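(* There is an algorithm that, given a 2-path graph $G$, determines $\#TDDP(G)$ in time linear in the number of vertices of $G$.
   Context: All graphs are finite, simple and connected. The diameter of $G$ is the greatest distance between any pair of vertices; a diametral path is a shortest path (in the graph-theoretic sense) connecting two vertices whose distance equals the diameter. Two paths are totally disjoint if they have no vertex in common, including their end vertices. $\#TDDP(G)$ denotes the maximum size of a set of pairwise totally disjoint diametral paths in $G$. A graph is outerplanar if it can be drawn in the plane without crossing edges and with all vertices on the exterior face. A maximal outerplanar graph (MOP) is an outerplanar graph such that adding any new edge destroys outerplanarity. A 2-path is a MOP having exactly two vertices of degree 2. Equivalently, a 2-path is built from the 4-cycle with one chord, whose two degree-2 vertices are called $v_l$ and $v_r$, by repeatedly adding a new vertex $u$ adjacent to the current $v_r$ and to one of the two neighbors of $v_r$; $u$ then becomes the new $v_r$. *)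

theory Defs
  imports Main
begin

section \<open>Graphs, diametral paths\<close>

text \<open>A graph is given by a vertex set \<open>V\<close> and a set \<open>E\<close> of two-element subsets of \<open>V\<close>.
  A path is the list of its vertices.\<close>

definition path_between :: "'a set \<Rightarrow> 'a set set \<Rightarrow> 'a \<Rightarrow> 'a list \<Rightarrow> 'a \<Rightarrow> bool" where
  "path_between V E u p v \<longleftrightarrow>
     p \<noteq> [] \<and> hd p = u \<and> last p = v \<and> set p \<subseteq> V \<and> distinct p \<and>
     successively (\<lambda>x y. {x, y} \<in> E) p"

text \<open>The length of a path is its number of edges. The distance is meaningful for connected
  graphs only.\<close>

definition gdist :: "'a set \<Rightarrow> 'a set set \<Rightarrow> 'a \<Rightarrow> 'a \<Rightarrow> nat" where
  "gdist V E u v = (LEAST k. \<exists>p. path_between V E u p v \<and> length p = Suc k)"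

definition diameter :: "'a set \<Rightarrow> 'a set set \<Rightarrow> nat" where
  "diameter V E = Max {gdist V E u v | u v. u \<in> V \<and> v \<in> V}"

definition diametral_path :: "'a set \<Rightarrow> 'a set set \<Rightarrow> 'a list \<Rightarrow> bool" where
  "diametral_path V E p \<longleftrightarrow>
     (\<exists>u\<in>V. \<exists>v\<in>V. gdist V E u v = diameter V E \<and>
        path_between V E u p v \<and> length p = Suc (gdist V E u v))"

text \<open>A path and its reversal are different lists, but they have common vertices and hence are
  never both counted.\<close>

definition num_TDDP :: "'a set \<Rightarrow> 'a set set \<Rightarrow> nat" where
  "num_TDDP V E =
     Max {card P | P. (\<forall>p\<in>P. diametral_path V E p) \<and>
                      pairwise (\<lambda>p q. set p \<inter> set q = {}) P}"


section \<open>2-paths\<close>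

text \<open>\<open>two_path_to V E r\<close>: the graph is a 2-path whose current vertex \<open>v\<^sub>r\<close> is \<open>r\<close>. In the base
  case the 4-cycle is \<open>l, x, r, y\<close> and the chord is \<open>{x, y}\<close>. A 2-path can
  equivalently be defined as a maximal outerplanar graph with exactly two vertices of degree 2.\<close>

inductive two_path_to :: "'a set \<Rightarrow> 'a set set \<Rightarrow> 'a \<Rightarrow> bool" where
  base: "distinct [l, x, y, r] \<Longrightarrow>
     two_path_to {l, x, y, r} {{l, x}, {x, r}, {r, y}, {y, l}, {x, y}} r"
| extend: "two_path_to V E r \<Longrightarrow> u \<notin> V \<Longrightarrow> {r, w} \<in> E \<Longrightarrow>
     two_path_to (insert u V) (E \<union> {{u, r}, {u, w}}) u"

definition two_path :: "'a set \<Rightarrow> 'a set set \<Rightarrow> bool" where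
  "two_path V E \<longleftrightarrow> (\<exists>r. two_path_to V E r)"


section \<open>A random access machine\<close>

text \<open>Programs are while-programs over finitely many registers and a random access memory; each
  assignment, memory access or test has cost 1. Every word is required to be smaller than a
  bound \<open>W\<close>; an operation whose result does not fit has no execution. With \<open>W\<close> polynomial in the
  input size, this is the word RAM with words of logarithmic length, and so the unit cost of
  additions cannot be abused to process long numbers. Registers and memory cells
  are indexed by natural numbers; the operands of instructions are register indices, apart from
  the constant in \<open>Const\<close>.\<close>

datatype rhs = Const nat | Reg nat | Add nat nat | Sub nat nat | Load nat

datatype prog =
    Skip
  | Assign nat rhs
  | Store nat nat
  | Seq prog prog
  | IfLess nat nat prog prog
  | WhileLess nat nat prog

type_synonym state = "(nat \<Rightarrow> nat) \<times> (nat \<Rightarrow> nat)"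

fun eval_rhs :: "rhs \<Rightarrow> state \<Rightarrow> nat" where
  "eval_rhs (Const k) (R, M) = k"
| "eval_rhs (Reg i) (R, M) = R i"
| "eval_rhs (Add i j) (R, M) = R i + R j"
| "eval_rhs (Sub i j) (R, M) = R i - R j"
| "eval_rhs (Load i) (R, M) = M (R i)"

text \<open>\<open>exec W c s t s'\<close>: started in state \<open>s\<close>, program \<open>c\<close> halts in state \<open>s'\<close> after \<open>t\<close> steps.\<close>

inductive exec :: "nat \<Rightarrow> prog \<Rightarrow> state \<Rightarrow> nat \<Rightarrow> state \<Rightarrow> bool" for W where
  Skip: "exec W Skip s 1 s"
| Assign: "eval_rhs e (R, M) < W \<Longrightarrow>
     exec W (Assign i e) (R, M) 1 (R(i := eval_rhs e (R, M)), M)"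
| Store: "R i < W \<Longrightarrow> R j < W \<Longrightarrow>
     exec W (Store i j) (R, M) 1 (R, M(R i := R j))"
| Seq: "exec W c1 s t1 s1 \<Longrightarrow> exec W c2 s1 t2 s2 \<Longrightarrow> exec W (Seq c1 c2) s (t1 + t2) s2"
| IfTrue: "R i < R j \<Longrightarrow> exec W c1 (R, M) t s \<Longrightarrow>
     exec W (IfLess i j c1 c2) (R, M) (Suc t) s"
| IfFalse: "\<not> R i < R j \<Longrightarrow> exec W c2 (R, M) t s \<Longrightarrow>
     exec W (IfLess i j c1 c2) (R, M) (Suc t) s"
| WhileFalse: "\<not> R i < R j \<Longrightarrow> exec W (WhileLess i j c) (R, M) 1 (R, M)"
| WhileTrue: "R i < R j \<Longrightarrow> exec W c (R, M) t1 s1 \<Longrightarrow> exec W (WhileLess i j c) s1 t2 s2 \<Longrightarrow>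
     exec W (WhileLess i j c) (R, M) (Suc (t1 + t2)) s2"

inductive_cases exec_elims:
  "exec W Skip s t s'"
  "exec W (Assign i e) s t s'"
  "exec W (Store i j) s t s'"
  "exec W (Seq c1 c2) s t s'"
  "exec W (IfLess i j c1 c2) s t s'"
  "exec W (WhileLess i j c) s t s'"

lemma exec_deterministic:
  "exec W c s t s' \<Longrightarrow> exec W c s u s'' \<Longrightarrow> u = t \<and> s'' = s'"
proof (induction arbitrary: u s'' rule: exec.induct)
  case (Skip s)
  then show ?case by (auto elim: exec_elims(1))
next
  case (Assign e R M i)
  from Assign.prems show ?case by (rule exec_elims(2)) simp
next
  case (Store R i j M)
  from Store.prems show ?case by (rule exec_elims(3)) simp
next
  case (Seq c1 s t1 s1 c2 t2 s2)
  from Seq.prems show ?case 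
  proof (rule exec_elims(4))
    fix u1 r1 u2
    assume u: "u = u1 + u2" and 1: "exec W c1 s u1 r1" and 2: "exec W c2 r1 u2 s''"
    from 1 have *: "u1 = t1 \<and> r1 = s1" by (rule Seq.IH(1))
    with 2 have "exec W c2 s1 u2 s''" by simp
    then have "u2 = t2 \<and> s'' = s2" by (rule Seq.IH(2))
    with * u show ?thesis by simp
  qed
next
  case (IfTrue R i j c1 M t s c2)
  from IfTrue.prems show ?case
    by (rule exec_elims(5)) (use IfTrue.hyps in \<open>simp_all add: IfTrue.IH\<close>)
next
  case (IfFalse R i j c2 M t s c1)
  from IfFalse.prems show ?case
    by (rule exec_elims(5)) (use IfFalse.hyps in \<open>simp_all add: IfFalse.IH\<close>)
next
  case (WhileFalse R i j c M)
  from WhileFalse.prems show ?case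
    by (rule exec_elims(6)) (use WhileFalse.hyps in auto)
next
  case (WhileTrue R i j c M t1 s1 t2 s2)
  from WhileTrue.prems show ?case
  proof (rule exec_elims(6))
    fix R' M' u1 r1 u2
    assume eq: "(R, M) = (R', M')" and u: "u = Suc (u1 + u2)"
      and 1: "exec W c (R', M') u1 r1" and 2: "exec W (WhileLess i j c) r1 u2 s''"
    from eq 1 have "exec W c (R, M) u1 r1" by simp
    then have *: "u1 = t1 \<and> r1 = s1" by (rule WhileTrue.IH(1))
    with 2 have "exec W (WhileLess i j c) s1 u2 s''" by simp
    then have "u2 = t2 \<and> s'' = s2" by (rule WhileTrue.IH(2))
    with * u show ?thesis by simp
  qed (use WhileTrue.hyps in simp)
qed

section \<open>Graphs as machine input\<close>

text \<open>The input graph has vertices \<open>0, \<dots>, n - 1\<close>, labelled arbitrarily, and is given by adjacency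
  lists, each in arbitrary order.\<close>

definition adjacency_lists :: "nat set \<Rightarrow> nat set set \<Rightarrow> nat list list \<Rightarrow> bool" where
  "adjacency_lists V E adj \<longleftrightarrow>
     V = {..<length adj} \<and>
     (\<forall>v\<in>V. distinct (adj ! v) \<and> set (adj ! v) = {w. {v, w} \<in> E})"

text \<open>Memory layout: cell \<open>0\<close> contains \<open>n\<close>; cells \<open>1, \<dots>, n + 1\<close> contain addresses such that the
  neighbours of vertex \<open>v\<close> are stored from the address in cell \<open>v + 1\<close> (inclusive) to the address
  in cell \<open>v + 2\<close> (exclusive). The concatenated adjacency lists follow from cell \<open>n + 2\<close> on.\<close>

definition input_words :: "nat list list \<Rightarrow> nat list" where
  "input_words adj =
     length adj #
     map (\<lambda>i. length adj + 2 + length (concat (take i adj))) [0..<Suc (length adj)] @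
     concat adj"

definition initial_state :: "nat list list \<Rightarrow> state" where
  "initial_state adj =
     (\<lambda>_. 0, \<lambda>a. if a < length (input_words adj) then input_words adj ! a else 0)"

end

theory Submission
  imports Defs
begin

text \<open>Let \<open>l\<close> and \<open>r\<close> be the two vertices of degree 2. Distances from a vertex grow monotonically along
  the strip, so the diameter is \<open>D = d(l, r)\<close>. If \<open>D = 2\<close>, the graph is a fan and the answer is
  \<open>n div 3\<close>. If \<open>D \<ge> 3\<close>, some edge between the two sides is met by all diametral paths, so the answer is
  1 or 2. Two disjoint diametral paths have to follow the two opposite sides as long as both are
  present, and counting vertices shows that they exist if and only if one of two conditions on the
  distances from \<open>l\<close> and to \<open>r\<close> holds, which are checked in a single pass. Peeling off the strip
  from \<open>l\<close> yields the sides and the distances from \<open>l\<close>; the distances to \<open>r\<close> follow in a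
  backward pass.\<close>



section \<open>Walks and distances\<close>

text \<open>Two vertices are adjacent exactly when their intervals of triangles meet, so separation
  and distance become comparisons of interval ends. This description is invariant under exchanging
  the sides and under reflection, so most arguments treat one of four orientations. The rung common
  to all diametral paths comes from Helly's theorem on the line: for a path from \<open>u\<close> on
  the left to \<open>v\<close> on the right, the gap from \<open>e u\<close> to \<open>s v\<close>
  is an interval, and for D \<ge> 3 any two such gaps meet. The reason is that a late start
  \<open>u'\<close> on one side, at distance D from r, leaves only the first vertex of the other
  side to bring l nearer to r; a larger delay would put this vertex at distance D as well. Counting
  works because both paths are locked to their sides on the rungs that both cross: each contains all
  side vertices there, but has only D + 1 vertices, while the arcs of the sides are themselves walks
  and so not shorter than D. The machine meets arbitrary labels and cannot delete from adjacency
  lists in constant time; it keeps only the number and the sum of the remaining neighbours. Such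
  sums reach the order of n^2, which is why the word bound has to exceed n^2.\<close>

definition walk :: "'a set \<Rightarrow> 'a set set \<Rightarrow> 'a \<Rightarrow> 'a list \<Rightarrow> 'a \<Rightarrow> bool" where
  "walk V E u p v \<longleftrightarrow>
     p \<noteq> [] \<and> hd p = u \<and> last p = v \<and> set p \<subseteq> V \<and> successively (\<lambda>x y. {x, y} \<in> E) p"

lemma path_between_iff_walk: "path_between V E u p v \<longleftrightarrow> walk V E u p v \<and> distinct p"
  by (auto simp: path_between_def walk_def)

lemma path_between_imp_walk: "path_between V E u p v \<Longrightarrow> walk V E u p v"
  by (simp add: path_between_iff_walk)

lemma walk_cut:
  assumes "walk V E u (xs @ [y] @ ys @ [y] @ zs) v" shows "walk V E u (xs @ [y] @ zs) v"
proof -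
  let ?R = "\<lambda>x y. {x, y} \<in> E"
  have s: "successively ?R (xs @ [y] @ ys @ [y] @ zs)" using assms by (simp add: walk_def)
  then have "successively ?R ((xs @ [y]) @ (ys @ [y] @ zs))" by simp
  then have "successively ?R (xs @ [y])" by (simp only: successively_append_iff)
  moreover have "successively ?R ((xs @ [y] @ ys) @ ([y] @ zs))" using s by simp
  then have "successively ?R ([y] @ zs)" by (simp only: successively_append_iff)
  ultimately have "successively ?R (xs @ [y] @ zs)"
    unfolding successively_append_iff by simp
  moreover have "hd (xs @ [y] @ zs) = u" using assms by (cases xs) (simp_all add: walk_def)
  moreover have "last (xs @ [y] @ zs) = v" using assms by (simp add: walk_def)
  ultimately show ?thesis using assms by (simp add: walk_def)
qed

lemma walk_imp_path:
  "walk V E u p v \<Longrightarrow> \<exists>q. path_between V E u q v \<and> length q \<le> length p"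
proof (induction "length p" arbitrary: p rule: less_induct)
  case less
  show ?case
  proof (cases "distinct p")
    case True
    then show ?thesis using less.prems by (auto simp: path_between_iff_walk intro!: exI[of _ p])
  next
    case False
    then obtain xs ys zs y where p: "p = xs @ [y] @ ys @ [y] @ zs"
      using not_distinct_decomp[OF False] by auto
    have w: "walk V E u (xs @ [y] @ zs) v"
      using less.prems unfolding p by (rule walk_cut)
    have l: "length (xs @ [y] @ zs) < length p" by (simp add: p)
    obtain q where "path_between V E u q v" "length q \<le> length (xs @ [y] @ zs)"
      using less.hyps[OF l w] by auto
    then show ?thesis using l by (intro exI[of _ q]) simp
  qed
qed

text \<open>Distances are defined by simple paths, but any walk bounds them, since loops can be cut
  out. Upper bounds may therefore come from concatenated walks whose vertices repeat.\<close>

lemma gdist_le_walk: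
  assumes "walk V E u p v" shows "Suc (gdist V E u v) \<le> length p"
proof -
  obtain q where q: "path_between V E u q v" "length q \<le> length p"
    using walk_imp_path[OF assms] by blast
  then obtain k where k: "length q = Suc k"
    by (cases q) (auto simp: path_between_def)
  then have "gdist V E u v \<le> k" unfolding gdist_def using q by (intro Least_le) blast
  then show ?thesis using k q by simp
qed

lemma walk_rev: "walk V E u p v \<Longrightarrow> walk V E v (rev p) u"
  unfolding walk_def by (simp add: hd_rev last_rev) (metis (no_types, lifting) insert_commute successively_mono)

lemma path_between_rev: "path_between V E u p v \<Longrightarrow> path_between V E v (rev p) u"
  by (simp add: path_between_iff_walk walk_rev)

lemma walk_append:
  assumes "walk V E u p v" "walk V E v q w" shows "walk V E u (p @ tl q) w"
proof -
  obtain q' where "q = v # q'" using assms(2) by (cases q) (auto simp: walk_def)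
  then show ?thesis using assms
    by (cases q') (auto simp: walk_def successively_append_iff successively_Cons)
qed

lemma walk_take:
  "walk V E u p v \<Longrightarrow> i < length p \<Longrightarrow> walk V E u (take (Suc i) p) (p ! i)"
proof -
  assume w: "walk V E u p v" and i: "i < length p"
  have "p = take (Suc i) p @ drop (Suc i) p" by simp
  then have "successively (\<lambda>x y. {x, y} \<in> E) (take (Suc i) p)"
    using w unfolding walk_def by (metis successively_append_iff)
  moreover have "last (take (Suc i) p) = p ! i" using i by (simp add: take_Suc_conv_app_nth)
  ultimately show ?thesis using w i set_take_subset[of "Suc i" p]
    by (auto simp: walk_def)
qed

lemma walk_drop:
  "walk V E u p v \<Longrightarrow> i < length p \<Longrightarrow> walk V E (p ! i) (drop i p) v"
proof -
  assume w: "walk V E u p v" and i: "i < length p"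
  have "p = take i p @ drop i p" by simp
  then have "successively (\<lambda>x y. {x, y} \<in> E) (drop i p)"
    using w unfolding walk_def by (metis successively_append_iff)
  then show ?thesis using w i set_drop_subset[of i p]
    by (auto simp: walk_def hd_drop_conv_nth)
qed

lemma walk_nth_edge:
  "walk V E u p v \<Longrightarrow> Suc i < length p \<Longrightarrow> {p ! i, p ! Suc i} \<in> E"
  by (auto simp: walk_def successively_conv_nth)

lemma walk_map:
  assumes "i \<le> k" "\<And>t. i \<le> t \<Longrightarrow> t \<le> k \<Longrightarrow> f t \<in> V"
    "\<And>t. i \<le> t \<Longrightarrow> t < k \<Longrightarrow> {f t, f (Suc t)} \<in> E"
  shows "walk V E (f i) (map f [i..<Suc k]) (f k)"
  using assms by (auto simp: walk_def successively_conv_nth hd_map last_map simp del: upt_Suc)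

section \<open>The graph metric and geodesics\<close>

locale connected_graph =
  fixes V :: "'a set" and E :: "'a set set"
  assumes finite_V: "finite V"
    and connected: "u \<in> V \<Longrightarrow> v \<in> V \<Longrightarrow> \<exists>p. walk V E u p v"
begin

abbreviation dist :: "'a \<Rightarrow> 'a \<Rightarrow> nat" where "dist \<equiv> gdist V E"

abbreviation geodesic :: "'a \<Rightarrow> 'a list \<Rightarrow> 'a \<Rightarrow> bool" where
  "geodesic u p v \<equiv> path_between V E u p v \<and> length p = Suc (dist u v)"

lemma ex_geodesic: "u \<in> V \<Longrightarrow> v \<in> V \<Longrightarrow> \<exists>p. geodesic u p v"
proof -
  assume "u \<in> V" "v \<in> V"
  then obtain p0 where "walk V E u p0 v" using connected by blast
  then obtain p where p: "path_between V E u p v" by (auto dest: walk_imp_path)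
  obtain k where "length p = Suc k" using p by (cases p) (auto simp: path_between_def)
  with p have "\<exists>k p. path_between V E u p v \<and> length p = Suc k" by blast
  then show ?thesis unfolding gdist_def by (rule LeastI_ex)
qed

lemma dist_sym_le: "u \<in> V \<Longrightarrow> v \<in> V \<Longrightarrow> dist u v \<le> dist v u"
proof -
  assume "u \<in> V" "v \<in> V"
  then obtain p where p: "geodesic v p u" using ex_geodesic by blast
  then have "walk V E u (rev p) v" by (intro walk_rev path_between_imp_walk) simp
  from gdist_le_walk[OF this] p show ?thesis by simp
qed

lemma dist_sym: "u \<in> V \<Longrightarrow> v \<in> V \<Longrightarrow> dist u v = dist v u"
  by (intro le_antisym dist_sym_le)

lemma dist_triangle: "u \<in> V \<Longrightarrow> v \<in> V \<Longrightarrow> w \<in> V \<Longrightarrow> dist u w \<le> dist u v + dist v w"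
proof -
  assume "u \<in> V" "v \<in> V" "w \<in> V"
  then obtain p q where p: "geodesic u p v" and q: "geodesic v q w" using ex_geodesic by blast
  then have "walk V E u (p @ tl q) w" by (intro walk_append path_between_imp_walk) auto
  from gdist_le_walk[OF this] p q show ?thesis by simp
qed

lemma dist_edge: "u \<in> V \<Longrightarrow> v \<in> V \<Longrightarrow> {u, v} \<in> E \<Longrightarrow> dist u v \<le> 1"
proof -
  assume "u \<in> V" "v \<in> V" "{u, v} \<in> E"
  then have "walk V E u [u, v] v" by (simp add: walk_def)
  from gdist_le_walk[OF this] show ?thesis by simp
qed

lemma dist_self [simp]: "u \<in> V \<Longrightarrow> dist u u = 0"
proof -
  assume "u \<in> V"
  then have "walk V E u [u] u" by (simp add: walk_def)
  from gdist_le_walk[OF this] show ?thesis by simp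
qed

lemma dist_eq_0: "u \<in> V \<Longrightarrow> v \<in> V \<Longrightarrow> dist u v = 0 \<Longrightarrow> u = v"
proof -
  assume "u \<in> V" "v \<in> V" "dist u v = 0"
  then obtain p where "geodesic u p v" using ex_geodesic by blast
  then show ?thesis using \<open>dist u v = 0\<close> by (cases p) (auto simp: path_between_def)
qed

lemma dist_eq_1: "u \<in> V \<Longrightarrow> v \<in> V \<Longrightarrow> dist u v = 1 \<Longrightarrow> {u, v} \<in> E"
proof -
  assume "u \<in> V" "v \<in> V" and d: "dist u v = 1"
  then obtain p where p: "geodesic u p v" using ex_geodesic by blast
  with d have "length p = 2" by simp
  then obtain x y where "p = [x, y]" by (auto simp: length_Suc_conv numeral_2_eq_2)
  then show ?thesis using p by (auto simp: path_between_def)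
qed

text \<open>Prefix and suffix bound the two distances from above, and the triangle inequality leaves
  no slack.\<close>

lemma geodesic_nth:
  assumes "geodesic u p v" "u \<in> V" "v \<in> V" "i < length p"
  shows "p ! i \<in> V" "dist u (p ! i) = i" "dist (p ! i) v = dist u v - i"
proof -
  have w: "walk V E u p v" using assms(1) by (auto dest: path_between_imp_walk)
  show V: "p ! i \<in> V" using w assms(4) nth_mem by (fastforce simp: walk_def)
  have 1: "dist u (p ! i) \<le> i" using gdist_le_walk[OF walk_take[OF w assms(4)]] assms(4) by simp
  have 2: "dist (p ! i) v \<le> dist u v - i"
    using gdist_le_walk[OF walk_drop[OF w assms(4)]] assms by simp
  have "dist u v \<le> dist u (p ! i) + dist (p ! i) v" using dist_triangle V assms by blast
  then show "dist u (p ! i) = i" "dist (p ! i) v = dist u v - i" using 1 2 assms by auto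
qed

lemma geodesic_mem:
  assumes "geodesic u p v" "u \<in> V" "v \<in> V" "x \<in> set p"
  shows "x \<in> V" "dist u x + dist x v = dist u v"
  using assms geodesic_nth[OF assms(1-3)] by (auto simp: in_set_conv_nth)

text \<open>A repeated vertex could be cut out, giving a walk shorter than the distance allows; so
  walks of minimal length need no separate check of distinctness.\<close>

lemma geodesicI:
  assumes "walk V E u p v" "length p = Suc (dist u v)"
  shows "geodesic u p v"
proof -
  have "distinct p"
  proof (rule ccontr)
    assume "\<not> distinct p"
    then obtain xs ys zs y where p: "p = xs @ [y] @ ys @ [y] @ zs"
      using not_distinct_decomp[of p] by auto
    have "walk V E u (xs @ [y] @ zs) v"
      using assms(1) unfolding p by (rule walk_cut)
    from gdist_le_walk[OF this] assms(2) show False by (simp add: p)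
  qed
  then show ?thesis using assms by (simp add: path_between_iff_walk)
qed

lemma dist_neighbour:
  assumes "u \<in> V" "v \<in> V" "u \<noteq> v"
  shows "\<exists>x\<in>V. {u, x} \<in> E \<and> dist u v = Suc (dist x v)"
proof -
  obtain p where p: "geodesic u p v" using ex_geodesic assms by blast
  have d: "dist u v \<noteq> 0" using dist_eq_0 assms by blast
  have w: "walk V E u p v" using p by (auto dest: path_between_imp_walk)
  have 0: "p ! 0 = u" using w hd_conv_nth[of p] by (auto simp: walk_def)
  have 1: "Suc 0 < length p" using p d by simp
  show ?thesis using walk_nth_edge[OF w 1] geodesic_nth[OF p assms(1,2) 1] 0 d by auto
qed

end


section \<open>Strips\<close>

text \<open>The outer cycle of a 2-path splits at the two vertices of degree 2 into the sides
  \<open>\<alpha>\<close> and \<open>\<beta>\<close>, which share only their end vertices. The edges between the sides are the rungs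
  \<open>{\<alpha> (a t), \<beta> (b t)}\<close>. The triangles are numbered from \<open>0\<close> to \<open>m + 1\<close>, rung \<open>t\<close> separates
  triangle \<open>t\<close> from triangle \<open>t + 1\<close>, and \<open>s x\<close> and \<open>e x\<close> are the first and the last triangle
  containing \<open>x\<close>. This is an interval representation of the graph.\<close>

locale strip =
  fixes V :: "'a set" and E :: "'a set set" and \<alpha> \<beta> :: "nat \<Rightarrow> 'a" and a b :: "nat \<Rightarrow> nat"
    and p q m :: nat and s e :: "'a \<Rightarrow> nat"
  assumes V_eq: "V = \<alpha> ` {..Suc p} \<union> \<beta> ` {..Suc q}"
    and left_end: "\<alpha> 0 = \<beta> 0" and right_end: "\<alpha> (Suc p) = \<beta> (Suc q)"
    and inj_\<alpha>: "inj_on \<alpha> {..Suc p}" and inj_\<beta>: "inj_on \<beta> {..Suc q}"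
    and sides: "i \<le> Suc p \<Longrightarrow> j \<le> Suc q \<Longrightarrow> \<alpha> i = \<beta> j \<Longrightarrow>
      i = 0 \<and> j = 0 \<or> i = Suc p \<and> j = Suc q"
    and a_0: "a 0 = 1" and b_0: "b 0 = 1" and a_m: "a m = p" and b_m: "b m = q"
    and step: "t < m \<Longrightarrow> a (Suc t) = Suc (a t) \<and> b (Suc t) = b t \<or>
      a (Suc t) = a t \<and> b (Suc t) = Suc (b t)"
    and adj: "{x, y} \<in> E \<longleftrightarrow> x \<in> V \<and> y \<in> V \<and> x \<noteq> y \<and> s x \<le> e y \<and> s y \<le> e x"
    and s_\<alpha>: "i \<le> Suc p \<Longrightarrow> t \<le> m \<Longrightarrow> s (\<alpha> i) \<le> t \<longleftrightarrow> i \<le> a t"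
    and e_\<alpha>: "i \<le> Suc p \<Longrightarrow> t \<le> m \<Longrightarrow> t < e (\<alpha> i) \<longleftrightarrow> a t \<le> i"
    and s_\<beta>: "j \<le> Suc q \<Longrightarrow> t \<le> m \<Longrightarrow> s (\<beta> j) \<le> t \<longleftrightarrow> j \<le> b t"
    and e_\<beta>: "j \<le> Suc q \<Longrightarrow> t \<le> m \<Longrightarrow> t < e (\<beta> j) \<longleftrightarrow> b t \<le> j"
    and s_le: "x \<in> V \<Longrightarrow> s x \<le> Suc m" and e_le: "x \<in> V \<Longrightarrow> e x \<le> Suc m"
begin

text \<open>First symmetry: exchanging the sides leaves intervals and edges unchanged, so each fact
  about \<open>\<alpha>\<close> has a copy for \<open>\<beta>\<close>.\<close>

lemma swap: "strip V E \<beta> \<alpha> b a q p m s e"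
proof (unfold_locales, goal_cases)
  case (6 i j)
  then show ?case using sides[of j i] by auto
next
  case (11 t)
  then show ?case using step by auto
qed (use V_eq left_end right_end inj_\<alpha> inj_\<beta> a_0 b_0 a_m b_m adj s_\<alpha> e_\<alpha> s_\<beta> e_\<beta> s_le e_le in auto)

lemma mono_a: "t \<le> t' \<Longrightarrow> t' \<le> m \<Longrightarrow> a t \<le> a t'"
proof (induction t' rule: dec_induct)
  case (step k)
  then show ?case using strip.step[OF strip_axioms, of k] by auto
qed simp

lemma a_bounds: "t \<le> m \<Longrightarrow> 1 \<le> a t" "t \<le> m \<Longrightarrow> a t \<le> p"
  using mono_a[of 0 t] mono_a[of t m] a_0 a_m by auto

lemma b_bounds: "t \<le> m \<Longrightarrow> 1 \<le> b t" "t \<le> m \<Longrightarrow> b t \<le> q"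
  using strip.a_bounds[OF swap] by auto

lemma p_ge_1: "1 \<le> p" and q_ge_1: "1 \<le> q"
  using a_bounds[of m] b_bounds[of m] by auto

text \<open>Each rung advances exactly one of the two sides by one vertex, starting from 1 +
  1.\<close>

lemma a_plus_b: "t \<le> m \<Longrightarrow> a t + b t = t + 2"
proof (induction t)
  case (Suc t)
  then show ?case using step[of t] by auto
qed (simp add: a_0 b_0)

lemma p_plus_q: "p + q = m + 2"
  using a_plus_b[of m] a_m b_m by simp

text \<open>Discrete intermediate values: \<open>a\<close> grows by at most one per rung, so no side
  vertex is skipped.\<close>

lemma ex_a_between:
  "t0 \<le> t1 \<Longrightarrow> t1 \<le> m \<Longrightarrow> a t0 \<le> i \<Longrightarrow> i \<le> a t1 \<Longrightarrow> \<exists>t. t0 \<le> t \<and> t \<le> t1 \<and> a t = i"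
proof (induction t1 rule: dec_induct)
  case (step k)
  show ?case
  proof (cases "i \<le> a k")
    case True
    then show ?thesis using step by fastforce
  next
    case False
    then have "a (Suc k) = i" using strip.step[OF strip_axioms, of k] step by auto
    then show ?thesis using step by (intro exI[of _ "Suc k"]) auto
  qed
qed auto

lemma ex_a: "1 \<le> i \<Longrightarrow> i \<le> p \<Longrightarrow> \<exists>t\<le>m. a t = i"
  using ex_a_between[of 0 m i] a_0 a_m by auto

lemma \<alpha>_in [simp, intro]: "i \<le> Suc p \<Longrightarrow> \<alpha> i \<in> V"
  and \<beta>_in [simp, intro]: "j \<le> Suc q \<Longrightarrow> \<beta> j \<in> V"
  by (auto simp: V_eq)

lemma V_cases:
  assumes "x \<in> V"
  obtains (left) "x = \<alpha> 0" | (right) "x = \<alpha> (Suc p)"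
    | (A) i where "1 \<le> i" "i \<le> p" "x = \<alpha> i" | (B) j where "1 \<le> j" "j \<le> q" "x = \<beta> j"
proof -
  consider i where "i \<le> Suc p" "x = \<alpha> i" | j where "j \<le> Suc q" "x = \<beta> j"
    using assms by (auto simp: V_eq)
  then show thesis
  proof cases
    case 1
    then consider "i = 0" | "i = Suc p" | "1 \<le> i" "i \<le> p" by linarith
    then show ?thesis using 1 that by cases auto
  next
    case 2
    then consider "j = 0" | "j = Suc q" | "1 \<le> j" "j \<le> q" by linarith
    then show ?thesis using 2 that left_end right_end by cases auto
  qed
qed

lemma s_left [simp]: "s (\<alpha> 0) = 0" and e_left [simp]: "e (\<alpha> 0) = 0"
  using s_\<alpha>[of 0 0] e_\<alpha>[of 0 0] a_0 by auto

lemma s_right [simp]: "s (\<alpha> (Suc p)) = Suc m" and e_right [simp]: "e (\<alpha> (Suc p)) = Suc m"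
  using s_\<alpha>[of "Suc p" m] e_\<alpha>[of "Suc p" m] a_m s_le[of "\<alpha> (Suc p)"] e_le[of "\<alpha> (Suc p)"]
  by auto

lemma s_less_e_\<alpha>: "1 \<le> i \<Longrightarrow> i \<le> p \<Longrightarrow> s (\<alpha> i) < e (\<alpha> i) \<and> s (\<alpha> i) \<le> m"
proof -
  assume i: "1 \<le> i" "i \<le> p"
  then obtain t where "t \<le> m" "a t = i" using ex_a by blast
  then show ?thesis using i s_\<alpha>[of i t] e_\<alpha>[of i t] by auto
qed

lemma s_less_e_\<beta>: "1 \<le> j \<Longrightarrow> j \<le> q \<Longrightarrow> s (\<beta> j) < e (\<beta> j) \<and> s (\<beta> j) \<le> m"
  using strip.s_less_e_\<alpha>[OF swap] .

lemma s_le_e: "x \<in> V \<Longrightarrow> s x \<le> e x"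
  by (erule V_cases) (use s_less_e_\<alpha> s_less_e_\<beta> in \<open>auto simp: less_imp_le\<close>)

lemma s_less_e: "x \<in> V \<Longrightarrow> x \<noteq> \<alpha> 0 \<Longrightarrow> x \<noteq> \<alpha> (Suc p) \<Longrightarrow> s x < e x"
  by (erule V_cases) (use s_less_e_\<alpha> s_less_e_\<beta> in auto)

lemma e_left_iff: "x \<in> V \<Longrightarrow> e x = 0 \<longleftrightarrow> x = \<alpha> 0"
  by (erule V_cases) (use s_less_e_\<alpha> s_less_e_\<beta> in fastforce)+

lemma s_right_iff: "x \<in> V \<Longrightarrow> s x = Suc m \<longleftrightarrow> x = \<alpha> (Suc p)"
  by (erule V_cases) (use s_less_e_\<alpha> s_less_e_\<beta> in fastforce)+

text \<open>Translates interval bounds back into vertices: spanning the triangles \<open>t\<close>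
  and \<open>t + 1\<close> means being an end of the rung between them. Crossing arguments end here
  with two candidates.\<close>

lemma rung_iff:
  assumes "x \<in> V" "t \<le> m"
  shows "s x \<le> t \<and> t < e x \<longleftrightarrow> x = \<alpha> (a t) \<or> x = \<beta> (b t)"
proof -
  note ab = a_bounds[OF assms(2)] b_bounds[OF assms(2)]
  have r: "s (\<alpha> (a t)) \<le> t" "t < e (\<alpha> (a t))" "s (\<beta> (b t)) \<le> t" "t < e (\<beta> (b t))"
    using s_\<alpha>[of "a t" t] e_\<alpha>[of "a t" t] s_\<beta>[of "b t" t] e_\<beta>[of "b t" t] ab assms by auto
  show ?thesis
    using assms(1)
  proof (cases rule: V_cases)
    case (A i)
    then show ?thesis using s_\<alpha>[of i t] e_\<alpha>[of i t] assms r by auto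
  next
    case (B j)
    then show ?thesis using s_\<beta>[of j t] e_\<beta>[of j t] assms r by auto
  next
    case left
    then show ?thesis using r e_left by (metis not_less0)
  next
    case right
    then show ?thesis using r s_right assms(2) by (metis not_less_eq_eq order_refl order_trans)
  qed
qed

lemma rung_mem: "t \<le> m \<Longrightarrow> \<alpha> (a t) \<in> V" "t \<le> m \<Longrightarrow> \<beta> (b t) \<in> V"
  using a_bounds[of t] b_bounds[of t] by auto

lemma rung_distinct: "t \<le> m \<Longrightarrow> \<alpha> (a t) \<noteq> \<beta> (b t)"
  using a_bounds[of t] b_bounds[of t] sides[of "a t" "b t"] by auto

text \<open>Passing rung \<open>t\<close> adds one vertex, the end of the next rung that moved.
  Hence starts are distinct except in triangle 0, which contributes three vertices; this is why
  \<open>s_inj\<close> asks for a positive start.\<close>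

lemma s_Suc_iff:
  assumes "x \<in> V" "t < m"
  shows "s x = Suc t \<longleftrightarrow> x = (if a (Suc t) = Suc (a t) then \<alpha> (a (Suc t)) else \<beta> (b (Suc t)))"
    (is "_ \<longleftrightarrow> x = ?z")
proof -
  have t: "t \<le> m" "Suc t \<le> m" using assms by auto
  note ab = a_bounds[OF t(1)] b_bounds[OF t(1)] a_bounds[OF t(2)] b_bounds[OF t(2)]
  have "s x = Suc t \<longleftrightarrow> s x \<le> Suc t \<and> \<not> s x \<le> t" by auto
  also have "\<dots> \<longleftrightarrow> x = ?z"
    using assms(1)
  proof (cases rule: V_cases)
    case (A i)
    have "\<alpha> i = \<alpha> (a (Suc t)) \<longleftrightarrow> i = a (Suc t)" using inj_onD[OF inj_\<alpha>] A ab by auto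
    moreover have "\<alpha> i \<noteq> \<beta> (b (Suc t))" using sides[of i "b (Suc t)"] A ab by auto
    ultimately show ?thesis
      using A t s_\<alpha>[of i t] s_\<alpha>[of i "Suc t"] step[OF assms(2)]
      by (cases "a (Suc t) = Suc (a t)") auto
  next
    case (B j)
    have "\<beta> j = \<beta> (b (Suc t)) \<longleftrightarrow> j = b (Suc t)" using inj_onD[OF inj_\<beta>] B ab by auto
    moreover have "\<beta> j \<noteq> \<alpha> (a (Suc t))" using sides[of "a (Suc t)" j] B ab by auto
    ultimately show ?thesis
      using B t s_\<beta>[of j t] s_\<beta>[of j "Suc t"] step[OF assms(2)]
      by (cases "a (Suc t) = Suc (a t)") auto
  next
    case left
    then show ?thesis using sides[of 0 "b (Suc t)"] inj_onD[OF inj_\<alpha>, of 0 "a (Suc t)"] ab by auto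
  next
    case right
    then show ?thesis
      using sides[of "Suc p" "b (Suc t)"] inj_onD[OF inj_\<alpha>, of "Suc p" "a (Suc t)"] ab t by auto
  qed
  finally show ?thesis .
qed

lemma s_inj: "x \<in> V \<Longrightarrow> y \<in> V \<Longrightarrow> s x = s y \<Longrightarrow> 0 < s x \<Longrightarrow> x = y"
proof -
  assume xy: "x \<in> V" "y \<in> V" and s: "s x = s y" "0 < s x"
  show "x = y"
  proof (cases "s x = Suc m")
    case True
    then show ?thesis using s_right_iff xy s by metis
  next
    case False
    then obtain t where "s x = Suc t" "t < m" using s s_le[OF xy(1)] by (cases "s y") auto
    then show ?thesis using s_Suc_iff[OF xy(1)] s_Suc_iff[OF xy(2)] s by metis
  qed
qed

text \<open>Intervals of consecutive vertices meet, so a walk cannot jump: if the current interval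
  ends before \<open>t'\<close>, the next one begins at \<open>t\<close> or earlier. With
  \<open>t' = t + 1\<close> the walk crosses a rung, with \<open>t' = t\<close> it visits a
  triangle.\<close>

lemma walk_crosses:
  assumes "walk V E u xs v" "s u \<le> t" "t' \<le> e v" "t' \<le> Suc t"
  shows "\<exists>z\<in>set xs. s z \<le> t \<and> t' \<le> e z"
  using assms
proof (induction xs arbitrary: u)
  case (Cons x xs)
  have x: "x = u" using Cons.prems by (simp add: walk_def)
  show ?case
  proof (cases "t' \<le> e u")
    case True
    then show ?thesis using x Cons.prems by auto
  next
    case False
    then have ne: "xs \<noteq> []" using Cons.prems by (auto simp: walk_def)
    then have w: "walk V E (hd xs) xs v" and edge: "{u, hd xs} \<in> E"
      using Cons.prems by (auto simp: walk_def successively_Cons)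
    have "s (hd xs) \<le> t" using edge False Cons.prems(4) by (auto simp: adj)
    then show ?thesis using Cons.IH[OF w _ Cons.prems(3,4)] by auto
  qed
qed (simp add: walk_def)

lemma walk_crosses_rung:
  assumes "walk V E u xs v" "s u \<le> t" "t < e v"
  shows "\<exists>z\<in>set xs. s z \<le> t \<and> t < e z"
  using walk_crosses[of u xs v t "Suc t"] assms by (simp add: Suc_le_eq)

lemma \<alpha>_edge: "i \<le> p \<Longrightarrow> {\<alpha> i, \<alpha> (Suc i)} \<in> E"
proof -
  assume i: "i \<le> p"
  have "s (\<alpha> i) \<le> e (\<alpha> (Suc i))"
  proof (rule ccontr)
    assume *: "\<not> ?thesis"
    define t where "t = e (\<alpha> (Suc i))"
    have "t \<le> m" using * s_le[of "\<alpha> i"] i by (simp add: t_def)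
    then show False using * s_\<alpha>[of i t] e_\<alpha>[of "Suc i" t] i by (auto simp: t_def)
  qed
  moreover have "s (\<alpha> (Suc i)) \<le> e (\<alpha> i)"
  proof (rule ccontr)
    assume *: "\<not> ?thesis"
    define t where "t = e (\<alpha> i)"
    have "t \<le> m" using * s_le[of "\<alpha> (Suc i)"] i by (simp add: t_def)
    then show False using * s_\<alpha>[of "Suc i" t] e_\<alpha>[of i t] i by (auto simp: t_def)
  qed
  moreover have "\<alpha> i \<noteq> \<alpha> (Suc i)" using inj_onD[OF inj_\<alpha>, of i "Suc i"] i by auto
  ultimately show ?thesis using i by (simp add: adj)
qed

lemma \<beta>_edge: "j \<le> q \<Longrightarrow> {\<beta> j, \<beta> (Suc j)} \<in> E"
  using strip.\<alpha>_edge[OF swap] .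

lemma \<alpha>_walk: "i \<le> k \<Longrightarrow> k \<le> Suc p \<Longrightarrow> walk V E (\<alpha> i) (map \<alpha> [i..<Suc k]) (\<alpha> k)"
  by (rule walk_map) (auto simp: \<alpha>_edge)

lemma \<beta>_walk: "j \<le> k \<Longrightarrow> k \<le> Suc q \<Longrightarrow> walk V E (\<beta> j) (map \<beta> [j..<Suc k]) (\<beta> k)"
  using strip.\<alpha>_walk[OF swap] .

end

sublocale strip \<subseteq> connected_graph V E
proof
  show "finite V" by (simp add: V_eq)
next
  fix u v assume "u \<in> V" "v \<in> V"
  have from_left: "\<exists>xs. walk V E (\<alpha> 0) xs x" if "x \<in> V" for x
    using that \<alpha>_walk[of 0] \<beta>_walk[of 0] left_end by (auto simp: V_eq)
  then obtain xs ys where "walk V E (\<alpha> 0) xs u" "walk V E (\<alpha> 0) ys v"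
    using \<open>u \<in> V\<close> \<open>v \<in> V\<close> by blast
  then show "\<exists>zs. walk V E u zs v" by (meson walk_append walk_rev)
qed


section \<open>Reflection, distances and the diameter of a strip\<close>

context strip
begin

text \<open>Second symmetry: reading both sides and the rungs backwards exchanges starts and ends of
  intervals. What holds at the left end transfers to the right end.\<close>

lemma mirror:
  "strip V E (\<lambda>i. \<alpha> (Suc p - i)) (\<lambda>j. \<beta> (Suc q - j)) (\<lambda>t. Suc p - a (m - t))
    (\<lambda>t. Suc q - b (m - t)) p q m (\<lambda>x. Suc m - e x) (\<lambda>x. Suc m - s x)"
proof -
  have refl_image: "(\<lambda>i. f (k - i)) ` {..k} = f ` {..k}" for f :: "nat \<Rightarrow> 'a" and k :: nat
  proof -
    have "f x \<in> (\<lambda>i. f (k - i)) ` {..k}" if "x \<le> k" for x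
      by (rule image_eqI[of _ _ "k - x"]) (use that in simp_all)
    then show ?thesis by auto
  qed
  have refl_inj: "inj_on f {..k} \<Longrightarrow> inj_on (\<lambda>i. f (k - i)) {..k}" for f :: "nat \<Rightarrow> 'a" and k :: nat
  proof (rule inj_onI)
    fix x y assume f: "inj_on f {..k}" and xy: "x \<in> {..k}" "y \<in> {..k}" "f (k - x) = f (k - y)"
    then have "k - x = k - y" using inj_onD[OF f xy(3)] by auto
    then show "x = y" using xy by auto
  qed
  have flip1: "Suc m - x \<le> t \<longleftrightarrow> m - t < x" if "t \<le> m" for x t using that by arith
  have flip2: "i \<le> Suc k - y \<longleftrightarrow> y \<le> Suc k - i" if "y \<le> k" "i \<le> Suc k" for i k y using that by arith
  have flip3: "t < Suc m - x \<longleftrightarrow> x \<le> m - t" if "t \<le> m" for x t using that by arith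
  have flip4: "Suc k - y \<le> i \<longleftrightarrow> Suc k - i \<le> y" for i k y :: nat by arith
  show ?thesis
  proof (unfold_locales, goal_cases)
    case 1
    then show ?case unfolding refl_image by (rule V_eq)
  next
    case (6 i j)
    then show ?case using sides[of "Suc p - i" "Suc q - j"] by auto
  next
    case (11 t)
    define n where "n = m - Suc t"
    have n: "m - t = Suc n" "n < m" "Suc n \<le> m" using 11 by (auto simp: n_def)
    show ?case unfolding n(1) n_def[symmetric]
      using step[OF n(2)] a_bounds[OF n(3)] b_bounds[OF n(3)] by (elim disjE conjE) auto
  next
    case (12 x y)
    have "s y \<le> e x \<longleftrightarrow> Suc m - e x \<le> Suc m - s y" if "x \<in> V" "y \<in> V" for x y
      using that s_le[of y] e_le[of x] by auto
    then show ?case using adj[of x y] by auto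
  next
    case (13 i t)
    then show ?case using e_\<alpha>[of "Suc p - i" "m - t"] a_bounds[of "m - t"] flip2[of "a (m - t)" p i]
      by (simp add: flip1)
  next
    case (14 i t)
    then show ?case using s_\<alpha>[of "Suc p - i" "m - t"] a_bounds[of "m - t"] flip4[of p "a (m - t)" i]
      by (simp add: flip3)
  next
    case (15 i t)
    then show ?case using e_\<beta>[of "Suc q - i" "m - t"] b_bounds[of "m - t"] flip2[of "b (m - t)" q i]
      by (simp add: flip1)
  next
    case (16 i t)
    then show ?case using s_\<beta>[of "Suc q - i" "m - t"] b_bounds[of "m - t"] flip4[of q "b (m - t)" i]
      by (simp add: flip3)
  qed (use left_end right_end refl_inj inj_\<alpha> inj_\<beta> a_0 b_0 a_m b_m in auto)
qed

abbreviation D :: nat where "D \<equiv> dist (\<alpha> 0) (\<alpha> (Suc p))"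

lemma e_inj: "x \<in> V \<Longrightarrow> y \<in> V \<Longrightarrow> e x = e y \<Longrightarrow> e x \<le> m \<Longrightarrow> x = y"
  using strip.s_inj[OF mirror, of x y] by auto

lemma dist_le_1: "x \<in> V \<Longrightarrow> y \<in> V \<Longrightarrow> s x \<le> e y \<Longrightarrow> s y \<le> e x \<Longrightarrow> dist x y \<le> 1"
  using dist_edge[of x y] adj[of x y] by (cases "x = y") auto

lemma dist_ge_2:
  assumes "u \<in> V" "v \<in> V" "e u < s v" shows "2 \<le> dist u v"
proof -
  have "u \<noteq> v" using assms s_le_e[of u] by auto
  moreover have "{u, v} \<notin> E" using assms by (simp add: adj)
  ultimately have "dist u v \<noteq> 0" "dist u v \<noteq> 1" using dist_eq_0 dist_eq_1 assms by blast+
  then show ?thesis by linarith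
qed

text \<open>A path from \<open>u\<close> to \<open>y'\<close> meets the triangle in which \<open>y\<close> appears, in a vertex other
  than \<open>y'\<close>.\<close>

lemma dist_mono:
  assumes "u \<in> V" "y \<in> V" "y' \<in> V" "s u \<le> s y" "s y < s y'"
  shows "dist u y \<le> dist u y'"
proof -
  obtain xs where xs: "geodesic u xs y'" using ex_geodesic assms by blast
  have "s y \<le> e y'" using assms s_le_e[of y'] by simp
  then obtain z where z: "z \<in> set xs" "s z \<le> s y" "s y \<le> e z"
    using walk_crosses[of u xs y' "s y" "s y"] xs assms by (auto dest: path_between_imp_walk)
  note zz = geodesic_mem[OF xs assms(1,3) z(1)]
  have "z \<noteq> y'" using z assms by auto
  then have "dist z y' \<noteq> 0" using dist_eq_0 zz assms by blast
  moreover have "dist z y \<le> 1" using dist_le_1[of z y] z zz assms s_le_e[of y] by simp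
  moreover have "dist u y \<le> dist u z + dist z y" using dist_triangle zz assms by blast
  ultimately show ?thesis using zz by linarith
qed

lemma dist_mono':
  assumes "u \<in> V" "y \<in> V" "y' \<in> V" "e y \<le> e u" "e y' < e y"
  shows "dist u y \<le> dist u y'"
  using strip.dist_mono[OF mirror, of u y y'] assms e_le[of y] by auto

text \<open>Distances do not shrink when an end moves outwards. For \<open>s u \<le> s v\<close>,
  the end \<open>v\<close> can be moved to r by \<open>dist_mono\<close>, then \<open>u\<close> to l
  by its mirror image; the other order of starts follows by symmetry of the distance.\<close>

lemma dist_le_D:
  assumes "u \<in> V" "v \<in> V" shows "dist u v \<le> D"
proof -
  have left: "dist u (\<alpha> (Suc p)) \<le> D" if "u \<in> V" for u
  proof (cases "u = \<alpha> 0")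
    case False
    then have "e (\<alpha> 0) < e u" using e_left_iff[OF that] by simp
    then have "dist (\<alpha> (Suc p)) u \<le> dist (\<alpha> (Suc p)) (\<alpha> 0)"
      using dist_mono'[of "\<alpha> (Suc p)" u "\<alpha> 0"] that e_le[OF that] by auto
    then show ?thesis using dist_sym that by auto
  qed simp
  have *: "dist u v \<le> D" if "u \<in> V" "v \<in> V" "s u \<le> s v" for u v
  proof (cases "v = \<alpha> (Suc p)")
    case True
    then show ?thesis using left that by simp
  next
    case False
    then have "s v < s (\<alpha> (Suc p))" using s_right_iff[OF that(2)] s_le[OF that(2)] by simp
    then have "dist u v \<le> dist u (\<alpha> (Suc p))" using dist_mono[of u v] that by simp
    then show ?thesis using left[OF that(1)] by linarith
  qed
  show ?thesis using *[OF assms] *[OF assms(2,1)] dist_sym[OF assms] by linarith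
qed

lemma diameter_eq: "diameter V E = D"
  unfolding diameter_def
proof (rule Max_eqI)
  have "{gdist V E u v |u v. u \<in> V \<and> v \<in> V} = (\<lambda>(u, v). gdist V E u v) ` (V \<times> V)" by auto
  then show "finite {gdist V E u v |u v. u \<in> V \<and> v \<in> V}" using finite_V by simp
next
  fix k assume "k \<in> {gdist V E u v |u v. u \<in> V \<and> v \<in> V}"
  then show "k \<le> D" using dist_le_D by auto
next
  show "D \<in> {gdist V E u v |u v. u \<in> V \<and> v \<in> V}" by blast
qed

lemma D_ge_2: "2 \<le> D"
  by (rule dist_ge_2) auto

lemma D_le: "D \<le> Suc p"
  using gdist_le_walk[OF \<alpha>_walk[of 0 "Suc p"]] by simp

text \<open>If \<open>dist u v\<close> is already maximal, moving \<open>v\<close> outwards to r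
  keeps it so. Diametral pairs can thus be compared through distances to the two ends of the
  strip.\<close>

lemma diametral_left: "u \<in> V \<Longrightarrow> v \<in> V \<Longrightarrow> dist u v = D \<Longrightarrow> e u < s v \<Longrightarrow> dist u (\<alpha> (Suc p)) = D"
proof -
  assume *: "u \<in> V" "v \<in> V" "dist u v = D" "e u < s v"
  have "D \<le> dist u (\<alpha> (Suc p))"
  proof (cases "v = \<alpha> (Suc p)")
    case False
    then have "s v < s (\<alpha> (Suc p))" using s_right_iff[OF *(2)] s_le[OF *(2)] by simp
    then show ?thesis using dist_mono[of u v "\<alpha> (Suc p)"] * s_le_e[of u] by simp
  qed (use * in simp)
  then show ?thesis using dist_le_D[of u "\<alpha> (Suc p)"] * by simp
qed

lemma diametral_right: "u \<in> V \<Longrightarrow> v \<in> V \<Longrightarrow> dist u v = D \<Longrightarrow> e u < s v \<Longrightarrow> dist (\<alpha> 0) v = D"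
proof -
  assume *: "u \<in> V" "v \<in> V" "dist u v = D" "e u < s v"
  have D: "dist v u = D" "dist (\<alpha> (Suc p)) (\<alpha> 0) = D" using * dist_sym by auto
  have "dist v (\<alpha> 0) = dist (\<alpha> (Suc p)) (\<alpha> 0)"
    using strip.diametral_left[OF mirror, of v u] * D s_le[of v] by auto
  then show ?thesis using D * dist_sym by auto
qed

text \<open>A path from l to a vertex that first appears in triangle \<open>t + 1\<close> crosses
  rung \<open>t\<close>, and both ends of that rung lie in this triangle, next to \<open>z\<close>.
  This is the recurrence that the forward pass evaluates.\<close>

lemma dist_left_Suc:
  assumes "z \<in> V" "t \<le> m" "s z = Suc t"
  shows "dist (\<alpha> 0) z = Suc (min (dist (\<alpha> 0) (\<alpha> (a t))) (dist (\<alpha> 0) (\<beta> (b t))))"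
proof -
  have le: "dist (\<alpha> 0) z \<le> Suc (dist (\<alpha> 0) x)" if "x \<in> V" "s x \<le> t" "t < e x" for x
  proof -
    have "dist x z \<le> 1" using dist_le_1[of x z] that assms s_le_e[of z] by simp
    then show ?thesis using dist_triangle[of "\<alpha> 0" x z] that assms by simp
  qed
  note r = rung_mem[OF assms(2)] rung_iff[OF rung_mem(1)[OF assms(2)] assms(2)]
    rung_iff[OF rung_mem(2)[OF assms(2)] assms(2)]
  obtain xs where xs: "geodesic (\<alpha> 0) xs z" using ex_geodesic assms by blast
  obtain w where w: "w \<in> set xs" "s w \<le> t" "t < e w"
    using walk_crosses_rung[of "\<alpha> 0" xs z t] xs assms s_le_e[of z] by (auto dest: path_between_imp_walk)
  note ww = geodesic_mem[OF xs _ assms(1) w(1)]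
  have "w \<noteq> z" using w assms by auto
  then have "dist w z \<noteq> 0" using dist_eq_0 ww assms by blast
  then have "Suc (dist (\<alpha> 0) w) \<le> dist (\<alpha> 0) z" using ww by simp
  moreover have "w = \<alpha> (a t) \<or> w = \<beta> (b t)" using rung_iff[of w t] ww w assms by simp
  ultimately show ?thesis using le[of "\<alpha> (a t)"] le[of "\<beta> (b t)"] r by auto
qed

text \<open>The reflected recurrence, evaluated by the backward pass.\<close>

lemma dist_right_Suc:
  assumes "z \<in> V" "t \<le> m" "e z = t"
  shows "dist z (\<alpha> (Suc p)) =
    Suc (min (dist (\<alpha> (a t)) (\<alpha> (Suc p))) (dist (\<beta> (b t)) (\<alpha> (Suc p))))"
proof -
  have eq: "Suc p - (Suc p - a t) = a t" "Suc q - (Suc q - b t) = b t"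
    using a_bounds[OF assms(2)] b_bounds[OF assms(2)] by auto
  note r = rung_mem[OF assms(2)]
  show ?thesis using strip.dist_left_Suc[OF mirror, of z "m - t"] assms dist_sym[of z "\<alpha> (Suc p)"]
      dist_sym[OF r(1), of "\<alpha> (Suc p)"] dist_sym[OF r(2), of "\<alpha> (Suc p)"]
    by (simp add: eq)
qed

lemma dist_left_1: "dist (\<alpha> 0) (\<alpha> 1) = 1"
proof -
  have p: "1 \<le> Suc p" "0 \<le> p" by auto
  have "{\<alpha> 0, \<alpha> 1} \<in> E" using \<alpha>_edge[of 0] by simp
  then have "dist (\<alpha> 0) (\<alpha> 1) \<le> 1" by (intro dist_edge) (auto simp: p)
  moreover have "\<alpha> 0 \<noteq> \<alpha> 1" using inj_onD[OF inj_\<alpha>, of 0 1] by auto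
  then have "dist (\<alpha> 0) (\<alpha> 1) \<noteq> 0" using dist_eq_0[of "\<alpha> 0" "\<alpha> 1"] by auto
  ultimately show ?thesis by linarith
qed

lemma dist_right_1: "dist (\<alpha> p) (\<alpha> (Suc p)) = 1"
  using strip.dist_left_1[OF mirror] dist_sym[of "\<alpha> p" "\<alpha> (Suc p)"] by simp

text \<open>A rung at \<open>\<alpha> (i + 1)\<close> separates the two intervals, so a side has no
  chords.\<close>

lemma nonconsecutive: "i + 2 \<le> k \<Longrightarrow> k \<le> Suc p \<Longrightarrow> e (\<alpha> i) < s (\<alpha> k)"
proof -
  assume ik: "i + 2 \<le> k" "k \<le> Suc p"
  then obtain t where "t \<le> m" "a t = Suc i" using ex_a[of "Suc i"] by auto
  then show ?thesis using s_\<alpha>[of k t] e_\<alpha>[of i t] ik by auto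
qed

lemma e_strict_mono: "i < k \<Longrightarrow> k \<le> p \<Longrightarrow> e (\<alpha> i) < e (\<alpha> k)"
proof -
  assume ik: "i < k" "k \<le> p"
  then obtain t where "t \<le> m" "a t = k" using ex_a[of k] by auto
  then show ?thesis using e_\<alpha>[of k t] e_\<alpha>[of i t] ik by auto
qed

lemma s_strict_mono: "i < k \<Longrightarrow> 1 \<le> i \<Longrightarrow> k \<le> p \<Longrightarrow> s (\<alpha> i) < s (\<alpha> k)"
proof -
  assume ik: "i < k" "1 \<le> i" "k \<le> p"
  then obtain t where "t \<le> m" "a t = i" using ex_a[of i] by auto
  then show ?thesis using s_\<alpha>[of k t] s_\<alpha>[of i t] ik by auto
qed

end


section \<open>Disjoint diametral paths in strips\<close>

text \<open>Up to exchanging the sides, two disjoint diametral paths can be chosen as arcs of the outer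
  cycle: either the whole side \<open>\<alpha>\<close> and a window of the side \<open>\<beta>\<close>, or an initial arc of \<open>\<alpha>\<close> and a
  final arc of \<open>\<beta>\<close>.\<close>

definition crit :: "'a set \<Rightarrow> 'a set set \<Rightarrow> (nat \<Rightarrow> 'a) \<Rightarrow> (nat \<Rightarrow> 'a) \<Rightarrow> nat \<Rightarrow> nat \<Rightarrow> nat \<Rightarrow> bool" where
  "crit V E \<alpha> \<beta> p q D \<longleftrightarrow>
     Suc p = D \<and> (\<exists>j\<ge>1. j + D \<le> q \<and> gdist V E (\<beta> j) (\<alpha> (Suc p)) = D \<and>
                            gdist V E (\<alpha> 0) (\<beta> (j + D)) = D) \<or>
     D \<le> p \<and> D \<le> q \<and> gdist V E (\<alpha> 0) (\<alpha> D) = D \<and>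
       gdist V E (\<beta> (Suc q - D)) (\<alpha> (Suc p)) = D"

context strip
begin

text \<open>The start \<open>u' = \<beta> j\<close> is at distance D from r, hence so is
  \<open>\<beta> 1\<close>. Since l is also at distance D, its step towards r must go to
  \<open>\<alpha> 1\<close>, which is at distance D - 1. By monotonicity \<open>u'\<close> then ends
  strictly before \<open>\<alpha> 1\<close>. If \<open>v\<close> began before the end of
  \<open>u'\<close>, both \<open>u\<close> and \<open>v\<close> would be equal or adjacent to
  \<open>\<alpha> 1\<close>, against D \<ge> 3.\<close>

lemma later_start:
  assumes D: "3 \<le> D" and V: "u \<in> V" "v \<in> V" "u' \<in> V" "v' \<in> V"
    and d: "dist u v = D" "dist u' v' = D" and o: "e u < s v" "e u' < s v'"
    and less: "e u < e u'" and u': "u' = \<beta> j" "1 \<le> j" "j \<le> q"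
  shows "e u' < e (\<alpha> 1)" "e u' \<le> s v"
proof -
  let ?r = "\<alpha> (Suc p)"
  have p: "1 \<le> Suc p" "\<alpha> 1 \<in> V" "\<beta> 1 \<in> V" "?r \<in> V" "\<alpha> 0 \<in> V" using p_ge_1 q_ge_1 by auto
  have du': "dist u' ?r = D" using diametral_left V d o by blast
  have d\<beta>: "dist (\<beta> 1) ?r = D"
  proof (cases "j = 1")
    case False
    then have "e (\<beta> 1) < e (\<beta> j)" using strip.e_strict_mono[OF swap, of 1 j] u' by simp
    then have "dist ?r u' \<le> dist ?r (\<beta> 1)"
      using dist_mono'[of ?r u' "\<beta> 1"] u' V p e_le[OF V(3)] by simp
    moreover have "dist ?r u' = dist u' ?r" "dist ?r (\<beta> 1) = dist (\<beta> 1) ?r"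
      using V p by (auto intro: dist_sym)
    moreover have "dist (\<beta> 1) ?r \<le> D" using dist_le_D p by blast
    ultimately show ?thesis using du' by linarith
  qed (use du' u' in simp)
  have "\<alpha> 0 \<noteq> ?r" using D dist_self[of "\<alpha> 0"] p by force
  then obtain x where x: "x \<in> V" "{\<alpha> 0, x} \<in> E" "D = Suc (dist x ?r)"
    using dist_neighbour[of "\<alpha> 0" ?r] p by auto
  have "s x = 0" "x \<noteq> \<alpha> 0" using x(2) by (auto simp: adj)
  then have "x = \<alpha> 1 \<or> x = \<beta> 1"
    using rung_iff[OF x(1), of 0] e_left_iff[OF x(1)] a_0 b_0 by auto
  then have d\<alpha>: "Suc (dist (\<alpha> 1) ?r) = D" using x(3) d\<beta> by auto
  have u'r: "e u' \<le> m"
  proof (rule ccontr)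
    assume "\<not> ?thesis"
    then have "dist u' ?r \<le> 1" using dist_le_1[of u' ?r] V p s_le[OF V(3)] by simp
    then show False using du' D by simp
  qed
  show 1: "e u' < e (\<alpha> 1)"
  proof (rule ccontr)
    assume "\<not> ?thesis"
    then consider "e (\<alpha> 1) < e u'" | "e (\<alpha> 1) = e u'" by linarith
    then show False
    proof cases
      case 1
      then have "dist ?r u' \<le> dist ?r (\<alpha> 1)" using dist_mono'[of ?r u' "\<alpha> 1"] V p e_le[OF V(3)] by simp
      moreover have "dist ?r u' = dist u' ?r" "dist ?r (\<alpha> 1) = dist (\<alpha> 1) ?r"
        using V p by (auto intro: dist_sym)
      ultimately show False using du' d\<alpha> by linarith
    next
      case 2
      then have "\<alpha> 1 = u'" using e_inj[OF p(2) V(3)] u'r by linarith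
      then show False using sides[of 1 j] u' p_ge_1 by auto
    qed
  qed
  show "e u' \<le> s v"
  proof (rule ccontr)
    assume "\<not> ?thesis"
    then have lt: "s v < e (\<alpha> 1)" "s u < e (\<alpha> 1)" using 1 less s_le_e[OF V(1)] by auto
    have "s (\<alpha> 1) = 0" using s_\<alpha>[of 1 0] a_0 by simp
    then have "dist u (\<alpha> 1) \<le> 1" "dist (\<alpha> 1) v \<le> 1"
      using dist_le_1[of u "\<alpha> 1"] dist_le_1[of "\<alpha> 1" v] lt V p by auto
    then show False using dist_triangle[of u "\<alpha> 1" v] V p d D by simp
  qed
qed

text \<open>Only a \<open>u'\<close> ending after \<open>u\<close> needs an argument: it cannot be
  l, whose interval ends at 0, nor r, which leaves no room for \<open>v'\<close>; on either side
  \<open>later_start\<close> applies.\<close>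

lemma overlap:
  assumes D: "3 \<le> D" and V: "u \<in> V" "v \<in> V" "u' \<in> V" "v' \<in> V"
    and d: "dist u v = D" "dist u' v' = D" and o: "e u < s v" "e u' < s v'"
  shows "e u' \<le> s v"
proof (cases "e u < e u'")
  case True
  from V(3) show ?thesis
  proof (cases rule: V_cases)
    case (A i)
    then show ?thesis
      using strip.later_start(2)[OF swap, of u v u' v' i] assms True left_end right_end by simp
  next
    case (B j)
    then show ?thesis using later_start(2)[OF D V d o True B(3,1,2)] by simp
  next
    case right
    then show ?thesis using o s_le[OF V(4)] by simp
  qed simp
qed (use o in simp)

text \<open>Every rung that both paths cross contains one vertex of each, so the paths cannot change
  sides.\<close>

lemma follow_sides:
  assumes w: "walk V E u xs v" "walk V E u' ys v'" and disj: "set xs \<inter> set ys = {}"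
    and t: "t0 \<le> t1" "t1 \<le> m" and s: "s u \<le> t0" "s u' \<le> t0" and e: "t1 < e v" "t1 < e v'"
    and start: "\<beta> (b t0) \<in> set ys"
  shows "t0 \<le> t \<Longrightarrow> t \<le> t1 \<Longrightarrow> \<alpha> (a t) \<in> set xs \<and> \<beta> (b t) \<in> set ys"
proof (induction t rule: dec_induct)
  have cross: "(\<alpha> (a t) \<in> set xs \<or> \<beta> (b t) \<in> set xs) \<and> (\<alpha> (a t) \<in> set ys \<or> \<beta> (b t) \<in> set ys)"
    if tt: "t0 \<le> t" "t \<le> t1" for t
  proof -
    have tm: "t \<le> m" using tt t by simp
    have c: "s u \<le> t" "t < e v" "s u' \<le> t" "t < e v'" using tt s e by auto
    obtain z z' where z: "z \<in> set xs" "s z \<le> t" "t < e z" "z' \<in> set ys" "s z' \<le> t" "t < e z'"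
      using walk_crosses_rung[OF w(1) c(1,2)] walk_crosses_rung[OF w(2) c(3,4)] by blast
    then have "z \<in> V" "z' \<in> V" using w by (auto simp: walk_def)
    then show ?thesis using z rung_iff[of z t] rung_iff[of z' t] tm by auto
  qed
  {
    case base
    then show ?case using cross[of t0] start disj t by auto
  next
    \<comment> \<open>Consecutive rungs share a vertex. It keeps its owner, and disjointness gives
      the other vertex of the new rung to the other path.\<close>
    case (step k)
    then show ?case using cross[of "Suc k"] disj t strip.step[OF strip_axioms, of k] by auto
  }
qed

text \<open>On the rungs from \<open>t0\<close> to \<open>t1\<close> each path follows its own side,
  \<open>ys\<close> along \<open>\<beta>\<close>. By \<open>later_start\<close>, side
  \<open>\<alpha>\<close> is still at its first inner vertex on rung \<open>t0\<close>. If
  \<open>ys\<close> also ends first, reflection shows that \<open>\<alpha>\<close> is at its last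
  inner vertex on rung \<open>t1\<close>, so \<open>xs\<close> contains the whole inner side: this
  is the window case. If \<open>xs\<close> ends first, \<open>\<beta>\<close> is at its last inner
  vertex there, which leads to an initial arc of \<open>\<alpha>\<close> and a final arc of
  \<open>\<beta>\<close>.\<close>

lemma disjoint_imp_crit:
  assumes D: "3 \<le> D" and V: "u \<in> V" "v \<in> V" "u' \<in> V" "v' \<in> V"
    and d: "dist u v = D" "dist u' v' = D" and o: "e u < s v" "e u' < s v'"
    and xs: "geodesic u xs v" and ys: "geodesic u' ys v'" and disj: "set xs \<inter> set ys = {}"
    and less: "e u < e u'" and u': "u' = \<beta> j" "1 \<le> j" "j \<le> q"
  shows "crit V E \<alpha> \<beta> p q D"
proof -
  let ?l = "\<alpha> 0" and ?r = "\<alpha> (Suc p)"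
  have wx: "walk V E u xs v" and wy: "walk V E u' ys v'"
    using xs ys by (auto dest: path_between_imp_walk)
  have ends: "u \<in> set xs" "v \<in> set xs" "u' \<in> set ys" "v' \<in> set ys"
    using wx wy hd_in_set last_in_set by (fastforce simp: walk_def)+
  have card: "card (set xs) = Suc D" "card (set ys) = Suc D"
    using xs ys d by (auto simp: path_between_def distinct_card)
  \<comment> \<open>Rung \<open>t\<close> lies between triangles \<open>t\<close> and
    \<open>t + 1\<close>, so \<open>e u' - 1\<close> is the last rung containing \<open>u'\<close>;
    \<open>less\<close> makes \<open>e u'\<close> positive.\<close>
  define t0 where "t0 = e u' - 1"
  \<comment> \<open>The first rung containing whichever of \<open>v\<close> and \<open>v'\<close>
    begins first.\<close>
  define t1 where "t1 = min (s v) (s v')"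
  note start = later_start[OF D V d o less u']
  have t0: "Suc t0 = e u'" using less by (simp add: t0_def)
  have vv': "v \<noteq> v'" using ends disj by auto
  have "s v \<noteq> s v'" using s_inj[of v v'] vv' V o by auto
  have t1m: "t1 \<le> m" using \<open>s v \<noteq> s v'\<close> s_le[OF V(2)] s_le[OF V(4)] by (auto simp: t1_def)
  have t01: "t0 \<le> t1" using start(2) o(2) t0 by (auto simp: t1_def)
  have su': "s u' < e u'" using s_less_e_\<beta> u' by simp
  have s0: "s u \<le> t0" "s u' \<le> t0" using s_le_e[OF V(1)] less su' t0 by auto
  have ev: "t1 < e x" if "x \<in> V" "x = v \<or> x = v'" for x
  proof (cases "x = ?r")
    case False
    moreover have "x \<noteq> ?l" using that o by auto
    ultimately have "s x < e x" using s_less_e that by blast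
    then show ?thesis using that by (auto simp: t1_def)
  next
    case True
    then show ?thesis using t1m by simp
  qed
  have t0m: "t0 \<le> m" using t01 t1m by simp
  have "u' = \<alpha> (a t0) \<or> u' = \<beta> (b t0)" using rung_iff[OF V(3) t0m] s0 t0 by auto
  then have "u' = \<beta> (b t0)" using sides[of "a t0" j] a_bounds[OF t0m] u' by auto
  then have "\<beta> (b t0) = \<beta> j" using u'(1) by simp
  then have bt0: "b t0 = j"
    by (rule inj_onD[OF inj_\<beta>]) (use b_bounds[OF t0m] u' in auto)
  have at0: "a t0 = 1"
    using e_\<alpha>[of 1 t0] start(1) t0 t0m a_bounds(1)[OF t0m] p_ge_1 by auto
  have follow: "\<alpha> (a t) \<in> set xs \<and> \<beta> (b t) \<in> set ys" if "t0 \<le> t" "t \<le> t1" for t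
    by (rule follow_sides[OF wx wy disj t01 t1m s0 ev[OF V(2)] ev[OF V(4)]])
      (use that ends bt0 u' in auto)
  have \<alpha>_xs: "\<alpha> i \<in> set xs" if "1 \<le> i" "i \<le> a t1" for i
    using ex_a_between[OF t01 t1m, of i] at0 that follow by auto
  have \<beta>_ys: "\<beta> i \<in> set ys" if "j \<le> i" "i \<le> b t1" for i
    using strip.ex_a_between[OF swap t01 t1m, of i] bt0 that follow by auto
  \<comment> \<open>All inner vertices of \<open>\<alpha>\<close> end after \<open>u'\<close>, hence
    after \<open>u\<close>, so \<open>u\<close> is one more vertex of \<open>xs\<close> in the
    counts below.\<close>
  have u_\<alpha>: "u \<notin> \<alpha> ` {1..p}"
  proof
    assume "u \<in> \<alpha> ` {1..p}"
    then obtain i where bounds: "1 \<le> i" "i \<le> p" "u = \<alpha> i" by auto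
    have "e (\<alpha> 1) \<le> e (\<alpha> i)" using bounds e_strict_mono[of 1 i] by (cases "i = 1") auto
    then show False using start(1) less bounds by auto
  qed
  have u'_r: "dist u' ?r = D" using diametral_left V d o by blast
  have v_l: "dist ?l v = D" "dist ?l v' = D" using diametral_right V d o by blast+
  have inj_on_\<alpha>: "inj_on \<alpha> {1..k}" if "k \<le> Suc p" for k
    using inj_on_subset[OF inj_\<alpha>] that by auto
  have inj_on_\<beta>: "inj_on \<beta> {i..k}" if "k \<le> Suc q" for i k
    using inj_on_subset[OF inj_\<beta>] that by auto
  note b1 = a_bounds[OF t1m] b_bounds[OF t1m]
  have M: "strip V E (\<lambda>i. \<alpha> (Suc p - i)) (\<lambda>j. \<beta> (Suc q - j)) (\<lambda>t. Suc p - a (m - t))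
    (\<lambda>t. Suc q - b (m - t)) p q m (\<lambda>x. Suc m - e x) (\<lambda>x. Suc m - s x)" by (rule mirror)
  have dm: "dist v u = dist ?r ?l" "dist v' u' = dist ?r ?l" "3 \<le> dist ?r ?l"
    using d D dist_sym V by auto
  have om: "Suc m - s v < Suc m - e u" "Suc m - s v' < Suc m - e u'"
    using o s_le[OF V(2)] s_le[OF V(4)] by linarith+
  show ?thesis
  proof (cases "s v' < s v")
    case True
    then have t1: "t1 = s v'" by (simp add: t1_def)
    define k where "k = b t1"
    have "v' = \<alpha> (a t1) \<or> v' = \<beta> (b t1)" using rung_iff[OF V(4) t1m] ev[OF V(4)] t1 by auto
    moreover have "v' \<noteq> \<alpha> (a t1)" using follow[OF t01 order_refl] ends disj by auto
    ultimately have v': "v' = \<beta> k" by (simp add: k_def)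
    have k: "1 \<le> k" "k \<le> q" using b1 by (auto simp: k_def)
    have sless: "Suc m - s v < Suc m - s v'" using True s_le[OF V(2)] by auto
    have v'': "v' = \<beta> (Suc q - (Suc q - k))" "1 \<le> Suc q - k" "Suc q - k \<le> q" using v' k by auto
    \<comment> \<open>Both paths are reversed in the mirrored strip; there \<open>v'\<close> is the
      later start.\<close>
    have "Suc m - s v' < Suc m - s (\<alpha> (Suc p - 1))"
      by (rule strip.later_start(1)[OF M _ V(2,1,4,3) _ _ om sless v'']) (use dm in auto)
    then have "s (\<alpha> p) < s v'" by auto
    then have at1: "a t1 = p" using s_\<alpha>[of p t1] t1 t1m b1 by auto
    have v_\<alpha>: "v \<notin> \<alpha> ` {1..p}"
    proof
      assume "v \<in> \<alpha> ` {1..p}"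
      then obtain i where bounds: "1 \<le> i" "i \<le> p" "v = \<alpha> i" by auto
      have "s (\<alpha> i) \<le> s (\<alpha> p)" using bounds s_strict_mono[of i p] by (cases "i = p") auto
      then show False using \<open>s (\<alpha> p) < s v'\<close> True bounds by auto
    qed
    have uv: "u \<noteq> v" using o s_le_e[OF V(1)] by auto
    have "insert u (insert v (\<alpha> ` {1..p})) \<subseteq> set xs" using ends \<alpha>_xs at1 by auto
    then have "card (insert u (insert v (\<alpha> ` {1..p}))) \<le> Suc D"
      using card card_mono by (metis List.finite_set)
    moreover have "card (insert u (insert v (\<alpha> ` {1..p}))) = p + 2"
    proof -
      have "v \<notin> \<alpha> ` {1..p}" "u \<notin> insert v (\<alpha> ` {1..p})" using u_\<alpha> v_\<alpha> uv by auto
      then show ?thesis using card_image[OF inj_on_\<alpha>[of p]] by simp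
    qed
    \<comment> \<open>The p + 2 vertices found on \<open>xs\<close> give p + 1 \<le> D; the side as
      a walk from l to r gives the converse.\<close>
    ultimately have pD: "Suc p = D" using D_le by simp
    have "j \<le> k" using strip.mono_a[OF swap t01 t1m] bt0 by (simp add: k_def)
    have "\<beta> ` {j..k} \<subseteq> set ys" using \<beta>_ys by (auto simp: k_def)
    then have "card (\<beta> ` {j..k}) \<le> Suc D" using card card_mono by (metis List.finite_set)
    then have "Suc k - j \<le> Suc D" using card_image[OF inj_on_\<beta>[of k j]] k by simp
    \<comment> \<open>The walk along \<open>\<beta>\<close> from j to k bounds D by k - j, and the
      count on \<open>ys\<close> bounds k - j by D.\<close>
    moreover have "D \<le> k - j" using gdist_le_walk[OF \<beta>_walk[OF \<open>j \<le> k\<close>]] k d u' v' by (simp del: upt_Suc)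
    ultimately have "k = j + D" using \<open>j \<le> k\<close> by simp
    then show ?thesis unfolding crit_def using pD u' u'_r v_l v' k by auto
  next
    case False
    then have lt: "s v < s v'" using \<open>s v \<noteq> s v'\<close> by simp
    then have t1: "t1 = s v" by (simp add: t1_def)
    define i where "i = a t1"
    have "v = \<alpha> (a t1) \<or> v = \<beta> (b t1)" using rung_iff[OF V(2) t1m] ev[OF V(2)] t1 by auto
    moreover have "v \<noteq> \<beta> (b t1)" using follow[OF t01 order_refl] ends disj by auto
    ultimately have v: "v = \<alpha> i" by (simp add: i_def)
    have i: "1 \<le> i" "i \<le> p" using b1 by (auto simp: i_def)
    have sless: "Suc m - s v' < Suc m - s v" using lt s_le[OF V(4)] by auto
    have v'': "v = \<alpha> (Suc p - (Suc p - i))" "1 \<le> Suc p - i" "Suc p - i \<le> p" using v i by auto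
    \<comment> \<open>Mirrored and with exchanged sides, since the later start is now
      \<open>v\<close>, on \<open>\<alpha>\<close>.\<close>
    have "Suc m - s v < Suc m - s (\<beta> (Suc q - 1))"
      by (rule strip.later_start(1)[OF strip.swap[OF M] _ V(4,3,2,1) _ _ om(2,1) sless v''])
        (use dm left_end right_end in auto)
    then have "s (\<beta> q) < s v" by auto
    then have bt1: "b t1 = q" using s_\<beta>[of q t1] t1 t1m b1 by auto
    have v'_\<beta>: "v' \<notin> \<beta> ` {1..q}"
    proof
      assume "v' \<in> \<beta> ` {1..q}"
      then obtain i where bounds: "1 \<le> i" "i \<le> q" "v' = \<beta> i" by auto
      have "s (\<beta> i) \<le> s (\<beta> q)" using bounds strip.s_strict_mono[OF swap, of i q] by (cases "i = q") auto
      then show False using \<open>s (\<beta> q) < s v\<close> lt bounds by auto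
    qed
    have "insert u (\<alpha> ` {1..i}) \<subseteq> set xs" using ends \<alpha>_xs by (auto simp: i_def)
    then have "card (insert u (\<alpha> ` {1..i})) \<le> Suc D" using card card_mono by (metis List.finite_set)
    moreover have "card (insert u (\<alpha> ` {1..i})) = i + 1"
    proof -
      have "u \<notin> \<alpha> ` {1..i}" using u_\<alpha> i(2) image_mono[of "{1..i}" "{1..p}" \<alpha>] by fastforce
      then show ?thesis using card_image[OF inj_on_\<alpha>[of i]] i by simp
    qed
    \<comment> \<open>The initial arc of \<open>\<alpha>\<close> joins l to \<open>v\<close>, which
      is at distance D; the count gave the other inequality.\<close>
    moreover have "D \<le> i" using gdist_le_walk[OF \<alpha>_walk[of 0 i]] i v_l v by simp
    ultimately have iD: "i = D" by simp
    have "insert v' (\<beta> ` {j..q}) \<subseteq> set ys" using ends \<beta>_ys bt1 by auto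
    then have "card (insert v' (\<beta> ` {j..q})) \<le> Suc D" using card card_mono by (metis List.finite_set)
    moreover have "card (insert v' (\<beta> ` {j..q})) = Suc (Suc q - j)"
    proof -
      have "v' \<notin> \<beta> ` {j..q}" using v'_\<beta> u'(2) image_mono[of "{j..q}" "{1..q}" \<beta>] by fastforce
      then show ?thesis using card_image[OF inj_on_\<beta>[of q j]] u' by simp
    qed
    moreover have "D \<le> Suc q - j"
      using gdist_le_walk[OF \<beta>_walk[of j "Suc q"]] u' u'_r right_end by simp
    ultimately have "Suc q - j = D" by simp
    then have "D \<le> q" "j = Suc q - D" using u' by auto
    then show ?thesis unfolding crit_def using iD i v v_l u' u'_r by auto
  qed
qed

text \<open>A path between the ends of the window that uses a vertex \<open>\<alpha> i\<close> has length at least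
  \<open>i + (D - i)\<close>.\<close>

lemma window_dist:
  assumes pD: "Suc p = D" and j: "1 \<le> j" "j + D \<le> q"
    and dr: "dist (\<beta> j) (\<alpha> (Suc p)) = D" and dl: "dist (\<alpha> 0) (\<beta> (j + D)) = D"
  shows "dist (\<beta> j) (\<beta> (j + D)) = D"
proof -
  let ?u = "\<beta> j" and ?v = "\<beta> (j + D)"
  have V: "?u \<in> V" "?v \<in> V" using j by auto
  obtain xs where xs: "geodesic ?u xs ?v" using ex_geodesic V by blast
  have w: "walk V E ?u xs ?v" using xs by (auto dest: path_between_imp_walk)
  have "D \<le> dist ?u ?v"
  proof (cases "\<exists>i. 1 \<le> i \<and> i \<le> p \<and> \<alpha> i \<in> set xs")
    case True
    then obtain i where i: "1 \<le> i" "i \<le> p" "\<alpha> i \<in> set xs" by blast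
    then have x: "\<alpha> i \<in> V" by auto
    have "dist ?u (\<alpha> i) + dist (\<alpha> i) ?v = dist ?u ?v" using geodesic_mem[OF xs V i(3)] by simp
    moreover have "D \<le> dist ?u (\<alpha> i) + dist (\<alpha> i) (\<alpha> (Suc p))"
      using dist_triangle[OF V(1) x, of "\<alpha> (Suc p)"] dr by simp
    moreover have "dist (\<alpha> i) (\<alpha> (Suc p)) \<le> Suc p - i"
      using gdist_le_walk[OF \<alpha>_walk[of i "Suc p"]] i by simp
    moreover have "D \<le> dist (\<alpha> 0) (\<alpha> i) + dist (\<alpha> i) ?v"
      using dist_triangle[OF _ x V(2), of "\<alpha> 0"] dl by simp
    moreover have "dist (\<alpha> 0) (\<alpha> i) \<le> i"
      using gdist_le_walk[OF \<alpha>_walk[of 0 i]] i by simp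
    ultimately show ?thesis using pD i by linarith
  next
    case False
    have in_\<beta>: "\<exists>k\<le>Suc q. x = \<beta> k" if "x \<in> set xs" for x
    proof -
      have "x \<in> V" using that w by (auto simp: walk_def)
      then show ?thesis
        by (cases rule: V_cases) (use False that left_end right_end in \<open>auto intro: le_SucI\<close>)
    qed
    \<comment> \<open>Off the inner part of \<open>\<alpha>\<close> all vertices have an index on
      \<open>\<beta>\<close>; as that side has no chords, a step raises the index by at most
      one.\<close>
    have reach: "n < length xs \<Longrightarrow> \<exists>k\<le>Suc q. xs ! n = \<beta> k \<and> k \<le> j + n" for n
    proof (induction n)
      case 0
      have "xs ! 0 = ?u" using w hd_conv_nth[of xs] by (auto simp: walk_def)
      then show ?case using j by (intro exI[of _ j]) auto
    next
      case (Suc n)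
      then obtain k where k: "k \<le> Suc q" "xs ! n = \<beta> k" "k \<le> j + n" by auto
      obtain k' where k': "k' \<le> Suc q" "xs ! Suc n = \<beta> k'" using in_\<beta>[OF nth_mem[OF Suc.prems]] by blast
      have "{\<beta> k, \<beta> k'} \<in> E" using walk_nth_edge[OF w Suc.prems] k k' by simp
      then have "\<not> e (\<beta> k) < s (\<beta> k')" by (simp add: adj)
      then have "k' \<le> Suc k" using strip.nonconsecutive[OF swap, of k k'] k' by fastforce
      then show ?case using k k' by auto
    qed
    have "xs \<noteq> []" using w by (simp add: walk_def)
    then obtain k where k: "k \<le> Suc q" "last xs = \<beta> k" "k \<le> j + (length xs - 1)"
      using reach[of "length xs - 1"] last_conv_nth[of xs] by auto
    have "last xs = ?v" using w by (simp add: walk_def)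
    then have "\<beta> k = \<beta> (j + D)" using k(2) by simp
    then have "k = j + D" by (rule inj_onD[OF inj_\<beta>]) (use k j in auto)
    then show ?thesis using k xs by simp
  qed
  then show ?thesis using dist_le_D[OF V] by simp
qed

lemma crit_imp_disjoint:
  assumes "crit V E \<alpha> \<beta> p q D"
  shows "\<exists>u v xs u' v' ys. u \<in> V \<and> v \<in> V \<and> u' \<in> V \<and> v' \<in> V \<and> geodesic u xs v \<and> geodesic u' ys v' \<and>
    dist u v = D \<and> dist u' v' = D \<and> set xs \<inter> set ys = {}"
proof -
  \<comment> \<open>\<open>1 \<le> j\<close> keeps l out of the arc of \<open>\<beta>\<close>, and
    the last condition keeps r out of one of the arcs.\<close>
  have ab: "\<alpha> ` {..i} \<inter> \<beta> ` {j..k} = {}"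
    if "i \<le> Suc p" "k \<le> Suc q" "1 \<le> j" "i \<le> p \<or> k \<le> q" for i j k
  proof (rule ccontr)
    assume "\<not> ?thesis"
    then obtain i' j' where "i' \<le> i" "j \<le> j'" "j' \<le> k" "\<alpha> i' = \<beta> j'" by auto
    then show False using sides[of i' j'] that by auto
  qed
  have set_map: "set (map f [i..<Suc k]) = f ` {i..k}" for f :: "nat \<Rightarrow> 'a" and i k
    by (simp add: atLeastLessThanSuc_atLeastAtMost del: upt_Suc)
  consider j where "Suc p = D" "1 \<le> j" "j + D \<le> q" "dist (\<beta> j) (\<alpha> (Suc p)) = D" "dist (\<alpha> 0) (\<beta> (j + D)) = D"
    | "D \<le> p" "D \<le> q" "dist (\<alpha> 0) (\<alpha> D) = D" "dist (\<beta> (Suc q - D)) (\<alpha> (Suc p)) = D"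
    using assms unfolding crit_def by blast
  then show ?thesis
  proof cases
    case 1
    then have w: "dist (\<beta> j) (\<beta> (j + D)) = D" by (rule window_dist)
    let ?xs = "map \<alpha> [0..<Suc (Suc p)]" and ?ys = "map \<beta> [j..<Suc (j + D)]"
    have x: "geodesic (\<alpha> 0) ?xs (\<alpha> (Suc p))" by (rule geodesicI[OF \<alpha>_walk]) (use 1 in auto)
    have y: "geodesic (\<beta> j) ?ys (\<beta> (j + D))" by (rule geodesicI[OF \<beta>_walk]) (use 1 w in auto)
    have "set ?xs \<inter> set ?ys = {}"
      unfolding set_map atLeast0AtMost by (rule ab) (use 1 in auto)
    moreover have "\<alpha> 0 \<in> V" "\<alpha> (Suc p) \<in> V" "\<beta> j \<in> V" "\<beta> (j + D) \<in> V" using 1 by auto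
    ultimately show ?thesis using x y w by blast
  next
    case 2
    let ?xs = "map \<alpha> [0..<Suc D]" and ?ys = "map \<beta> [Suc q - D..<Suc (Suc q)]"
    have x: "geodesic (\<alpha> 0) ?xs (\<alpha> D)" by (rule geodesicI[OF \<alpha>_walk]) (use 2 in auto)
    have y: "geodesic (\<beta> (Suc q - D)) ?ys (\<beta> (Suc q))"
      by (rule geodesicI[OF \<beta>_walk]) (use 2 right_end in auto)
    have "set ?xs \<inter> set ?ys = {}"
      unfolding set_map atLeast0AtMost by (rule ab) (use 2 in auto)
    moreover have "\<alpha> 0 \<in> V" "\<alpha> D \<in> V" "\<beta> (Suc q - D) \<in> V" "\<beta> (Suc q) \<in> V" using 2 by auto
    moreover have "dist (\<beta> (Suc q - D)) (\<beta> (Suc q)) = D" using 2 right_end by simp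
    ultimately show ?thesis using x y 2(3) by blast
  qed
qed

end


section \<open>Families of totally disjoint diametral paths\<close>

definition TDDP_family :: "'a set \<Rightarrow> 'a set set \<Rightarrow> 'a list set \<Rightarrow> bool" where
  "TDDP_family V E P \<longleftrightarrow>
     (\<forall>p\<in>P. diametral_path V E p) \<and> pairwise (\<lambda>p q. set p \<inter> set q = {}) P"

text \<open>The uniform bound also makes the set of cardinalities finite, as \<open>Max\<close>
  requires.\<close>

lemma num_TDDP_eqI:
  assumes "TDDP_family V E P" "card P = K" "\<And>P. TDDP_family V E P \<Longrightarrow> card P \<le> K"
  shows "num_TDDP V E = K"
  unfolding num_TDDP_def TDDP_family_def[symmetric]
proof (rule Max_eqI)
  show "finite {card P |P. TDDP_family V E P}"
    by (rule finite_subset[of _ "{..K}"]) (use assms(3) in auto)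
  show "K \<in> {card P |P. TDDP_family V E P}" using assms(1,2) by blast
qed (use assms(3) in auto)

context strip
begin

lemma card_V: "card V = p + q + 2"
proof -
  have "V = \<alpha> ` {..Suc p} \<union> \<beta> ` {1..q}"
  proof (intro equalityI subsetI)
    fix x assume "x \<in> V"
    then show "x \<in> \<alpha> ` {..Suc p} \<union> \<beta> ` {1..q}" by (cases rule: V_cases) auto
  qed auto
  moreover have "\<alpha> ` {..Suc p} \<inter> \<beta> ` {1..q} = {}"
  proof (rule ccontr)
    assume "\<not> ?thesis"
    then obtain i j where "i \<le> Suc p" "1 \<le> j" "j \<le> q" "\<alpha> i = \<beta> j" by auto
    then show False using sides[of i j] by auto
  qed
  moreover have "card (\<alpha> ` {..Suc p}) = p + 2" "card (\<beta> ` {1..q}) = q"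
    using card_image[OF inj_\<alpha>] card_image[OF inj_on_subset[OF inj_\<beta>], of "{1..q}"] by auto
  ultimately show ?thesis using card_Un_disjoint[of "\<alpha> ` {..Suc p}" "\<beta> ` {1..q}"] by simp
qed

lemma diametral_path_iff:
  "diametral_path V E xs \<longleftrightarrow> (\<exists>u\<in>V. \<exists>v\<in>V. dist u v = D \<and> geodesic u xs v)"
  unfolding diametral_path_def diameter_eq by auto

text \<open>As D \<ge> 2, the intervals of the end vertices are disjoint, so the path or its
  reversal runs from left to right; disjointness depends on the vertex set alone.\<close>

lemma diametral_path_oriented:
  assumes "diametral_path V E xs"
  obtains u v ys where "u \<in> V" "v \<in> V" "dist u v = D" "e u < s v" "geodesic u ys v" "set ys = set xs"
proof -
  obtain u v where uv: "u \<in> V" "v \<in> V" "dist u v = D" "geodesic u xs v"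
    using assms diametral_path_iff by blast
  have "\<not> (s u \<le> e v \<and> s v \<le> e u)" using dist_le_1[of u v] uv D_ge_2 by auto
  then consider "e u < s v" | "e v < s u" by linarith
  then show thesis
  proof cases
    case 1
    then show ?thesis using that uv by blast
  next
    case 2
    have "geodesic v (rev xs) u" "dist v u = D" using uv path_between_rev dist_sym[of v u] by auto
    then show ?thesis using that[of v u "rev xs"] uv 2 by simp
  qed
qed

lemma card_diametral: "diametral_path V E xs \<Longrightarrow> set xs \<subseteq> V \<and> card (set xs) = Suc D"
  by (auto simp: diametral_path_iff path_between_def distinct_card)

lemma TDDP_family_inj: "TDDP_family V E P \<Longrightarrow> inj_on set P"
proof (rule inj_onI)
  fix xs ys assume P: "TDDP_family V E P" and xy: "xs \<in> P" "ys \<in> P" "set xs = set ys"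
  have "card (set xs) = Suc D" using card_diametral P xy by (auto simp: TDDP_family_def)
  then have "set xs \<inter> set ys \<noteq> {}" using xy by auto
  then show "xs = ys" using P xy unfolding TDDP_family_def pairwise_def by blast
qed

lemma TDDP_family_finite: "TDDP_family V E P \<Longrightarrow> finite P"
proof -
  assume P: "TDDP_family V E P"
  then have "set ` P \<subseteq> Pow V" using card_diametral by (auto simp: TDDP_family_def)
  then have "finite (set ` P)" using finite_V finite_subset by blast
  then show ?thesis using TDDP_family_inj[OF P] finite_imageD by blast
qed

text \<open>Each of the disjoint paths takes D + 1 vertices; for D = 2 this is the bound by n div
  3.\<close>

lemma TDDP_family_card: "TDDP_family V E P \<Longrightarrow> card P * Suc D \<le> card V"
proof -
  assume P: "TDDP_family V E P"
  have "card (\<Union>(set ` P)) = (\<Sum>xs\<in>P. card (set xs))"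
    using P TDDP_family_finite[OF P]
    by (intro card_UN_disjoint) (auto simp: TDDP_family_def pairwise_def)
  also have "\<dots> = (\<Sum>xs\<in>P. Suc D)"
    using P card_diametral by (intro sum.cong) (auto simp: TDDP_family_def)
  finally have "card (\<Union>(set ` P)) = card P * Suc D" by simp
  moreover have "\<Union>(set ` P) \<subseteq> V" using P card_diametral by (auto simp: TDDP_family_def)
  ultimately show ?thesis using card_mono[OF finite_V] by metis
qed

text \<open>For \<open>D \<ge> 3\<close> there is a single rung met by all diametral paths.\<close>

lemma TDDP_family_card_2:
  assumes D: "3 \<le> D" and P: "TDDP_family V E P"
  shows "card P \<le> 2"
proof -
  have "\<forall>xs\<in>P. \<exists>u v ys. u \<in> V \<and> v \<in> V \<and> dist u v = D \<and> e u < s v \<and> geodesic u ys v \<and> set ys = set xs"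
    using P by (metis TDDP_family_def diametral_path_oriented)
  then obtain U W Y where UW: "\<And>xs. xs \<in> P \<Longrightarrow> U xs \<in> V \<and> W xs \<in> V \<and> dist (U xs) (W xs) = D \<and>
      e (U xs) < s (W xs) \<and> geodesic (U xs) (Y xs) (W xs) \<and> set (Y xs) = set xs"
    by metis
  \<comment> \<open>By \<open>overlap\<close> the latest end of a starting vertex is at most the
    beginning of every final vertex, so each path crosses rung \<open>k - 1\<close>. For
    \<open>k = 0\<close>, truncated subtraction gives rung 0, which is crossed as well because every
    path then starts at l.\<close>
  define k where "k = Max ((\<lambda>xs. e (U xs)) ` P)"
  have fin: "finite P" by (rule TDDP_family_finite[OF P])
  have kU: "e (U xs) \<le> k" if "xs \<in> P" for xs using that fin by (simp add: k_def)
  have kW: "k \<le> s (W ys)" if ys: "ys \<in> P" for ys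
  proof -
    have "k \<in> (\<lambda>xs. e (U xs)) ` P" unfolding k_def using fin ys by (intro Max_in) auto
    then obtain xs where "xs \<in> P" "k = e (U xs)" by auto
    then show ?thesis using overlap[OF D, of "U ys" "W ys" "U xs" "W xs"] UW ys by auto
  qed
  have meets: "\<alpha> (a (k - 1)) \<in> set xs \<or> \<beta> (b (k - 1)) \<in> set xs" if "xs \<in> P" for xs
  proof -
    note ux = UW[OF that] kU[OF that] kW[OF that]
    have m: "k - 1 \<le> m" using ux s_le[of "W xs"] by auto
    have "s (U xs) \<le> k - 1"
    proof (cases "U xs = \<alpha> 0")
      case False
      moreover have "U xs \<noteq> \<alpha> (Suc p)" using ux s_le[of "W xs"] by auto
      ultimately show ?thesis using s_less_e[of "U xs"] ux by auto
    qed simp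
    moreover have "k - 1 < e (W xs)" using ux s_le_e[of "W xs"] by linarith
    moreover have w: "walk V E (U xs) (Y xs) (W xs)" using ux by (auto dest: path_between_imp_walk)
    ultimately obtain z where z: "z \<in> set (Y xs)" "s z \<le> k - 1" "k - 1 < e z"
      using walk_crosses_rung by blast
    then have "z \<in> V" using w by (auto simp: walk_def)
    then show ?thesis using z rung_iff[of z "k - 1"] m ux by auto
  qed
  define f where "f xs = (if \<alpha> (a (k - 1)) \<in> set xs then \<alpha> (a (k - 1)) else \<beta> (b (k - 1)))" for xs
  have f: "f xs \<in> set xs" if "xs \<in> P" for xs using meets[OF that] by (auto simp: f_def)
  have "inj_on f P"
  proof (rule inj_onI)
    fix xs ys assume xy: "xs \<in> P" "ys \<in> P" "f xs = f ys"
    then have "set xs \<inter> set ys \<noteq> {}" using f by (metis disjoint_iff)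
    then show "xs = ys" using P xy unfolding TDDP_family_def pairwise_def by blast
  qed
  moreover have "f ` P \<subseteq> {\<alpha> (a (k - 1)), \<beta> (b (k - 1))}" by (auto simp: f_def)
  ultimately have "card P \<le> card {\<alpha> (a (k - 1)), \<beta> (b (k - 1))}" using card_inj_on_le by blast
  then show ?thesis using card_insert_le_m1[of 2 "{\<beta> (b (k - 1))}" "\<alpha> (a (k - 1))"] by simp
qed

text \<open>The path whose start ends later decides the orientation: if it starts on
  \<open>\<beta>\<close>, the criterion holds as stated, on \<open>\<alpha>\<close> with exchanged
  sides. Equal ends are excluded, because \<open>e\<close> is injective before the last
  triangle.\<close>

lemma disjoint_pair_imp_crit:
  assumes D: "3 \<le> D" and xy: "diametral_path V E xs" "diametral_path V E ys" "set xs \<inter> set ys = {}"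
  shows "crit V E \<alpha> \<beta> p q D \<or> crit V E \<beta> \<alpha> q p D"
proof -
  have *: "crit V E \<alpha> \<beta> p q D \<or> crit V E \<beta> \<alpha> q p D"
    if V: "u \<in> V" "v \<in> V" "u' \<in> V" "v' \<in> V" and d: "dist u v = D" "dist u' v' = D"
      and o: "e u < s v" "e u' < s v'" and g: "geodesic u xs v" "geodesic u' ys v'"
      and disj: "set xs \<inter> set ys = {}" and less: "e u < e u'" for u v xs u' v' ys
    using V(3)
  proof (cases rule: V_cases)
    case (A i)
    then have "crit V E \<beta> \<alpha> q p (dist (\<beta> 0) (\<beta> (Suc q)))"
      using left_end right_end D d
      by (intro strip.disjoint_imp_crit[OF swap _ V _ _ o g disj less A(3,1,2)]) auto
    then show ?thesis using left_end right_end by simp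
  next
    case (B j)
    then show ?thesis using disjoint_imp_crit[OF D V d o g disj less B(3,1,2)] by simp
  next
    case left
    then show ?thesis using less by simp
  next
    case right
    then show ?thesis using o s_le[OF V(4)] by simp
  qed
  obtain u v xs' where u: "u \<in> V" "v \<in> V" "dist u v = D" "e u < s v" "geodesic u xs' v" "set xs' = set xs"
    using diametral_path_oriented[OF xy(1)] by metis
  obtain u' v' ys' where u': "u' \<in> V" "v' \<in> V" "dist u' v' = D" "e u' < s v'" "geodesic u' ys' v'"
    "set ys' = set ys"
    using diametral_path_oriented[OF xy(2)] by metis
  have "u \<in> set xs'" "u' \<in> set ys'" using u(5) u'(5) hd_in_set by (fastforce simp: path_between_def)+
  then have "u \<noteq> u'" using xy(3) u(6) u'(6) by auto
  moreover have "e u \<le> m" using u s_le[of v] by auto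
  ultimately have "e u \<noteq> e u'" using e_inj u(1) u'(1) by blast
  then consider "e u < e u'" | "e u' < e u" by linarith
  then show ?thesis
  proof cases
    case 1
    then show ?thesis using *[OF u(1,2) u'(1,2) u(3) u'(3) u(4) u'(4) u(5) u'(5)] xy(3) u(6) u'(6) by simp
  next
    case 2
    then show ?thesis using *[OF u'(1,2) u(1,2) u'(3) u(3) u'(4) u(4) u'(5) u(5)] xy(3) u(6) u'(6)
      by (simp add: Int_commute)
  qed
qed

lemma crit_imp_family:
  assumes "crit V E \<alpha> \<beta> p q D" shows "\<exists>P. TDDP_family V E P \<and> card P = 2"
proof -
  obtain u v xs u' v' ys where 1: "u \<in> V" "v \<in> V" "u' \<in> V" "v' \<in> V"
    and 2: "geodesic u xs v" "geodesic u' ys v'" "dist u v = D" "dist u' v' = D" "set xs \<inter> set ys = {}"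
    using crit_imp_disjoint[OF assms] by blast
  have "diametral_path V E xs" "diametral_path V E ys" using 1 2 diametral_path_iff by blast+
  then have "TDDP_family V E {xs, ys}"
    using 2 by (auto simp: TDDP_family_def pairwise_def)
  moreover have "xs \<noteq> ys" using 2 by (auto simp: path_between_def)
  then have "card {xs, ys} = 2" by simp
  ultimately show ?thesis by blast
qed

text \<open>With \<open>p = 1\<close> the vertex \<open>\<alpha> 1\<close> is the centre of the fan.
  One path runs through it from l to r, and consecutive triples of inner vertices of
  \<open>\<beta>\<close> are paths of length two; 1 + q div 3 equals (q + 3) div 3.\<close>

lemma fan_family:
  assumes "D = 2" "p = 1" shows "\<exists>P. TDDP_family V E P \<and> card P = card V div 3"
proof -
  define f where "f k = map \<beta> [3 * k + 1..<Suc (3 * k + 3)]" for k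
  define g where "g = map \<alpha> [0..<Suc (Suc p)]"
  have set_f: "set (f k) = \<beta> ` {3 * k + 1..3 * k + 3}" for k
    unfolding f_def set_map set_upt atLeastLessThanSuc_atLeastAtMost ..
  have set_g: "set g = \<alpha> ` {..Suc p}"
    unfolding g_def set_map set_upt by (metis atLeast0LessThan lessThan_Suc_atMost)
  have d: "diametral_path V E (f k)" if k: "k < q div 3" for k
  proof -
    have kq: "3 * k + 3 \<le> q" using k by linarith
    then have V: "\<beta> (3 * k + 1) \<in> V" "\<beta> (3 * k + 3) \<in> V" by auto
    have "e (\<beta> (3 * k + 1)) < s (\<beta> (3 * k + 3))"
      using strip.nonconsecutive[OF swap, of "3 * k + 1" "3 * k + 3"] kq by auto
    then have dd: "dist (\<beta> (3 * k + 1)) (\<beta> (3 * k + 3)) = D"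
      using dist_ge_2[OF V] dist_le_D[OF V] assms by simp
    have "geodesic (\<beta> (3 * k + 1)) (f k) (\<beta> (3 * k + 3))"
      unfolding f_def by (rule geodesicI[OF \<beta>_walk]) (use kq dd assms in \<open>auto simp del: upt_Suc\<close>)
    then show ?thesis using dd V unfolding diametral_path_iff by blast
  qed
  have "geodesic (\<alpha> 0) g (\<alpha> (Suc p))"
    unfolding g_def by (rule geodesicI[OF \<alpha>_walk]) (use assms in \<open>auto simp del: upt_Suc\<close>)
  then have dg: "diametral_path V E g" unfolding diametral_path_iff by blast
  have fg: "set (f k) \<inter> set g = {}" if k: "k < q div 3" for k
  proof (rule ccontr)
    assume "\<not> ?thesis"
    then obtain i j where "i \<le> Suc p" "3 * k + 1 \<le> j" "j \<le> 3 * k + 3" "\<alpha> i = \<beta> j"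
      unfolding set_f set_g disjoint_iff by fastforce
    moreover have "3 * k + 3 \<le> q" using k by linarith
    ultimately show False using sides[of i j] by auto
  qed
  have ff: "set (f k) \<inter> set (f k') = {}" if k: "k < q div 3" "k' < q div 3" "k \<noteq> k'" for k k'
  proof (rule ccontr)
    assume "\<not> ?thesis"
    then obtain i j where ij: "3 * k + 1 \<le> i" "i \<le> 3 * k + 3" "3 * k' + 1 \<le> j" "j \<le> 3 * k' + 3" "\<beta> i = \<beta> j"
      unfolding set_f by auto
    have "3 * k + 3 \<le> q" "3 * k' + 3 \<le> q" using k by linarith+
    then have "i = j" using ij by (intro inj_onD[OF inj_\<beta> ij(5)]) auto
    then show False using ij k by linarith
  qed
  have ne: "set (f k) \<noteq> {}" for k by (simp add: set_f)
  have inj: "inj_on f {..<q div 3}"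
    by (rule inj_onI) (use ff ne in \<open>metis inf.idem lessThan_iff\<close>)
  have "pairwise (\<lambda>p q. set p \<inter> set q = {}) (f ` {..<q div 3})"
    unfolding pairwise_image pairwise_def lessThan_iff Ball_def using ff by blast
  then have "TDDP_family V E (insert g (f ` {..<q div 3}))"
    unfolding TDDP_family_def pairwise_insert using d dg fg by (auto simp: Int_commute)
  moreover have "g \<notin> f ` {..<q div 3}"
    using fg ne by (metis imageE inf.idem lessThan_iff)
  then have "card (insert g (f ` {..<q div 3})) = Suc (q div 3)" using card_image[OF inj] by simp
  moreover have "card V div 3 = Suc (q div 3)" using card_V assms by simp
  ultimately show ?thesis by metis
qed

text \<open>The midpoint of a path of length two from l to r has an interval covering all triangles.
  It is the first inner vertex of its side and still lies on the last rung, so its side has no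
  other.\<close>

lemma D_2_fan:
  assumes "D = 2" shows "p = 1 \<or> q = 1"
proof -
  obtain x where x: "x \<in> V" "{\<alpha> 0, x} \<in> E" "D = Suc (dist x (\<alpha> (Suc p)))"
    using dist_neighbour[of "\<alpha> 0" "\<alpha> (Suc p)"] assms by fastforce
  then have "dist x (\<alpha> (Suc p)) = 1" using assms by simp
  then have "{x, \<alpha> (Suc p)} \<in> E" using dist_eq_1 x by blast
  then have se: "s x = 0" "e x = Suc m" "x \<noteq> \<alpha> 0" "x \<noteq> \<alpha> (Suc p)"
    using x(2) e_le[OF x(1)] by (auto simp: adj)
  have "x = \<alpha> 1 \<or> x = \<beta> 1" using rung_iff[OF x(1), of 0] se a_0 b_0 by simp
  then show ?thesis
  proof
    assume "x = \<alpha> 1"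
    then show ?thesis using e_\<alpha>[of 1 m] se a_m p_ge_1 by simp
  next
    assume "x = \<beta> 1"
    then show ?thesis using e_\<beta>[of 1 m] se b_m q_ge_1 by simp
  qed
qed

text \<open>The form in which the program decides: only n, D, the lengths of the sides and distances
  to the two ends enter.\<close>

theorem num_TDDP_eq:
  "num_TDDP V E =
    (if D < 3 then card V div 3
     else if crit V E \<alpha> \<beta> p q D \<or> crit V E \<beta> \<alpha> q p D then 2 else 1)"
proof -
  consider "D = 2" | "3 \<le> D" using D_ge_2 by linarith
  then show ?thesis
  proof cases
    case 1
    have "\<exists>P. TDDP_family V E P \<and> card P = card V div 3"
      using D_2_fan[OF 1]
    proof
      assume "q = 1"
      then show ?thesis using strip.fan_family[OF swap] 1 left_end right_end by simp
    qed (use fan_family 1 in simp)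
    then obtain P where P: "TDDP_family V E P" "card P = card V div 3" by blast
    have "card P \<le> card V div 3" if "TDDP_family V E P" for P
      using TDDP_family_card[OF that] 1 by (simp add: less_eq_div_iff_mult_less_eq)
    then have "num_TDDP V E = card V div 3" by (rule num_TDDP_eqI[OF P])
    then show ?thesis using 1 by simp
  next
    case D: 2
    show ?thesis
    proof (cases "crit V E \<alpha> \<beta> p q D \<or> crit V E \<beta> \<alpha> q p D")
      case True
      have "\<exists>P. TDDP_family V E P \<and> card P = 2"
        using True
      proof
        assume "crit V E \<beta> \<alpha> q p D"
        then show ?thesis using strip.crit_imp_family[OF swap] left_end right_end by simp
      qed (rule crit_imp_family)
      then obtain P where P: "TDDP_family V E P" "card P = 2" by blast
      have "num_TDDP V E = 2" by (rule num_TDDP_eqI[OF P TDDP_family_card_2[OF D]])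
      then show ?thesis using True D by simp
    next
      case False
      obtain xs where "geodesic (\<alpha> 0) xs (\<alpha> (Suc p))" using ex_geodesic by blast
      then have "diametral_path V E xs" unfolding diametral_path_iff by blast
      then have P: "TDDP_family V E {xs}" "card {xs} = 1" by (auto simp: TDDP_family_def)
      have "card P \<le> 1" if P: "TDDP_family V E P" for P
      proof (rule ccontr)
        assume "\<not> ?thesis"
        then have "\<not> (\<forall>x\<in>P. \<forall>y\<in>P. x = y)" using card_le_Suc0_iff_eq[OF TDDP_family_finite[OF P]] by simp
        then obtain xs ys where "xs \<in> P" "ys \<in> P" "xs \<noteq> ys" by blast
        then have "diametral_path V E xs" "diametral_path V E ys" "set xs \<inter> set ys = {}"
          using P by (auto simp: TDDP_family_def pairwise_def)
        then show False using disjoint_pair_imp_crit[OF D] False by blast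
      qed
      then have "num_TDDP V E = 1" by (rule num_TDDP_eqI[OF P])
      then show ?thesis using False D by simp
    qed
  qed
qed

end


section \<open>2-paths are strips\<close>

text \<open>The same data with the edges listed explicitly. Appending a vertex is easy to describe
  in this form, whereas intervals would have to be adjusted; they are derived from the rungs
  afterwards.\<close>

locale strip_edges =
  fixes V :: "'a set" and E :: "'a set set" and \<alpha> \<beta> :: "nat \<Rightarrow> 'a" and a b :: "nat \<Rightarrow> nat"
    and p q m :: nat
  assumes V_eq: "V = \<alpha> ` {..Suc p} \<union> \<beta> ` {..Suc q}"
    and left_end: "\<alpha> 0 = \<beta> 0" and right_end: "\<alpha> (Suc p) = \<beta> (Suc q)"
    and inj_\<alpha>: "inj_on \<alpha> {..Suc p}" and inj_\<beta>: "inj_on \<beta> {..Suc q}"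
    and sides: "i \<le> Suc p \<Longrightarrow> j \<le> Suc q \<Longrightarrow> \<alpha> i = \<beta> j \<Longrightarrow>
      i = 0 \<and> j = 0 \<or> i = Suc p \<and> j = Suc q"
    and a_0: "a 0 = 1" and b_0: "b 0 = 1" and a_m: "a m = p" and b_m: "b m = q"
    and step: "t < m \<Longrightarrow> a (Suc t) = Suc (a t) \<and> b (Suc t) = b t \<or>
      a (Suc t) = a t \<and> b (Suc t) = Suc (b t)"
    and E_eq: "E = (\<lambda>i. {\<alpha> i, \<alpha> (Suc i)}) ` {..p} \<union> (\<lambda>j. {\<beta> j, \<beta> (Suc j)}) ` {..q} \<union>
      (\<lambda>t. {\<alpha> (a t), \<beta> (b t)}) ` {..m}"
begin

lemma swap: "strip_edges V E \<beta> \<alpha> b a q p m"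
proof (unfold_locales, goal_cases)
  case (6 i j)
  then show ?case using sides[of j i] by auto
next
  case (11 t)
  then show ?case using step by auto
next
  case 12
  have eq: "(\<lambda>t. {\<beta> (b t), \<alpha> (a t)}) ` {..m} = (\<lambda>t. {\<alpha> (a t), \<beta> (b t)}) ` {..m}"
    by (simp add: insert_commute)
  show ?case unfolding eq using E_eq by (simp only: Un_commute Un_left_commute)
qed (use V_eq left_end right_end inj_\<alpha> inj_\<beta> a_0 b_0 a_m b_m in auto)

lemma mono_a: "t \<le> t' \<Longrightarrow> t' \<le> m \<Longrightarrow> a t \<le> a t'"
proof (induction t' rule: dec_induct)
  case (step k)
  then show ?case using strip_edges.step[OF strip_edges_axioms, of k] by auto
qed simp

lemma a_bounds: "t \<le> m \<Longrightarrow> 1 \<le> a t" "t \<le> m \<Longrightarrow> a t \<le> p"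
  using mono_a[of 0 t] mono_a[of t m] a_0 a_m by auto

lemma ex_a: "1 \<le> i \<Longrightarrow> i \<le> p \<Longrightarrow> \<exists>t\<le>m. a t = i"
proof -
  assume i: "1 \<le> i" "i \<le> p"
  define t where "t = (LEAST t. i \<le> a t)"
  have "i \<le> a m" using i a_m by simp
  then have t: "i \<le> a t" "t \<le> m" unfolding t_def by (rule LeastI, rule Least_le)
  have "a t = i"
  proof (cases t)
    case 0
    then show ?thesis using t i a_0 by simp
  next
    case (Suc n)
    then have "\<not> i \<le> a n" using not_less_Least[of n "\<lambda>t. i \<le> a t"] by (simp add: t_def)
    then show ?thesis using t step[of n] Suc by auto
  qed
  then show ?thesis using t by blast
qed

text \<open>Counts the rungs that have \<open>x\<close> strictly on their right; these form an
  initial segment, so the count is the first triangle containing \<open>x\<close>. For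
  \<open>e\<close> the ends of a rung count as lying on its right, which gives the last
  triangle.\<close>

definition s :: "'a \<Rightarrow> nat" where
  "s x = card {t. t \<le> m \<and> x \<notin> \<alpha> ` {..a t} \<union> \<beta> ` {..b t}}"

definition e :: "'a \<Rightarrow> nat" where
  "e x = card {t. t \<le> m \<and> x \<notin> \<alpha> ` {..<a t} \<union> \<beta> ` {..<b t}}"

end

text \<open>A downward closed set of numbers up to \<open>m\<close> is an initial segment, and its
  cardinality is the first number missing.\<close>

lemma card_initial_segment:
  assumes "\<And>t t'. t \<le> t' \<Longrightarrow> t' \<le> m \<Longrightarrow> P t' \<Longrightarrow> P t" and "t \<le> m"
  shows "t < card {t. t \<le> m \<and> P t} \<longleftrightarrow> P t"
proof
  have fin: "finite {t. t \<le> m \<and> P t}" by simp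
  assume "P t"
  then have "{..t} \<subseteq> {t. t \<le> m \<and> P t}" using assms by auto
  then have "card {..t} \<le> card {t. t \<le> m \<and> P t}" by (rule card_mono[OF fin])
  then show "t < card {t. t \<le> m \<and> P t}" by simp
next
  assume less: "t < card {t. t \<le> m \<and> P t}"
  show "P t"
  proof (rule ccontr)
    assume "\<not> P t"
    then have "{t. t \<le> m \<and> P t} \<subseteq> {..<t}" using assms(1)[of t] by (auto simp: not_less[symmetric])
    then have "card {t. t \<le> m \<and> P t} \<le> card {..<t}" by (rule card_mono[OF finite_lessThan])
    then show False using less by simp
  qed
qed

context strip_edges
begin

lemma mem_left_\<alpha>:
  assumes "i \<le> Suc p" "t \<le> m"
  shows "\<alpha> i \<in> \<alpha> ` {..a t} \<union> \<beta> ` {..b t} \<longleftrightarrow> i \<le> a t"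
    and "\<alpha> i \<in> \<alpha> ` {..<a t} \<union> \<beta> ` {..<b t} \<longleftrightarrow> i < a t"
proof -
  have ab: "a t \<le> p" "b t \<le> q" "1 \<le> a t" "1 \<le> b t"
    using a_bounds[OF assms(2)] strip_edges.a_bounds[OF swap assms(2)] by auto
  have 1: "i = k" if "\<alpha> i = \<alpha> k" "k \<le> a t" for k
    using that(1) by (rule inj_onD[OF inj_\<alpha>]) (use that ab assms in auto)
  have 2: "i = 0" if "\<alpha> i = \<beta> k" "k \<le> b t" for k
    using sides[OF assms(1) _ that(1)] that ab by auto
  show "\<alpha> i \<in> \<alpha> ` {..a t} \<union> \<beta> ` {..b t} \<longleftrightarrow> i \<le> a t"
    using 1 2 by (auto simp: image_iff)
  show "\<alpha> i \<in> \<alpha> ` {..<a t} \<union> \<beta> ` {..<b t} \<longleftrightarrow> i < a t"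
    using 1 2 ab by (force simp: image_iff)
qed

lemma mono_b: "t \<le> t' \<Longrightarrow> t' \<le> m \<Longrightarrow> b t \<le> b t'"
  by (rule strip_edges.mono_a[OF swap])

lemma
  assumes t: "t \<le> m"
  shows less_s: "t < s x \<longleftrightarrow> x \<notin> \<alpha> ` {..a t} \<union> \<beta> ` {..b t}"
    and less_e: "t < e x \<longleftrightarrow> x \<notin> \<alpha> ` {..<a t} \<union> \<beta> ` {..<b t}"
proof -
  show "t < s x \<longleftrightarrow> x \<notin> \<alpha> ` {..a t} \<union> \<beta> ` {..b t}"
    unfolding s_def
  proof (rule card_initial_segment[OF _ t])
    fix t t' assume "t \<le> t'" "t' \<le> m" "x \<notin> \<alpha> ` {..a t'} \<union> \<beta> ` {..b t'}"
    moreover have "\<alpha> ` {..a t} \<union> \<beta> ` {..b t} \<subseteq> \<alpha> ` {..a t'} \<union> \<beta> ` {..b t'}"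
      using mono_a[of t t'] mono_b[of t t'] calculation by (intro Un_mono image_mono) auto
    ultimately show "x \<notin> \<alpha> ` {..a t} \<union> \<beta> ` {..b t}" by blast
  qed
  show "t < e x \<longleftrightarrow> x \<notin> \<alpha> ` {..<a t} \<union> \<beta> ` {..<b t}"
    unfolding e_def
  proof (rule card_initial_segment[OF _ t])
    fix t t' assume "t \<le> t'" "t' \<le> m" "x \<notin> \<alpha> ` {..<a t'} \<union> \<beta> ` {..<b t'}"
    moreover have "\<alpha> ` {..<a t} \<union> \<beta> ` {..<b t} \<subseteq> \<alpha> ` {..<a t'} \<union> \<beta> ` {..<b t'}"
      using mono_a[of t t'] mono_b[of t t'] calculation by (intro Un_mono image_mono) auto
    ultimately show "x \<notin> \<alpha> ` {..<a t} \<union> \<beta> ` {..<b t}" by blast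
  qed
qed

lemma s_e_le: "s x \<le> Suc m" "e x \<le> Suc m"
proof -
  have "card {t. t \<le> m \<and> P t} \<le> Suc m" for P
    using card_mono[of "{..m}" "{t. t \<le> m \<and> P t}"] by auto
  then show "s x \<le> Suc m" "e x \<le> Suc m" by (simp_all add: s_def e_def)
qed

lemma s_swap: "strip_edges.s \<beta> \<alpha> b a m = s" and e_swap: "strip_edges.e \<beta> \<alpha> b a m = e"
  unfolding s_def[abs_def] e_def[abs_def] strip_edges.s_def[OF swap, abs_def]
    strip_edges.e_def[OF swap, abs_def] by (simp_all add: Un_commute)

lemma s_\<alpha>: "i \<le> Suc p \<Longrightarrow> t \<le> m \<Longrightarrow> s (\<alpha> i) \<le> t \<longleftrightarrow> i \<le> a t"
  and e_\<alpha>: "i \<le> Suc p \<Longrightarrow> t \<le> m \<Longrightarrow> t < e (\<alpha> i) \<longleftrightarrow> a t \<le> i"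
  using less_s[of t "\<alpha> i"] less_e[of t "\<alpha> i"] mem_left_\<alpha>[of i t] by (auto simp: not_less not_le)

lemma s_\<beta>: "j \<le> Suc q \<Longrightarrow> t \<le> m \<Longrightarrow> s (\<beta> j) \<le> t \<longleftrightarrow> j \<le> b t"
  and e_\<beta>: "j \<le> Suc q \<Longrightarrow> t \<le> m \<Longrightarrow> t < e (\<beta> j) \<longleftrightarrow> b t \<le> j"
  using strip_edges.s_\<alpha>[OF swap] strip_edges.e_\<alpha>[OF swap] unfolding s_swap e_swap by auto

text \<open>Reduces a comparison of interval ends to one condition per rung; \<open>t = e y\<close>
  is the critical instance.\<close>

lemma s_le_e_iff: "s x \<le> e y \<longleftrightarrow> (\<forall>t\<le>m. s x \<le> t \<or> t < e y)"
proof
  assume "\<forall>t\<le>m. s x \<le> t \<or> t < e y"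
  then have "e y \<le> m \<longrightarrow> s x \<le> e y" by auto
  then show "s x \<le> e y" using s_e_le(1)[of x] by linarith
qed auto

definition meet :: "'a \<Rightarrow> 'a \<Rightarrow> bool" where
  "meet x y \<longleftrightarrow> x \<in> V \<and> y \<in> V \<and> x \<noteq> y \<and> s x \<le> e y \<and> s y \<le> e x"

lemma meet_sym: "meet x y \<Longrightarrow> meet y x" by (auto simp: meet_def)

lemma \<alpha>_in: "i \<le> Suc p \<Longrightarrow> \<alpha> i \<in> V" and \<beta>_in: "j \<le> Suc q \<Longrightarrow> \<beta> j \<in> V"
  by (auto simp: V_eq)

lemma \<alpha>_meet_Suc: "i \<le> p \<Longrightarrow> meet (\<alpha> i) (\<alpha> (Suc i))"
proof -
  assume i: "i \<le> p"
  have "\<alpha> i \<noteq> \<alpha> (Suc i)"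
  proof
    assume "\<alpha> i = \<alpha> (Suc i)"
    then have "i = Suc i" by (rule inj_onD[OF inj_\<alpha>]) (use i in auto)
    then show False by simp
  qed
  moreover have "s (\<alpha> i) \<le> e (\<alpha> (Suc i))" "s (\<alpha> (Suc i)) \<le> e (\<alpha> i)"
    unfolding s_le_e_iff using s_\<alpha>[of i] s_\<alpha>[of "Suc i"] e_\<alpha>[of i] e_\<alpha>[of "Suc i"] i by fastforce+
  ultimately show ?thesis using i \<alpha>_in[of i] \<alpha>_in[of "Suc i"] by (simp add: meet_def)
qed

lemma rung_meet: "t \<le> m \<Longrightarrow> meet (\<alpha> (a t)) (\<beta> (b t))"
proof -
  assume t: "t \<le> m"
  have ab: "a t \<le> p" "b t \<le> q" "1 \<le> a t" "1 \<le> b t"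
    using a_bounds[OF t] strip_edges.a_bounds[OF swap t] by auto
  have "s (\<alpha> (a t)) \<le> t" "t < e (\<alpha> (a t))" "s (\<beta> (b t)) \<le> t" "t < e (\<beta> (b t))"
    using ab t by (simp_all add: s_\<alpha> e_\<alpha> s_\<beta> e_\<beta>)
  moreover have "\<alpha> (a t) \<noteq> \<beta> (b t)" using sides[of "a t" "b t"] ab by auto
  ultimately show ?thesis using ab \<alpha>_in[of "a t"] \<beta>_in[of "b t"] by (simp add: meet_def)
qed

lemma \<alpha>_meet_imp_edge:
  assumes "i < k" "k \<le> Suc p" "meet (\<alpha> i) (\<alpha> k)" shows "{\<alpha> i, \<alpha> k} \<in> E"
proof -
  have "k = Suc i"
  proof (rule ccontr)
    assume "k \<noteq> Suc i"
    then obtain t where t: "t \<le> m" "a t = Suc i" using ex_a[of "Suc i"] assms by auto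
    have "s (\<alpha> k) \<le> e (\<alpha> i)" using assms(3) by (simp add: meet_def)
    then have "s (\<alpha> k) \<le> t \<or> t < e (\<alpha> i)" using t by (simp only: s_le_e_iff)
    then show False using s_\<alpha>[of k t] e_\<alpha>[of i t] t assms \<open>k \<noteq> Suc i\<close> by auto
  qed
  then show ?thesis using assms by (auto simp: E_eq)
qed

text \<open>Take the first rung at or beyond both indices. The rung before it misses one of them, so
  that side has just moved and hits its index exactly; the meeting condition at the previous rung
  keeps the other side from being too far.\<close>

lemma \<alpha>_\<beta>_meet_imp_edge:
  assumes i: "1 \<le> i" "i \<le> p" and j: "1 \<le> j" "j \<le> q" and "meet (\<alpha> i) (\<beta> j)"
  shows "{\<alpha> i, \<beta> j} \<in> E"
proof -
  have 1: "i \<le> a t \<or> b t \<le> j" and 2: "j \<le> b t \<or> a t \<le> i" if t: "t \<le> m" for t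
  proof -
    have "s (\<alpha> i) \<le> t \<or> t < e (\<beta> j)" "s (\<beta> j) \<le> t \<or> t < e (\<alpha> i)"
      using assms(5) t unfolding meet_def s_le_e_iff by auto
    then show "i \<le> a t \<or> b t \<le> j" "j \<le> b t \<or> a t \<le> i"
      using s_\<alpha>[of i t] e_\<alpha>[of i t] s_\<beta>[of j t] e_\<beta>[of j t] t i j by auto
  qed
  define t where "t = (LEAST t. i \<le> a t \<and> j \<le> b t)"
  have "i \<le> a m \<and> j \<le> b m" using i j a_m b_m by simp
  then have t: "i \<le> a t \<and> j \<le> b t" "t \<le> m" unfolding t_def by (rule LeastI, rule Least_le)
  have "a t = i \<and> b t = j"
  proof (cases t)
    case 0
    then show ?thesis using t i j a_0 b_0 by simp
  next
    case (Suc n)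
    then have "\<not> (i \<le> a n \<and> j \<le> b n)"
      using not_less_Least[of n "\<lambda>t. i \<le> a t \<and> j \<le> b t"] by (simp add: t_def)
    then show ?thesis using t step[of n] 1[of n] 2[of n] Suc by auto
  qed
  then show ?thesis using t(2) by (auto simp: E_eq)
qed

lemma V_cases:
  assumes "x \<in> V"
  obtains (A) i where "i \<le> Suc p" "x = \<alpha> i" | (B) j where "1 \<le> j" "j \<le> q" "x = \<beta> j"
proof -
  consider i where "i \<le> Suc p" "x = \<alpha> i" | j where "j \<le> Suc q" "x = \<beta> j"
    using assms by (auto simp: V_eq)
  then show thesis
  proof cases
    case (2 j)
    then consider "j = 0" | "j = Suc q" | "1 \<le> j" "j \<le> q" by linarith
    then show ?thesis using 2 that(1)[of 0] that(1)[of "Suc p"] that(2) left_end right_end by cases auto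
  qed (use that in blast)
qed

lemma edge_iff_meet: "{x, y} \<in> E \<longleftrightarrow> meet x y"
proof
  assume "{x, y} \<in> E"
  then consider i where "i \<le> p" "{x, y} = {\<alpha> i, \<alpha> (Suc i)}" | j where "j \<le> q" "{x, y} = {\<beta> j, \<beta> (Suc j)}"
    | t where "t \<le> m" "{x, y} = {\<alpha> (a t), \<beta> (b t)}"
    unfolding E_eq by auto
  then show "meet x y"
  proof cases
    case 1
    then show ?thesis using \<alpha>_meet_Suc[of i] meet_sym by (auto simp: doubleton_eq_iff)
  next
    case 2
    have "strip_edges.meet V \<beta> \<alpha> b a m (\<beta> j) (\<beta> (Suc j))"
      using strip_edges.\<alpha>_meet_Suc[OF swap 2(1)] .
    then have "meet (\<beta> j) (\<beta> (Suc j))"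
      unfolding strip_edges.meet_def[OF swap] s_swap e_swap meet_def .
    then show ?thesis using 2 meet_sym by (auto simp: doubleton_eq_iff)
  next
    case 3
    then show ?thesis using rung_meet[of t] meet_sym by (auto simp: doubleton_eq_iff)
  qed
next
  assume xy: "meet x y"
  have \<alpha>\<alpha>: "{\<alpha> i, \<alpha> k} \<in> E" if "meet (\<alpha> i) (\<alpha> k)" "i \<le> Suc p" "k \<le> Suc p" for i k
  proof -
    have "i \<noteq> k" using that by (auto simp: meet_def)
    then consider "i < k" | "k < i" by linarith
    then show ?thesis
      using \<alpha>_meet_imp_edge[of i k] \<alpha>_meet_imp_edge[of k i] that meet_sym
      by cases (auto simp: insert_commute)
  qed
  have \<beta>\<beta>: "{\<beta> i, \<beta> k} \<in> E" if mt: "meet (\<beta> i) (\<beta> k)" and ik: "i \<le> Suc q" "k \<le> Suc q" for i k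
  proof -
    have ne: "i \<noteq> k" using mt by (auto simp: meet_def)
    have m': "strip_edges.meet V \<beta> \<alpha> b a m (\<beta> i) (\<beta> k)" "strip_edges.meet V \<beta> \<alpha> b a m (\<beta> k) (\<beta> i)"
      using mt meet_sym unfolding strip_edges.meet_def[OF swap] s_swap e_swap meet_def[symmetric] by auto
    consider "i < k" | "k < i" using ne by linarith
    then show ?thesis
      using strip_edges.\<alpha>_meet_imp_edge[OF swap, of i k] strip_edges.\<alpha>_meet_imp_edge[OF swap, of k i] ik m'
      by cases (auto simp: insert_commute)
  qed
  have \<alpha>\<beta>: "{\<alpha> i, \<beta> j} \<in> E" if mt: "meet (\<alpha> i) (\<beta> j)" and ij: "i \<le> Suc p" "1 \<le> j" "j \<le> q" for i j
  proof -
    consider "i = 0" | "i = Suc p" | "1 \<le> i" "i \<le> p" using ij by linarith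
    then show ?thesis
    proof cases
      case 1
      then show ?thesis using \<beta>\<beta>[of 0 j] mt ij left_end by simp
    next
      case 2
      then show ?thesis using \<beta>\<beta>[of "Suc q" j] mt ij right_end by simp
    next
      case 3
      then show ?thesis using \<alpha>_\<beta>_meet_imp_edge mt ij by blast
    qed
  qed
  have "x \<in> V" "y \<in> V" using xy by (auto simp: meet_def)
  then show "{x, y} \<in> E"
  proof (cases rule: V_cases[case_product V_cases])
    case (A_A i k)
    then show ?thesis using \<alpha>\<alpha> xy by simp
  next
    case (A_B i j)
    then show ?thesis using \<alpha>\<beta> xy by simp
  next
    case (B_A j i)
    then show ?thesis using \<alpha>\<beta>[of i j] meet_sym[OF xy] by (simp add: insert_commute)
  next
    case (B_B j k)
    then show ?thesis using \<beta>\<beta> xy by simp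
  qed
qed

lemma strip: "strip V E \<alpha> \<beta> a b p q m s e"
  by unfold_locales
    (use V_eq left_end right_end inj_\<alpha> inj_\<beta> sides a_0 b_0 a_m b_m step edge_iff_meet meet_def
      s_\<alpha> e_\<alpha> s_\<beta> e_\<beta> s_e_le in auto)

text \<open>Attaching \<open>u\<close> to the last edge of \<open>\<beta>\<close>: the old right end
  becomes the last inner vertex of \<open>\<alpha>\<close>, the edge between it and
  \<open>\<beta> q\<close> becomes a rung, and \<open>u\<close> is the new common end.\<close>

lemma extend:
  assumes u: "u \<notin> V"
  shows "strip_edges (insert u V) (E \<union> {{u, \<alpha> (Suc p)}, {u, \<beta> q}}) (\<alpha>(Suc (Suc p) := u)) (\<beta>(Suc q := u))
    (a(Suc m := Suc p)) (b(Suc m := q)) (Suc p) q (Suc m)"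
proof (unfold_locales, goal_cases)
  have \<alpha>u: "\<alpha> i \<noteq> u" if "i \<le> Suc p" for i using that u by (auto simp: V_eq)
  have \<beta>u: "\<beta> i \<noteq> u" if "i \<le> Suc q" for i using that u by (auto simp: V_eq)
  {
    case 1
    have "{..Suc (Suc p)} = insert (Suc (Suc p)) {..Suc p}" "{..Suc q} = insert (Suc q) {..q}" by auto
    moreover have "(\<alpha>(Suc (Suc p) := u)) ` {..Suc p} = \<alpha> ` {..Suc p}" "(\<beta>(Suc q := u)) ` {..q} = \<beta> ` {..q}"
      by (intro image_cong; simp)+
    moreover have "V = \<alpha> ` {..Suc p} \<union> \<beta> ` {..q}"
      unfolding V_eq atMost_Suc[of q] image_insert right_end[symmetric] by auto
    ultimately show ?case by auto
  next
    case 2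
    then show ?case using left_end by simp
  next
    case 3
    then show ?case by simp
  next
    case 4
    have "inj_on (\<alpha>(Suc (Suc p) := u)) (insert (Suc (Suc p)) {..Suc p})"
    proof (rule inj_on_insert[THEN iffD2], intro conjI)
      show "inj_on (\<alpha>(Suc (Suc p) := u)) {..Suc p}"
        by (rule inj_on_cong[THEN iffD2, OF _ inj_\<alpha>]) simp
    qed (use \<alpha>u \<alpha>u[symmetric] in auto)
    then show ?case by (simp add: atMost_Suc)
  next
    case 5
    have "inj_on (\<beta>(Suc q := u)) (insert (Suc q) {..q})"
    proof (rule inj_on_insert[THEN iffD2], intro conjI)
      show "inj_on (\<beta>(Suc q := u)) {..q}"
        by (rule inj_on_cong[THEN iffD2, OF _ inj_on_subset[OF inj_\<beta>]]) auto
    next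
      have "u \<notin> \<beta> ` {..q}" using u by (auto simp: V_eq)
      then show "(\<beta>(Suc q := u)) (Suc q) \<notin> (\<beta>(Suc q := u)) ` ({..q} - {Suc q})" by auto
    qed
    then show ?case by (simp add: atMost_Suc)
  next
    case (6 i j)
    then show ?case using sides[of i j] \<alpha>u[of i] \<beta>u[of j]
      by (cases "i = Suc (Suc p)"; cases "j = Suc q") (auto split: if_splits)
  next
    case (11 t)
    then show ?case using step[of t] a_m b_m by (cases "t = m") auto
  next
    case 12
    have A: "(\<lambda>i. {(\<alpha>(Suc (Suc p) := u)) i, (\<alpha>(Suc (Suc p) := u)) (Suc i)}) ` {..Suc p} =
      insert {\<alpha> (Suc p), u} ((\<lambda>i. {\<alpha> i, \<alpha> (Suc i)}) ` {..p})"
      unfolding atMost_Suc image_insert by (intro arg_cong2[of _ _ _ _ insert] image_cong) auto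
    have split: "{..q} = insert q {..<q}" by auto
    have B: "(\<lambda>j. {(\<beta>(Suc q := u)) j, (\<beta>(Suc q := u)) (Suc j)}) ` {..q} =
      insert {\<beta> q, u} ((\<lambda>j. {\<beta> j, \<beta> (Suc j)}) ` {..<q})"
      unfolding split image_insert by (intro arg_cong2[of _ _ _ _ insert] image_cong) auto
    have R: "(\<lambda>t. {(\<alpha>(Suc (Suc p) := u)) ((a(Suc m := Suc p)) t), (\<beta>(Suc q := u)) ((b(Suc m := q)) t)}) ` {..Suc m} =
      insert {\<alpha> (Suc p), \<beta> q} ((\<lambda>t. {\<alpha> (a t), \<beta> (b t)}) ` {..m})"
    proof -
      have ab: "a t \<noteq> Suc (Suc p)" "b t \<noteq> Suc q" if "t \<le> m" for t
        using a_bounds(2)[OF that] strip_edges.a_bounds(2)[OF swap that] by auto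
      show ?thesis unfolding atMost_Suc image_insert
        by (intro arg_cong2[of _ _ _ _ insert] image_cong) (use ab in auto)
    qed
    \<comment> \<open>The last edge of \<open>\<beta>\<close> is split off because it turns from a
      side edge into the new rung.\<close>
    have "E = (\<lambda>i. {\<alpha> i, \<alpha> (Suc i)}) ` {..p} \<union> insert {\<beta> q, \<alpha> (Suc p)} ((\<lambda>j. {\<beta> j, \<beta> (Suc j)}) ` {..<q}) \<union>
      (\<lambda>t. {\<alpha> (a t), \<beta> (b t)}) ` {..m}"
      unfolding E_eq split image_insert right_end by simp
    then show ?case unfolding A B R by (auto simp: insert_commute)
  }
qed (use a_0 b_0 in auto)

end


lemma ex_strip_edgesI:
  "strip_edges V E \<alpha> \<beta> a b p q m \<Longrightarrow> \<alpha> (Suc p) = r \<Longrightarrow>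
    \<exists>\<alpha> \<beta> a b p q m. strip_edges V E \<alpha> \<beta> a b p q m \<and> \<alpha> (Suc p) = r"
  by blast

text \<open>The interval representation of the current graph shows that the neighbours of the right
  end are just \<open>\<alpha> p\<close> and \<open>\<beta> q\<close>, the ends of the last rung; so
  \<open>extend\<close> and its copy with exchanged sides cover every construction step.\<close>

lemma two_path_to_strip_edges:
  assumes "two_path_to V E r"
  shows "\<exists>\<alpha> \<beta> a b p q m. strip_edges V E \<alpha> \<beta> a b p q m \<and> \<alpha> (Suc p) = r"
  using assms
proof induction
  case (base l x y r)
  let ?\<alpha> = "\<lambda>i. if i = 0 then l else if i = Suc 0 then x else r"
  let ?\<beta> = "\<lambda>i. if i = 0 then l else if i = Suc 0 then y else r"
  have S: "strip_edges {l, x, y, r} {{l, x}, {x, r}, {r, y}, {y, l}, {x, y}} ?\<alpha> ?\<beta> (\<lambda>_. 1) (\<lambda>_. 1) 1 1 0"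
    by unfold_locales
      (use base in \<open>auto simp: inj_on_def atMost_Suc le_Suc_eq insert_commute split: if_splits\<close>)
  then show ?case by (rule ex_strip_edgesI) simp
next
  case (extend V E r u w)
  then obtain \<alpha> \<beta> a b p q m where S: "strip_edges V E \<alpha> \<beta> a b p q m" and r: "\<alpha> (Suc p) = r" by blast
  interpret strip_edges V E \<alpha> \<beta> a b p q m by (rule S)
  interpret strip V E \<alpha> \<beta> a b p q m s e by (rule strip)
  have w: "w \<in> V" "w \<noteq> r" "Suc m \<le> e w" using extend.hyps(3) r by (auto simp: adj)
  then have "s w \<le> m" using s_right_iff[of w] s_le[of w] r by fastforce
  then have "w = \<alpha> p \<or> w = \<beta> q" using rung_iff[of w m] w a_m b_m by auto
  then show ?case
  proof
    assume "w = \<beta> q"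
    then have "E \<union> {{u, r}, {u, w}} = E \<union> {{u, \<alpha> (Suc p)}, {u, \<beta> q}}" using r by simp
    then show ?thesis using ex_strip_edgesI[OF extend[OF extend.hyps(2)], of u] by simp
  next
    assume "w = \<alpha> p"
    then have "E \<union> {{u, r}, {u, w}} = E \<union> {{u, \<beta> (Suc q)}, {u, \<alpha> p}}" using r right_end by simp
    then show ?thesis
      using ex_strip_edgesI[OF strip_edges.extend[OF strip_edges.swap[OF S] extend.hyps(2)], of u] by simp
  qed
qed

lemma two_path_strip:
  assumes "two_path V E"
  obtains \<alpha> \<beta> a b p q m s e where "strip V E \<alpha> \<beta> a b p q m s e"
proof -
  obtain r where "two_path_to V E r" using assms by (auto simp: two_path_def)
  from two_path_to_strip_edges[OF this] show thesis using that strip_edges.strip by metis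
qed

section \<open>Degrees, choice of orientation and number of edges\<close>

context strip
begin

lemma finite_neighbours: "finite {w. {v, w} \<in> E}"
  by (rule finite_subset[OF _ finite_V]) (auto simp: adj)

lemma neighbours_left: "{w. {\<alpha> 0, w} \<in> E} = {\<alpha> 1, \<beta> 1}"
proof (intro equalityI subsetI)
  fix w assume "w \<in> {w. {\<alpha> 0, w} \<in> E}"
  then have w: "w \<in> V" "w \<noteq> \<alpha> 0" "s w \<le> 0" by (auto simp: adj)
  then have "0 < e w" using e_left_iff by auto
  then show "w \<in> {\<alpha> 1, \<beta> 1}" using rung_iff[of w 0] w a_0 b_0 by auto
next
  fix w assume "w \<in> {\<alpha> 1, \<beta> 1}"
  then show "w \<in> {w. {\<alpha> 0, w} \<in> E}" using \<alpha>_edge[of 0] \<beta>_edge[of 0] left_end by auto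
qed

lemma degree_left: "card {w. {\<alpha> 0, w} \<in> E} = 2"
  unfolding neighbours_left using sides[of 1 1] p_ge_1 by (auto simp: card_insert_if)

text \<open>Two neighbours along the side and one across a rung.\<close>

lemma degree_\<alpha>: "1 \<le> i \<Longrightarrow> i \<le> p \<Longrightarrow> 3 \<le> card {w. {\<alpha> i, w} \<in> E}"
proof -
  assume i: "1 \<le> i" "i \<le> p"
  then obtain k where k: "i = Suc k" by (cases i) auto
  obtain t where t: "t \<le> m" "a t = i" using ex_a i by blast
  note bb = b_bounds[OF t(1)]
  have "\<alpha> k \<noteq> \<alpha> (Suc i)"
  proof
    assume "\<alpha> k = \<alpha> (Suc i)"
    then have "k = Suc i" by (rule inj_onD[OF inj_\<alpha>]) (use i k in auto)
    then show False using k by simp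
  qed
  moreover have "\<alpha> k \<noteq> \<beta> (b t)" "\<alpha> (Suc i) \<noteq> \<beta> (b t)"
    using sides[of k "b t"] sides[of "Suc i" "b t"] i k bb by auto
  ultimately have "card {\<alpha> k, \<alpha> (Suc i), \<beta> (b t)} = 3" by simp
  moreover have "{\<alpha> i, \<beta> (b t)} \<in> E"
  proof -
    note r = rung_iff[OF rung_mem(1)[OF t(1)] t(1)] rung_iff[OF rung_mem(2)[OF t(1)] t(1)]
    show ?thesis using r rung_mem[OF t(1)] rung_distinct[OF t(1)] t(2) by (auto simp: adj)
  qed
  then have "{\<alpha> k, \<alpha> (Suc i), \<beta> (b t)} \<subseteq> {w. {\<alpha> i, w} \<in> E}"
    using \<alpha>_edge[of k] \<alpha>_edge[of i] i k by (auto simp: insert_commute)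
  ultimately show ?thesis using card_mono[OF finite_neighbours] by metis
qed

lemma degree_ge_3: "v \<in> V \<Longrightarrow> v \<noteq> \<alpha> 0 \<Longrightarrow> v \<noteq> \<alpha> (Suc p) \<Longrightarrow> 3 \<le> card {w. {v, w} \<in> E}"
  by (erule V_cases) (use degree_\<alpha> strip.degree_\<alpha>[OF swap] in auto)

lemma degree_le_2: "v \<in> V \<Longrightarrow> card {w. {v, w} \<in> E} \<le> 2 \<Longrightarrow> v = \<alpha> 0 \<or> v = \<alpha> (Suc p)"
  using degree_ge_3[of v] by linarith

end

text \<open>The program starts at whichever vertex of degree 2 it meets first and reads its
  neighbours in the order of the list. Reflection and exchange of sides adapt the strip to these
  choices.\<close>

lemma two_path_strip_from:
  assumes "two_path V E" "v \<in> V" "{w. {v, w} \<in> E} = {x, y}" "x \<noteq> y"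
  obtains \<alpha> \<beta> a b p q m s e where "strip V E \<alpha> \<beta> a b p q m s e" "\<alpha> 0 = v" "\<alpha> 1 = x" "\<beta> 1 = y"
proof -
  obtain \<alpha> \<beta> a b p q m s e where S: "strip V E \<alpha> \<beta> a b p q m s e" using two_path_strip[OF assms(1)] .
  interpret strip V E \<alpha> \<beta> a b p q m s e by (rule S)
  have "\<exists>\<alpha> \<beta> a b p q m s e. strip V E \<alpha> \<beta> a b p q m s e \<and> \<alpha> 0 = v"
  proof -
    have "v = \<alpha> 0 \<or> v = \<alpha> (Suc p)"
      using degree_le_2[OF assms(2)] assms(3,4) by simp
    then show ?thesis
    proof
      assume "v = \<alpha> 0"
      then show ?thesis using S by blast
    next
      assume "v = \<alpha> (Suc p)"
      then have "(\<lambda>i. \<alpha> (Suc p - i)) 0 = v" by simp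
      then show ?thesis using mirror by blast
    qed
  qed
  then obtain \<alpha> \<beta> a b p q m s e where T: "strip V E \<alpha> \<beta> a b p q m s e" "\<alpha> 0 = v" by blast
  have "{\<alpha> 1, \<beta> 1} = {x, y}" using strip.neighbours_left[OF T(1)] T(2) assms(3) by simp
  then consider "\<alpha> 1 = x" "\<beta> 1 = y" | "\<alpha> 1 = y" "\<beta> 1 = x" by (auto simp: doubleton_eq_iff)
  then show thesis
  proof cases
    case 1
    then show ?thesis using that T by blast
  next
    case 2
    have "\<beta> 0 = v" using strip.left_end[OF T(1)] T(2) by simp
    then show ?thesis using that[OF strip.swap[OF T(1)]] 2 by blast
  qed
qed

text \<open>Ordered pairs count the entries of all adjacency lists: ten for the initial graph with
  four vertices, at most four more for each new vertex.\<close>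

lemma two_path_to_arcs:
  assumes "two_path_to V E r"
  shows "finite V \<and> r \<in> V \<and> \<Union>E \<subseteq> V \<and> finite {(v, w). {v, w} \<in> E} \<and>
    card {(v, w). {v, w} \<in> E} + 6 \<le> 4 * card V"
  using assms
proof induction
  case (base l x y r)
  let ?E = "{{l, x}, {x, r}, {r, y}, {y, l}, {x, y}}"
  let ?A = "[(l, x), (x, l), (x, r), (r, x), (r, y), (y, r), (y, l), (l, y), (x, y), (y, x)]"
  have sub: "{(v, w). {v, w} \<in> ?E} \<subseteq> set ?A" by (auto simp: doubleton_eq_iff)
  have "card {(v, w). {v, w} \<in> ?E} \<le> card (set ?A)" by (rule card_mono[OF _ sub]) simp
  also have "\<dots> \<le> 10" using card_length[of ?A] by simp
  finally have "card {(v, w). {v, w} \<in> ?E} \<le> 10" .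
  moreover have "card {l, x, y, r} = 4" using base by auto
  moreover have "finite {(v, w). {v, w} \<in> ?E}" using finite_subset[OF sub] by simp
  ultimately show ?case by auto
next
  case (extend V E r u w)
  let ?E = "E \<union> {{u, r}, {u, w}}"
  let ?A = "{(u, r), (r, u), (u, w), (w, u)}"
  have sub: "{(v, w). {v, w} \<in> ?E} \<subseteq> {(v, w). {v, w} \<in> E} \<union> ?A" by (auto simp: doubleton_eq_iff)
  have fin: "finite ({(v, w). {v, w} \<in> E} \<union> ?A)" using extend.IH by simp
  have "card {(v, w). {v, w} \<in> ?E} \<le> card ({(v, w). {v, w} \<in> E} \<union> ?A)" by (rule card_mono[OF fin sub])
  also have "\<dots> \<le> card {(v, w). {v, w} \<in> E} + card ?A" by (rule card_Un_le)
  also have "card ?A \<le> 4" using card_length[of "[(u, r), (r, u), (u, w), (w, u)]"] by simp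
  finally have "card {(v, w). {v, w} \<in> ?E} \<le> card {(v, w). {v, w} \<in> E} + 4" by simp
  moreover have "card (insert u V) = Suc (card V)" using extend by simp
  moreover have "finite {(v, w). {v, w} \<in> ?E}" using finite_subset[OF sub fin] .
  moreover have "r \<in> V" "w \<in> V" using extend by auto
  ultimately show ?case using extend.IH by auto
qed

section \<open>Neighbours remaining while the strip is peeled\<close>

context strip
begin

text \<open>The neighbours left after removing all vertices whose last triangle is at most
  \<open>t\<close>. The machine never stores this set; it works with sizes and sums of such
  sets.\<close>

definition rest :: "nat \<Rightarrow> 'a \<Rightarrow> 'a set" where
  "rest t x = {w. {x, w} \<in> E \<and> t < e w}"

lemma finite_rest: "finite (rest t x)"
  by (rule finite_subset[OF _ finite_neighbours[of x]]) (auto simp: rest_def)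

lemma rung_adj: "t \<le> m \<Longrightarrow> {\<alpha> (a t), \<beta> (b t)} \<in> E"
proof -
  assume t: "t \<le> m"
  show ?thesis using rung_iff[OF rung_mem(1)[OF t] t] rung_iff[OF rung_mem(2)[OF t] t]
      rung_mem[OF t] rung_distinct[OF t] by (simp add: adj)
qed

lemma rest_0: "rest 0 x = {w. {x, w} \<in> E} - {\<alpha> 0}"
proof -
  have "0 < e w \<longleftrightarrow> w \<noteq> \<alpha> 0" if "w \<in> V" for w using e_left_iff[OF that] by auto
  then show ?thesis by (auto simp: rest_def adj)
qed

lemma ex_s: "t \<le> m \<Longrightarrow> \<exists>z\<in>V. s z = Suc t"
proof (cases "t = m")
  case False
  assume "t \<le> m"
  then have t: "t < m" "Suc t \<le> m" using False by auto
  let ?z = "if a (Suc t) = Suc (a t) then \<alpha> (a (Suc t)) else \<beta> (b (Suc t))"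
  have "?z \<in> V" by (rule if_split[THEN iffD2]) (use rung_mem[OF t(2)] in blast)
  then show ?thesis using s_Suc_iff[OF _ t(1)] by blast
next
  case True
  then show ?thesis using s_right by blast
qed

context
  fixes t assumes t: "t < m" and up: "a (Suc t) = Suc (a t)"
begin

lemma same_b: "b (Suc t) = b t"
  using step[OF t] up by auto

lemma e_old: "e (\<alpha> (a t)) = Suc t"
  using e_\<alpha>[of "a t" t] e_\<alpha>[of "a t" "Suc t"] a_bounds[of t] t up by auto

lemma s_new: "s (\<alpha> (a (Suc t))) = Suc t"
  using s_Suc_iff[OF rung_mem(1)[of "Suc t"] t] t up by simp

text \<open>No other vertex has its last triangle at \<open>t + 1\<close>, so moving to the next
  rung removes only the end that is left behind.\<close>

lemma rest_Suc: "rest (Suc t) x = rest t x - {\<alpha> (a t)}"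
proof -
  have "w \<in> V \<Longrightarrow> e w = Suc t \<longleftrightarrow> w = \<alpha> (a t)" for w
    using e_inj[of w "\<alpha> (a t)"] e_old t rung_mem(1)[of t] by auto
  moreover have "Suc t < e w \<longleftrightarrow> t < e w \<and> e w \<noteq> Suc t" for w by auto
  ultimately have "w \<in> V \<Longrightarrow> Suc t < e w \<longleftrightarrow> t < e w \<and> w \<noteq> \<alpha> (a t)" for w by blast
  then show ?thesis by (auto simp: rest_def adj)
qed

lemma rest_new: "rest (Suc t) (\<alpha> (a (Suc t))) = {w. {\<alpha> (a (Suc t)), w} \<in> E} - {\<alpha> (a t)}"
  unfolding rest_Suc using s_new by (auto simp: rest_def adj)

lemma old_adj_new: "\<alpha> (a t) \<in> {w. {\<alpha> (a (Suc t)), w} \<in> E}"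
  using \<alpha>_edge[of "a t"] a_bounds[of t] t up by (simp add: insert_commute)

lemma old_in_rest: "\<alpha> (a t) \<in> rest t (\<beta> (b t))"
  using rung_adj[of t] e_old t by (simp add: rest_def insert_commute)

text \<open>The leaving vertex ends with triangle \<open>t + 1\<close>. Its remaining neighbours
  begin no later, so they are the other end of rung \<open>t\<close> or the one vertex that begins
  in that triangle.\<close>

lemma rest_old: "rest t (\<alpha> (a t)) = {\<beta> (b t), \<alpha> (a (Suc t))}" "\<beta> (b t) \<noteq> \<alpha> (a (Suc t))"
proof -
  show "\<beta> (b t) \<noteq> \<alpha> (a (Suc t))" using rung_distinct[of "Suc t"] t same_b by simp
  show "rest t (\<alpha> (a t)) = {\<beta> (b t), \<alpha> (a (Suc t))}"
  proof (intro equalityI subsetI)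
    fix w assume "w \<in> rest t (\<alpha> (a t))"
    then have w: "w \<in> V" "w \<noteq> \<alpha> (a t)" "s w \<le> Suc t" "t < e w" by (auto simp: rest_def adj e_old)
    then consider "s w \<le> t" | "s w = Suc t" by linarith
    then show "w \<in> {\<beta> (b t), \<alpha> (a (Suc t))}"
      using rung_iff[OF w(1), of t] s_Suc_iff[OF w(1) t] w t up by cases auto
  next
    have "t < e (\<alpha> (a (Suc t)))" using s_new s_le_e[OF rung_mem(1)[of "Suc t"]] t by simp
    moreover have "t < e (\<beta> (b t))" using rung_iff[OF rung_mem(2)[of t], of t] t by simp
    ultimately show "w \<in> rest t (\<alpha> (a t))" if "w \<in> {\<beta> (b t), \<alpha> (a (Suc t))}" for w
      using that rung_adj[of t] old_adj_new t by (auto simp: rest_def insert_commute)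
  qed
qed

text \<open>The end that stays is adjacent to the leaving vertex, the entering one and the vertex
  that first appears in triangle \<open>t + 2\<close>. Together with \<open>rest_old\<close> this
  lets the size of a remaining neighbourhood tell which side advances.\<close>

lemma rest_other: "3 \<le> card (rest t (\<beta> (b t)))"
proof -
  let ?y = "\<beta> (b t)"
  have tm: "t \<le> m" "Suc t \<le> m" using t by auto
  obtain z where z: "z \<in> V" "s z = Suc (Suc t)" using ex_s[OF tm(2)] by blast
  have "Suc t < e ?y" using e_\<beta>[of "b t" "Suc t"] same_b b_bounds[OF tm(1)] tm by simp
  moreover have "s ?y \<le> t" using rung_iff[OF rung_mem(2)[OF tm(1)] tm(1)] by simp
  ultimately have "{?y, z} \<in> E" using z rung_mem(2)[OF tm(1)] s_le_e[OF z(1)] by (auto simp: adj)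
  then have 1: "z \<in> rest t ?y" using z s_le_e[OF z(1)] by (simp add: rest_def)
  have "{?y, \<alpha> (a (Suc t))} \<in> E" using rung_adj[OF tm(2)] same_b by (simp add: insert_commute)
  then have 2: "\<alpha> (a (Suc t)) \<in> rest t ?y"
    using s_new s_le_e[OF rung_mem(1)[OF tm(2)]] by (simp add: rest_def)
  have "s (\<alpha> (a t)) \<le> t" using rung_iff[OF rung_mem(1)[OF tm(1)] tm(1)] by simp
  then have "card {z, \<alpha> (a (Suc t)), \<alpha> (a t)} = 3" using z s_new by (auto simp: card_insert_if)
  moreover have "{z, \<alpha> (a (Suc t)), \<alpha> (a t)} \<subseteq> rest t ?y" using 1 2 old_in_rest by simp
  ultimately show ?thesis using card_mono[OF finite_rest] by metis
qed

end

end


section \<open>Verification of programs\<close>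

definition runs :: "nat \<Rightarrow> prog \<Rightarrow> (nat \<Rightarrow> nat) \<Rightarrow> (nat \<Rightarrow> nat) \<Rightarrow> nat \<Rightarrow>
    ((nat \<Rightarrow> nat) \<Rightarrow> (nat \<Rightarrow> nat) \<Rightarrow> bool) \<Rightarrow> bool" where
  "runs W c R M T Q \<longleftrightarrow> (\<exists>t R' M'. exec W c (R, M) t (R', M') \<and> t \<le> T \<and> Q R' M')"

text \<open>For loop-free programs only: the values for loops are junk.\<close>

fun wp :: "nat \<Rightarrow> prog \<Rightarrow> ((nat \<Rightarrow> nat) \<Rightarrow> (nat \<Rightarrow> nat) \<Rightarrow> bool) \<Rightarrow>
    (nat \<Rightarrow> nat) \<Rightarrow> (nat \<Rightarrow> nat) \<Rightarrow> bool" where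
  "wp W Skip Q R M = Q R M"
| "wp W (Assign i f) Q R M = (eval_rhs f (R, M) < W \<and> Q (R(i := eval_rhs f (R, M))) M)"
| "wp W (Store i j) Q R M = (R i < W \<and> R j < W \<and> Q R (M(R i := R j)))"
| "wp W (Seq c d) Q R M = wp W c (wp W d Q) R M"
| "wp W (IfLess i j c d) Q R M = (if R i < R j then wp W c Q R M else wp W d Q R M)"
| "wp W (WhileLess i j c) Q R M = False"

fun cost :: "prog \<Rightarrow> nat" where
  "cost (Seq c d) = cost c + cost d"
| "cost (IfLess i j c d) = Suc (max (cost c) (cost d))"
| "cost c = 1"

definition block :: "prog list \<Rightarrow> prog" where "block cs = foldr Seq cs Skip"

lemma wp_block [simp]:
  "wp W (block []) Q = Q" "wp W (block (c # cs)) Q = wp W c (wp W (block cs) Q)"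
  by (intro ext, simp add: block_def)+

lemma cost_block [simp]: "cost (block []) = 1" "cost (block (c # cs)) = cost c + cost (block cs)"
  by (simp_all add: block_def)

lemma runs_weaken:
  "runs W c R M T Q \<Longrightarrow> T \<le> T' \<Longrightarrow> (\<And>R M. Q R M \<Longrightarrow> Q' R M) \<Longrightarrow> runs W c R M T' Q'"
  unfolding runs_def by (meson le_trans)

lemma runs_Seq:
  assumes "runs W c R M T P" "\<And>R M. P R M \<Longrightarrow> runs W d R M T' Q"
  shows "runs W (Seq c d) R M (T + T') Q"
proof -
  obtain t R' M' where 1: "exec W c (R, M) t (R', M')" "t \<le> T" "P R' M'"
    using assms(1) by (auto simp: runs_def)
  obtain t' R'' M'' where 2: "exec W d (R', M') t' (R'', M'')" "t' \<le> T'" "Q R'' M''"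
    using assms(2)[OF 1(3)] by (auto simp: runs_def)
  have "exec W (Seq c d) (R, M) (t + t') (R'', M'')" using exec.Seq 1 2 by blast
  moreover have "t + t' \<le> T + T'" using 1 2 by simp
  ultimately show ?thesis using 2 unfolding runs_def by blast
qed

lemma runs_If:
  assumes "R i < R j \<Longrightarrow> runs W c R M T Q" "\<not> R i < R j \<Longrightarrow> runs W d R M T Q"
  shows "runs W (IfLess i j c d) R M (Suc T) Q"
  using assms unfolding runs_def by (cases "R i < R j") (meson exec.IfTrue exec.IfFalse Suc_le_mono)+

lemma wp_runs: "wp W c Q R M \<Longrightarrow> runs W c R M (cost c) Q"
proof (induction c arbitrary: R M Q)
  case Skip
  then show ?case by (auto simp: runs_def intro!: exI exec.Skip)
next
  case (Assign i f)
  then show ?case unfolding runs_def by (fastforce intro: exec.Assign)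
next
  case (Store i j)
  then show ?case unfolding runs_def by (fastforce intro: exec.Store)
next
  case (Seq c d)
  have "runs W c R M (cost c) (wp W d Q)" using Seq by simp
  then show ?case unfolding cost.simps by (rule runs_Seq) (rule Seq.IH)
next
  case (IfLess i j c d)
  show ?case unfolding cost.simps
  proof (rule runs_If)
    assume "R i < R j"
    then have "runs W c R M (cost c) Q" using IfLess by simp
    then show "runs W c R M (max (cost c) (cost d)) Q" by (rule runs_weaken) simp_all
  next
    assume "\<not> R i < R j"
    then have "runs W d R M (cost d) Q" using IfLess by simp
    then show "runs W d R M (max (cost c) (cost d)) Q" by (rule runs_weaken) simp_all
  qed
qed simp

text \<open>Each iteration pays one step for the test and at most \<open>T\<close> for the body
  while the measure drops; the final \<open>1\<close> is the failing test.\<close>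

lemma runs_While:
  assumes body: "\<And>R M. I R M \<Longrightarrow> R i < R j \<Longrightarrow>
      runs W c R M T (\<lambda>R' M'. I R' M' \<and> \<mu> R' M' < (\<mu> R M :: nat))"
    and exit: "\<And>R M. I R M \<Longrightarrow> \<not> R i < R j \<Longrightarrow> Q R M"
    and I: "I R M"
  shows "runs W (WhileLess i j c) R M (\<mu> R M * Suc T + 1) Q"
  using I
proof (induction "\<mu> R M" arbitrary: R M rule: less_induct)
  case less
  show ?case
  proof (cases "R i < R j")
    case False
    then have "exec W (WhileLess i j c) (R, M) 1 (R, M)" by (rule exec.WhileFalse)
    moreover have "1 \<le> \<mu> R M * Suc T + 1" by simp
    ultimately show ?thesis using exit[OF less.prems False] unfolding runs_def by blast
  next
    case True
    obtain t R' M' where 1: "exec W c (R, M) t (R', M')" "t \<le> T" "I R' M'" "\<mu> R' M' < \<mu> R M"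
      using body[OF less.prems True] by (auto simp: runs_def)
    obtain t' R'' M'' where 2: "exec W (WhileLess i j c) (R', M') t' (R'', M'')"
      "t' \<le> \<mu> R' M' * Suc T + 1" "Q R'' M''"
      using less.hyps[OF 1(4,3)] by (auto simp: runs_def)
    have "Suc (\<mu> R' M') * Suc T \<le> \<mu> R M * Suc T" using 1(4) by (intro mult_right_mono) auto
    then have "Suc (t + t') \<le> \<mu> R M * Suc T + 1" using 1 2 by simp
    then show ?thesis using exec.WhileTrue[OF True 1(1) 2(1)] 2(3) unfolding runs_def by blast
  qed
qed

lemma runs_While_wp:
  assumes "\<And>R M. I R M \<Longrightarrow> R i < R j \<Longrightarrow> wp W c (\<lambda>R' M'. I R' M' \<and> \<mu> R' M' < (\<mu> R M :: nat)) R M"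
    and "\<And>R M. I R M \<Longrightarrow> \<not> R i < R j \<Longrightarrow> Q R M" and "I R M"
    and "\<mu> R M \<le> N"
  shows "runs W (WhileLess i j c) R M (N * Suc (cost c) + 1) Q"
proof -
  have "runs W (WhileLess i j c) R M (\<mu> R M * Suc (cost c) + 1) Q"
    by (rule runs_While[where I = I and \<mu> = \<mu>]) (use assms wp_runs in auto)
  moreover have "\<mu> R M * Suc (cost c) + 1 \<le> N * Suc (cost c) + 1"
    using mult_right_mono[OF assms(4), of "Suc (cost c)"] by simp
  ultimately show ?thesis using runs_weaken by blast
qed

section \<open>Input layout, arrays and word size\<close>

lemma concat_nth:
  assumes "v < length xs" "k < length (xs ! v)"
  shows "concat xs ! (length (concat (take v xs)) + k) = xs ! v ! k"
proof -
  have "concat xs = concat (take v xs) @ xs ! v @ concat (drop (Suc v) xs)"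
    using id_take_nth_drop[OF assms(1)] by (metis concat.simps(2) concat_append)
  then show ?thesis using assms(2) by (simp add: nth_append)
qed

lemma distinct_imp_sum: "distinct xs \<Longrightarrow> sum_list xs = \<Sum>(set xs)" for xs :: "nat list"
  using sum_list_distinct_conv_sum_set[of xs "\<lambda>x. x"] by simp

text \<open>\<open>16 * n\<close> covers every address, as the last array ends before
  \<open>11 * n\<close>, and all counters and distances; \<open>2 * (n * n)\<close> covers the sums
  of neighbours, which are at most \<open>n * n\<close>.\<close>

locale machine_input =
  fixes V :: "nat set" and E :: "nat set set" and adj :: "nat list list" and n W :: nat
  assumes two_path: "two_path V E" and lists: "adjacency_lists V E adj" and n: "n = length adj"
    and W: "16 * n < W" "2 * (n * n) < W"
begin

definition nb :: "nat \<Rightarrow> nat set" where "nb v = {w. {v, w} \<in> E}"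

definition off :: "nat \<Rightarrow> nat" where "off v = n + 2 + length (concat (take v adj))"

definition M0 :: "nat \<Rightarrow> nat" where "M0 = snd (initial_state adj)"

lemma V_eq: "V = {..<n}" using lists by (simp add: adjacency_lists_def n[symmetric])

lemma card_V: "card V = n" by (simp add: V_eq)

lemma n_ge_4: "4 \<le> n"
proof -
  obtain \<alpha> \<beta> a b p q m s e where S: "strip V E \<alpha> \<beta> a b p q m s e" using two_path_strip[OF two_path] .
  show ?thesis using strip.card_V[OF S] strip.p_ge_1[OF S] strip.q_ge_1[OF S] card_V by simp
qed

lemma adj_nth: "v < n \<Longrightarrow> distinct (adj ! v) \<and> set (adj ! v) = nb v"
  using lists V_eq by (auto simp: adjacency_lists_def nb_def)

lemma length_adj: "v < n \<Longrightarrow> length (adj ! v) = card (nb v)"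
  using adj_nth[of v] distinct_card by metis

lemma sum_adj: "v < n \<Longrightarrow> sum_list (adj ! v) = \<Sum>(nb v)"
  using adj_nth[of v] distinct_imp_sum by metis

lemma nb_subset: "nb v \<subseteq> {..<n}"
proof -
  obtain r where "two_path_to V E r" using two_path by (auto simp: two_path_def)
  from two_path_to_arcs[OF this] show ?thesis by (auto simp: nb_def V_eq)
qed

lemma finite_nb: "finite (nb v)" using nb_subset finite_subset by blast

lemma sum_nb_le: "\<Sum>(nb v) \<le> n * n"
proof -
  have "\<Sum>(nb v) \<le> card (nb v) * n"
    using sum_bounded_above[of "nb v" "\<lambda>x. x" n] nb_subset[of v] by fastforce
  also have "card (nb v) \<le> n" using card_mono[OF _ nb_subset[of v]] by simp
  finally show ?thesis by simp
qed

lemma card_nb_le: "card (nb v) \<le> n"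
  using card_mono[OF _ nb_subset[of v]] by simp

lemma off_0: "off 0 = n + 2" by (simp add: off_def)

lemma off_Suc: "v < n \<Longrightarrow> off (Suc v) = off v + card (nb v)"
  using length_adj[of v] by (simp add: off_def take_Suc_conv_app_nth n[symmetric])

text \<open>The n + 2 cells before the lists and at most 4 n - 6 list entries end at 5 n - 4, so the
  arrays can start at \<open>5 * n\<close>.\<close>

lemma off_n: "off n + 4 \<le> 5 * n"
proof -
  obtain r where "two_path_to V E r" using two_path by (auto simp: two_path_def)
  note arcs = two_path_to_arcs[OF this]
  have "{(v, w). {v, w} \<in> E} = Sigma {..<n} nb"
    using arcs by (auto simp: nb_def V_eq)
  then have "card {(v, w). {v, w} \<in> E} = (\<Sum>v<n. card (nb v))"
    using card_SigmaI[of "{..<n}" nb] finite_nb by simp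
  also have "\<dots> = (\<Sum>v<n. length (adj ! v))" using length_adj by simp
  also have "\<dots> = length (concat adj)"
    by (simp add: length_concat sum_list_sum_nth n[symmetric] atLeast0LessThan)
  finally show ?thesis using arcs card_V by (simp add: off_def n[symmetric])
qed

lemma off_mono: "v \<le> w \<Longrightarrow> w \<le> n \<Longrightarrow> off v \<le> off w"
proof (induction w rule: dec_induct)
  case (step w)
  then show ?case using off_Suc[of w] by simp
qed simp

lemma length_input: "length (input_words adj) = off n"
  by (simp add: input_words_def off_def n[symmetric])

lemma M0_0: "M0 0 = n"
  by (simp add: M0_def initial_state_def input_words_def n[symmetric])

lemma M0_off: "v \<le> n \<Longrightarrow> M0 (Suc v) = off v"
proof -
  assume v: "v \<le> n"
  have "Suc v < off n" using v n_ge_4 by (simp add: off_def)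
  then have "M0 (Suc v) = input_words adj ! Suc v"
    by (simp add: M0_def initial_state_def length_input)
  then show ?thesis using v
    by (simp add: input_words_def nth_append off_def n[symmetric] del: upt_Suc)
qed

lemma M0_adj: "v < n \<Longrightarrow> k < card (nb v) \<Longrightarrow> M0 (off v + k) = adj ! v ! k"
proof -
  assume v: "v < n" and k: "k < card (nb v)"
  have "off v + k < off (Suc v)" using off_Suc[OF v] k by simp
  then have "off v + k < off n" using off_mono[of "Suc v" n] v by simp
  then have "M0 (off v + k) = input_words adj ! (off v + k)"
    by (simp add: M0_def initial_state_def length_input)
  also have "\<dots> = input_words adj ! Suc (Suc n + (length (concat (take v adj)) + k))" by (simp add: off_def add.assoc)
  also have "\<dots> = concat adj ! (length (concat (take v adj)) + k)"
    by (simp add: input_words_def nth_append n[symmetric] del: upt_Suc)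
  also have "\<dots> = adj ! v ! k" using concat_nth[of v adj k] v k length_adj[OF v] by (simp add: n[symmetric])
  finally show ?thesis .
qed

text \<open>The arrays \<open>5, \<dots>, 10\<close> of the program occupy \<open>n\<close> cells each, behind the input.\<close>

definition seg :: "(nat \<Rightarrow> nat) \<Rightarrow> nat \<Rightarrow> nat set \<Rightarrow> (nat \<Rightarrow> nat) \<Rightarrow> bool" where
  "seg M k I f \<longleftrightarrow> (\<forall>i\<in>I. M (k * n + i) = f i)"

definition inp :: "(nat \<Rightarrow> nat) \<Rightarrow> bool" where "inp M \<longleftrightarrow> (\<forall>c<5 * n. M c = M0 c)"

text \<open>Addresses are read to base n with last digit \<open>i\<close>, hence distinct arrays
  never overlap.\<close>

lemma cell_eq: "i < n \<Longrightarrow> j < n \<Longrightarrow> k * n + i = l * n + j \<longleftrightarrow> k = l \<and> i = j" for k l :: nat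
proof
  assume "i < n" "j < n" "k * n + i = l * n + j"
  then show "k = l \<and> i = j"
    by (metis add_diff_cancel_left' add.commute div_mult_self3 div_less add.right_neutral less_nat_zero_code)
qed simp

lemma seg_upd_other: "l \<noteq> k \<Longrightarrow> j < n \<Longrightarrow> I \<subseteq> {..<n} \<Longrightarrow> seg (M(l * n + j := x)) k I f = seg M k I f"
  unfolding seg_def by (intro ball_cong refl) (use cell_eq[of _ j k l] in auto)

lemma seg_upd_same: "j < n \<Longrightarrow> I \<subseteq> {..<n} \<Longrightarrow> seg M k I f \<Longrightarrow> x = f j \<Longrightarrow> seg (M(k * n + j := x)) k (insert j I) f"
  by (auto simp: seg_def cell_eq)

lemma segD: "seg M k I f \<Longrightarrow> i \<in> I \<Longrightarrow> M (k * n + i) = f i"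
  by (simp add: seg_def)

lemma inp_upd: "5 \<le> k \<Longrightarrow> inp (M(k * n + j := x)) = inp M"
proof -
  assume "5 \<le> k"
  then have "5 * n \<le> k * n" by (rule mult_right_mono) simp
  then have "5 * n \<le> k * n + j" by (rule trans_le_add1)
  then show ?thesis by (auto simp: inp_def)
qed

lemma inp_off: "inp M \<Longrightarrow> v \<le> n \<Longrightarrow> M (Suc v) = off v"
  using M0_off[of v] n_ge_4 by (simp add: inp_def)

lemma inp_adj: "inp M \<Longrightarrow> v < n \<Longrightarrow> k < card (nb v) \<Longrightarrow> M (off v + k) = adj ! v ! k"
proof -
  assume v: "v < n" "k < card (nb v)" "inp M"
  have "off v + k < off (Suc v)" using off_Suc[OF v(1)] v by simp
  then have "off v + k < 5 * n" using off_mono[of "Suc v" n] v off_n by simp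
  then show ?thesis using M0_adj v by (simp add: inp_def)
qed

definition K :: "(nat \<Rightarrow> nat) \<Rightarrow> bool" where
  "K R \<longleftrightarrow> R 2 = n \<and> R 3 = 1 \<and> R 4 = 2 \<and> R 5 = 3 \<and> R 6 = 5 * n \<and> R 7 = 6 * n \<and> R 8 = 7 * n \<and>
    R 9 = 8 * n \<and> R 10 = 9 * n \<and> R 11 = 10 * n \<and> R 32 = 0"

lemma K_upd [simp]: "11 < i \<Longrightarrow> i \<noteq> 32 \<Longrightarrow> K (R(i := x)) = K R" "K (R(0 := x)) = K R"
  by (auto simp: K_def)

lemma K_D:
  "K R \<Longrightarrow> R 2 = n" "K R \<Longrightarrow> R 3 = 1" "K R \<Longrightarrow> R 4 = 2" "K R \<Longrightarrow> R 5 = 3" "K R \<Longrightarrow> R 6 = 5 * n"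
  "K R \<Longrightarrow> R 7 = 6 * n" "K R \<Longrightarrow> R 8 = 7 * n" "K R \<Longrightarrow> R 9 = 8 * n" "K R \<Longrightarrow> R 10 = 9 * n"
  "K R \<Longrightarrow> R 11 = 10 * n" "K R \<Longrightarrow> R 32 = 0"
  by (auto simp: K_def)

end


section \<open>The algorithm\<close>

text \<open>Register 32 is never assigned; it holds 0, and so \<open>Load 32\<close> fetches n from
  cell 0. The base 5 n is formed by doubling twice and adding n. Register 14 receives n + 2, the
  address of the first list.\<close>

definition init_prog :: prog where
  "init_prog = block
    [Assign 2 (Load 32), Assign 3 (Const 1), Assign 4 (Const 2), Assign 5 (Const 3),
     Assign 6 (Add 2 2), Assign 6 (Add 6 6), Assign 6 (Add 6 2), Assign 7 (Add 6 2),
     Assign 8 (Add 7 2), Assign 9 (Add 8 2), Assign 10 (Add 9 2), Assign 11 (Add 10 2),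
     Assign 14 (Add 2 4)]"

text \<open>A nested traversal as one loop: an iteration either consumes one list entry or, at the
  end of a list, stores the sum and moves to the next vertex. The iterations total the number of
  vertices plus the number of entries.\<close>

definition sum_body :: prog where
  "sum_body = block
    [Assign 15 (Add 12 4), Assign 15 (Load 15),
     IfLess 14 15
       (block [Assign 16 (Load 14), Assign 13 (Add 13 16), Assign 14 (Add 14 3)])
       (block [Assign 15 (Add 6 12), Store 15 13, Assign 13 (Const 0), Assign 12 (Add 12 3)])]"

text \<open>The degree is the difference of two consecutive offsets. The list address left in
  register 16 is reused when the traversal starts.\<close>

definition degree_prog :: "nat \<Rightarrow> nat \<Rightarrow> prog" where
  "degree_prog v d = block
    [Assign 15 (Add v 4), Assign 15 (Load 15), Assign 16 (Add v 3), Assign 16 (Load 16),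
     Assign d (Sub 15 16)]"

definition find_body :: prog where
  "find_body = block [Assign 12 (Add 12 3), degree_prog 12 17]"

text \<open>Rung 0 consists of the two neighbours of l, both at distance 1; l is subtracted from
  their sums. Register 28 becomes n - 4, the index of the last rung.\<close>

definition start_prog :: prog where
  "start_prog = block
    [Assign 18 (Load 16), Assign 16 (Add 16 3), Assign 19 (Load 16),
     degree_prog 18 20, Assign 20 (Sub 20 3),
     Assign 15 (Add 6 18), Assign 21 (Load 15), Assign 21 (Sub 21 12),
     Assign 15 (Add 6 19), Assign 22 (Load 15), Assign 22 (Sub 22 12),
     Assign 23 (Const 1), Assign 24 (Const 1), Assign 25 (Const 1), Assign 26 (Const 1),
     Assign 27 (Const 0), Assign 28 (Sub 2 5), Assign 28 (Sub 28 3),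
     Assign 15 (Add 8 25), Store 15 23, Assign 15 (Add 9 26), Store 15 24]"

text \<open>One step of the distance recurrence from the two ends of a rung, used in both directions
  and for D.\<close>

definition min_prog :: "nat \<Rightarrow> prog" where
  "min_prog d = IfLess 23 24 (Assign d (Add 23 3)) (Assign d (Add 24 3))"

text \<open>Registers 18 and 19 hold the current rung \<open>x, y\<close>. Registers 20 and 21 hold the number and
  the sum of the remaining neighbours of \<open>x\<close>, register 22 the sum of the remaining neighbours of
  \<open>y\<close>. The vertex that leaves the rung has only two remaining neighbours, so the
  vertex that enters is obtained from the sum by a subtraction.\<close>

definition peel_A :: prog where
  "peel_A = block
    [Assign 15 (Sub 21 19), Assign 22 (Sub 22 18), Assign 33 (Reg 15),
     degree_prog 33 20, Assign 20 (Sub 20 3),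
     Assign 16 (Add 6 33), Assign 21 (Load 16), Assign 21 (Sub 21 18), Assign 18 (Reg 33),
     min_prog 23, Assign 25 (Add 25 3), Assign 16 (Add 8 25), Store 16 23,
     Assign 16 (Add 7 27), Store 16 32]"

definition peel_B :: prog where
  "peel_B = block
    [Assign 33 (Sub 22 18), Assign 20 (Sub 20 3), Assign 21 (Sub 21 19),
     Assign 16 (Add 6 33), Assign 22 (Load 16), Assign 22 (Sub 22 19), Assign 19 (Reg 33),
     min_prog 24, Assign 26 (Add 26 3), Assign 16 (Add 9 26), Store 16 24,
     Assign 16 (Add 7 27), Store 16 3]"

text \<open>Register 20 below 3 means that \<open>x\<close> leaves the rung. The side that advanced
  is recorded as 0 or 1 in the array at 6 n, so that the backward pass need not rediscover
  it.\<close>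

definition peel_body :: prog where
  "peel_body = block [IfLess 20 5 peel_A peel_B, Assign 27 (Add 27 3)]"

definition turn_prog :: prog where
  "turn_prog = block
    [min_prog 29, Assign 30 (Reg 25), Assign 31 (Reg 26), Assign 23 (Const 1), Assign 24 (Const 1),
     Assign 15 (Add 10 25), Store 15 23, Assign 15 (Add 11 26), Store 15 24]"

definition back_body :: prog where
  "back_body = block
    [Assign 27 (Sub 27 3), Assign 15 (Add 7 27), Assign 15 (Load 15),
     IfLess 15 3
       (block [min_prog 23, Assign 25 (Sub 25 3), Assign 16 (Add 10 25), Store 16 23])
       (block [min_prog 24, Assign 26 (Sub 26 3), Assign 16 (Add 11 26), Store 16 24])]"

text \<open>Distances never exceed D, so failing the test for less than D means equality.\<close>

definition window_body :: "nat \<Rightarrow> nat \<Rightarrow> prog" where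
  "window_body xb yb = block
    [Assign 19 (Add yb 16), Assign 19 (Load 19), Assign 20 (Add xb 17), Assign 20 (Load 20),
     IfLess 19 29 Skip (IfLess 20 29 Skip (Assign 0 (Const 2))),
     Assign 16 (Add 16 3), Assign 17 (Add 17 3)]"

text \<open>D is at most p + 1, so the first test sorts out all cases except equality.\<close>

definition window_check :: "nat \<Rightarrow> nat \<Rightarrow> nat \<Rightarrow> nat \<Rightarrow> prog" where
  "window_check p q xb yb = Seq (Assign 15 (Add p 3)) (IfLess 29 15 Skip
     (Seq (block [Assign 16 (Const 1), Assign 17 (Add 29 3), Assign 18 (Add q 3)])
       (WhileLess 17 18 (window_body xb yb))))"

definition ends_check :: "nat \<Rightarrow> nat \<Rightarrow> nat \<Rightarrow> nat \<Rightarrow> prog" where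
  "ends_check p q xa yb = IfLess p 29 Skip (IfLess q 29 Skip (block
     [Assign 15 (Add xa 29), Assign 15 (Load 15), Assign 16 (Add q 3), Assign 16 (Sub 16 29),
      Assign 16 (Add yb 16), Assign 16 (Load 16),
      IfLess 15 29 Skip (IfLess 16 29 Skip (Assign 0 (Const 2)))]))"

definition crit_prog :: "nat \<Rightarrow> nat \<Rightarrow> nat \<Rightarrow> nat \<Rightarrow> nat \<Rightarrow> prog" where
  "crit_prog p q xa xb yb = Seq (window_check p q xb yb) (ends_check p q xa yb)"

text \<open>Division by repeated subtraction; it consumes register 2.\<close>

definition div3_body :: prog where
  "div3_body = block [Assign 2 (Sub 2 5), Assign 0 (Add 0 3)]"

definition decide_prog :: prog where
  "decide_prog = IfLess 29 5
     (Seq (Assign 0 (Const 0)) (WhileLess 4 2 div3_body))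
     (Seq (Assign 0 (Const 1)) (Seq (crit_prog 30 31 8 9 11) (crit_prog 31 30 9 8 10)))"

definition TDDP_prog :: prog where
  "TDDP_prog =
    Seq init_prog (Seq (WhileLess 12 2 sum_body)
    (Seq (block [Assign 12 (Const 0), degree_prog 12 17]) (Seq (WhileLess 4 17 find_body)
    (Seq start_prog (Seq (WhileLess 27 28 peel_body)
    (Seq turn_prog (Seq (WhileLess 32 27 back_body) decide_prog)))))))"

lemmas block_defs = degree_prog_def min_prog_def

section \<open>Correctness of the neighbour sums and of the search for an end\<close>

context machine_input
begin

definition sums :: "(nat \<Rightarrow> nat) \<Rightarrow> nat \<Rightarrow> bool" where
  "sums M v \<longleftrightarrow> inp M \<and> seg M 5 {..<v} (\<lambda>v. \<Sum>(nb v))"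

lemma init_correct:
  "wp W init_prog (\<lambda>R M. K R \<and> R 12 = 0 \<and> R 13 = 0 \<and> R 14 = off 0 \<and> sums M 0) (\<lambda>_. 0) M0"
proof -
  have "1 < W" "2 < W" "3 < W" using W n_ge_4 by auto
  then show ?thesis
    using W M0_0 by (simp add: init_prog_def K_def sums_def seg_def inp_def off_0)
qed

definition sum_inv :: "(nat \<Rightarrow> nat) \<Rightarrow> (nat \<Rightarrow> nat) \<Rightarrow> bool" where
  "sum_inv R M \<longleftrightarrow> K R \<and> R 12 \<le> n \<and> sums M (R 12) \<and> off (R 12) \<le> R 14 \<and>
     (if R 12 < n then R 14 \<le> off (Suc (R 12)) \<and> R 13 = sum_list (take (R 14 - off (R 12)) (adj ! R 12))
      else R 13 = 0 \<and> R 14 = off n)"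

text \<open>Every iteration advances either the vertex or the read address.\<close>

definition sum_measure :: "(nat \<Rightarrow> nat) \<Rightarrow> (nat \<Rightarrow> nat) \<Rightarrow> nat" where
  "sum_measure R M = (n - R 12) + (off n - R 14)"

lemma sum_body_correct:
  assumes I: "sum_inv R M" and less: "R 12 < R 2"
  shows "wp W sum_body (\<lambda>R' M'. sum_inv R' M' \<and> sum_measure R' M' < sum_measure R M) R M"
proof -
  define v where "v = R 12"
  have K: "K R" and v: "v < n" and sums: "sums M v" and ge: "off v \<le> R 14" and le: "R 14 \<le> off (Suc v)"
    and R13: "R 13 = sum_list (take (R 14 - off v) (adj ! v))"
    using I less by (auto simp: sum_inv_def v_def K_D)
  obtain k where k: "R 14 = off v + k" using ge le_Suc_ex by blast
  have k_le: "k \<le> card (nb v)" using le k off_Suc[OF v] by simp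
  have off_le: "off (Suc v) \<le> off n" using off_mono[of "Suc v" n] v by simp
  have inp: "inp M" and seg: "seg M 5 {..<v} (\<lambda>v. \<Sum>(nb v))" using sums by (auto simp: sums_def)
  have end_addr: "M (Suc (Suc v)) = off (Suc v)" using inp_off[OF inp, of "Suc v"] v by simp
  have bounds: "Suc (Suc v) < W" "off (Suc v) < W" "5 * n + v < W" "Suc v < W" "0 < W"
    using W v off_le off_n by auto
  \<comment> \<open>Partial sums are bounded by the full sum, so no intermediate word
    overflows.\<close>
  have take_le: "sum_list (take j (adj ! v)) \<le> n * n" for j
  proof -
    have "sum_list (take j (adj ! v)) + sum_list (drop j (adj ! v)) = sum_list (adj ! v)"
      by (metis append_take_drop_id sum_list_append)
    then show ?thesis using sum_adj[OF v] sum_nb_le[of v] by simp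
  qed
  show ?thesis
  proof (cases "k < card (nb v)")
    case True
    have in_range: "off v + k < off (Suc v)" using True off_Suc[OF v] by simp
    have ld: "M (off v + k) = adj ! v ! k" using inp_adj[OF inp v True] .
    have "adj ! v ! k \<in> nb v" using adj_nth[OF v] length_adj[OF v] True nth_mem by metis
    then have "adj ! v ! k < n" using nb_subset by blast
    then have b: "adj ! v ! k < W" "Suc (off v + k) < W" using W in_range off_le off_n by auto
    have snoc: "sum_list (take k (adj ! v)) + adj ! v ! k = sum_list (take (Suc k) (adj ! v))"
      using True length_adj[OF v] by (simp add: take_Suc_conv_app_nth)
    have b2: "sum_list (take (Suc k) (adj ! v)) < W" using take_le[of "Suc k"] W by linarith
    show ?thesis
      using K v sums in_range off_le
      by (simp add: sum_body_def K_D v_def[symmetric] end_addr bounds k ld b R13 snoc b2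
          sum_inv_def sum_measure_def diff_less_mono2)
  next
    case False
    then have k_eq: "k = card (nb v)" using k_le by simp
    have R14: "R 14 = off (Suc v)" using k k_eq off_Suc[OF v] by simp
    have all: "R 13 = \<Sum>(nb v)" using R13 k k_eq length_adj[OF v] sum_adj[OF v] by simp
    have b: "\<Sum>(nb v) < W" using sum_nb_le[of v] W by linarith
    have "seg (M(5 * n + v := \<Sum>(nb v))) 5 (insert v {..<v}) (\<lambda>v. \<Sum>(nb v))"
      by (rule seg_upd_same) (use v seg in auto)
    then have sums': "sums (M(5 * n + v := \<Sum>(nb v))) (Suc v)"
      using inp by (simp add: sums_def inp_upd lessThan_Suc)
    have "off (Suc v) = off n" if "n \<le> Suc v" using that v by (metis Suc_leI le_antisym)
    moreover have "Suc v < n \<longrightarrow> off (Suc v) \<le> off (Suc (Suc v))" using off_mono[of "Suc v" "Suc (Suc v)"] by simp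
    ultimately show ?thesis
      using K v sums'
      by (auto simp: sum_body_def K_D v_def[symmetric] end_addr bounds R14 all b
          sum_inv_def sum_measure_def le_less_Suc_eq not_less less_Suc_eq_le)
  qed
qed

lemma sum_correct:
  assumes "K R" "R 12 = 0" "R 13 = 0" "R 14 = off 0" "sums M 0"
  shows "runs W (WhileLess 12 2 sum_body) R M (6 * n * Suc (cost sum_body) + 1)
    (\<lambda>R M. K R \<and> sums M n)"
proof (rule runs_While_wp[where I = sum_inv and \<mu> = sum_measure])
  show "sum_inv R M" using assms n_ge_4 off_mono[of 0 1] by (simp add: sum_inv_def)
  show "sum_measure R M \<le> 6 * n" using assms off_n by (simp add: sum_measure_def)
qed (use sum_body_correct in \<open>auto simp: sum_inv_def K_D\<close>)

definition find_inv :: "(nat \<Rightarrow> nat) \<Rightarrow> (nat \<Rightarrow> nat) \<Rightarrow> bool" where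
  "find_inv R M \<longleftrightarrow> K R \<and> sums M n \<and> R 12 < n \<and> (\<forall>v<R 12. 2 < card (nb v)) \<and>
     R 16 = off (R 12) \<and> R 17 = card (nb (R 12))"

text \<open>An equation rather than an implication, so that it rewrites inside larger programs.
  Register 15 is overwritten before register \<open>v\<close> is read again, whence
  \<open>v \<noteq> 15\<close>.\<close>

lemma degree_wp:
  assumes "K R" "inp M" "R v < n" "v \<noteq> 15"
  shows "wp W (degree_prog v d) Q R M =
    Q (R(15 := off (Suc (R v)), 16 := off (R v), d := card (nb (R v)))) M"
proof -
  have o: "M (Suc (Suc (R v))) = off (Suc (R v))" "M (Suc (R v)) = off (R v)"
    using inp_off[of M "Suc (R v)"] inp_off[of M "R v"] assms by auto
  have "off (Suc (R v)) \<le> off n" "off (R v) \<le> off n" using off_mono assms(3) by auto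
  then have b: "off (Suc (R v)) < W" "off (R v) < W" "Suc (Suc (R v)) < W" "card (nb (R v)) < W"
    using W off_n assms(3) card_nb_le[of "R v"] by auto
  have "off (Suc (R v)) - off (R v) = card (nb (R v))" using off_Suc[OF assms(3)] by simp
  then show ?thesis
    using assms b o by (simp add: degree_prog_def K_D fun_upd_def cong: if_cong)
qed

end


context machine_input
begin

lemma find_body_correct:
  assumes I: "find_inv R M" and less: "R 4 < R 17" and ex: "\<exists>v<n. card (nb v) \<le> 2"
  shows "wp W find_body (\<lambda>R' M'. find_inv R' M' \<and> n - R' 12 < n - R 12) R M"
proof -
  define v where "v = R 12"
  have K: "K R" and v: "v < n" and inp: "inp M" and sums: "sums M n"
    and before: "\<forall>w<v. 2 < card (nb w)" and deg: "2 < card (nb v)"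
    using I less by (auto simp: find_inv_def v_def K_D sums_def)
  have before': "\<forall>w<Suc v. 2 < card (nb w)" using before deg by (auto simp: less_Suc_eq)
  \<comment> \<open>Some vertex has degree at most 2 and is not among those already passed, so the
    search does not run off the end.\<close>
  then have "Suc v < n" using ex by (metis Suc_lessI leD v less_trans not_less_eq)
  then show ?thesis unfolding find_body_def
    using W K inp sums v before'
    by (auto simp: K_D v_def[symmetric] find_inv_def degree_wp)
qed

lemma find_correct:
  assumes "K R" "sums M n" and ex: "\<exists>v<n. card (nb v) \<le> 2"
  shows "runs W (Seq (block [Assign 12 (Const 0), degree_prog 12 17]) (WhileLess 4 17 find_body)) R M
    (cost (block [Assign 12 (Const 0), degree_prog 12 17]) + (n * Suc (cost find_body) + 1))
    (\<lambda>R M. K R \<and> sums M n \<and> R 12 < n \<and> R 16 = off (R 12) \<and> card (nb (R 12)) \<le> 2)"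
proof (rule runs_Seq)
  show "runs W (block [Assign 12 (Const 0), degree_prog 12 17]) R M
    (cost (block [Assign 12 (Const 0), degree_prog 12 17])) find_inv"
    by (rule wp_runs)
      (use assms W n_ge_4 in \<open>auto simp: K_D find_inv_def sums_def degree_wp\<close>)
next
  fix R M assume "find_inv R M"
  then show "runs W (WhileLess 4 17 find_body) R M (n * Suc (cost find_body) + 1)
    (\<lambda>R M. K R \<and> sums M n \<and> R 12 < n \<and> R 16 = off (R 12) \<and> card (nb (R 12)) \<le> 2)"
    by (intro runs_While_wp[where I = find_inv and \<mu> = "\<lambda>R M. n - R 12"] find_body_correct ex)
      (auto simp: find_inv_def K_D)
qed

end

section \<open>Correctness of the forward pass\<close>

locale machine = machine_input V E adj n W + strip V E \<alpha> \<beta> a b p q m s e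
  for V E adj n W \<alpha> \<beta> a b p q m s e
begin

lemma n_eq: "n = p + q + 2" "n = m + 4"
  using machine_input.card_V[OF machine_input_axioms] strip.card_V[OF strip_axioms] p_plus_q by simp_all

lemma rung_less_n: "t \<le> m \<Longrightarrow> \<alpha> (a t) < n" "t \<le> m \<Longrightarrow> \<beta> (b t) < n"
  using rung_mem[of t] machine_input.V_eq[OF machine_input_axioms] by auto

lemma sum_rest_le: "\<Sum>(rest t x) \<le> n * n"
proof -
  have "\<Sum>(rest t x) \<le> \<Sum>(nb x)"
    by (rule sum_mono2[OF finite_nb]) (auto simp: rest_def nb_def)
  then show ?thesis using sum_nb_le[of x] by simp
qed

lemma card_rest_le: "card (rest t x) \<le> n"
proof -
  have "card (rest t x) \<le> card (nb x)"
    by (rule card_mono[OF finite_nb]) (auto simp: rest_def nb_def)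
  then show ?thesis using card_nb_le[of x] by simp
qed

abbreviation dl :: "nat \<Rightarrow> nat" where "dl x \<equiv> dist (\<alpha> 0) x"
abbreviation dr :: "nat \<Rightarrow> nat" where "dr x \<equiv> dist x (\<alpha> (Suc p))"

lemma D_less_n: "D < n" using D_le n_eq q_ge_1 by linarith

lemma dist_less_n: "x \<in> V \<Longrightarrow> y \<in> V \<Longrightarrow> dist x y < n"
  using dist_le_D D_less_n le_less_trans by blast

definition peel_inv :: "(nat \<Rightarrow> nat) \<Rightarrow> (nat \<Rightarrow> nat) \<Rightarrow> bool" where
  "peel_inv R M \<longleftrightarrow> (\<exists>t\<le>m. K R \<and> sums M n \<and> R 27 = t \<and> R 28 = m \<and>
     R 18 = \<alpha> (a t) \<and> R 19 = \<beta> (b t) \<and> R 20 = card (rest t (\<alpha> (a t))) \<and>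
     R 21 = \<Sum>(rest t (\<alpha> (a t))) \<and> R 22 = \<Sum>(rest t (\<beta> (b t))) \<and>
     R 23 = dl (\<alpha> (a t)) \<and> R 24 = dl (\<beta> (b t)) \<and> R 25 = a t \<and> R 26 = b t \<and>
     seg M 6 {..<t} (\<lambda>t. if a (Suc t) = Suc (a t) then 0 else 1) \<and>
     seg M 7 {1..a t} (\<lambda>i. dl (\<alpha> i)) \<and> seg M 8 {1..b t} (\<lambda>j. dl (\<beta> j)))"

lemma sums_upd: "5 < k \<Longrightarrow> i < n \<Longrightarrow> sums (M(k * n + i := x)) n = sums M n"
  by (simp add: sums_def inp_upd seg_upd_other)

lemma sum_remove: "finite A \<Longrightarrow> x \<in> A \<Longrightarrow> \<Sum>(A - {x}) = \<Sum>A - x" for A :: "nat set"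
  by (simp add: sum_diff1_nat)

text \<open>The assumption on the list fixes the orientation: the strip is chosen so that the first
  listed neighbour lies on \<open>\<alpha>\<close>.\<close>

lemma start_correct:
  assumes K: "K R" and sums: "sums M n" and l: "R 12 = \<alpha> 0" "R 16 = off (\<alpha> 0)"
    and x: "adj ! \<alpha> 0 = [\<alpha> 1, \<beta> 1]"
  shows "wp W start_prog peel_inv R M"
proof -
  have inp: "inp M" and seg: "seg M 5 {..<n} (\<lambda>v. \<Sum>(nb v))" using sums by (auto simp: sums_def)
  have l_n: "\<alpha> 0 < n" using \<alpha>_in[of 0] machine_input.V_eq[OF machine_input_axioms] by auto
  have xy: "\<alpha> 1 < n" "\<beta> 1 < n" using rung_less_n[of 0] a_0 b_0 by auto
  have nb_l: "nb (\<alpha> 0) = {\<alpha> 1, \<beta> 1}" using neighbours_left by (simp add: nb_def)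
  have card_l: "card (nb (\<alpha> 0)) = 2" using degree_left by (simp add: nb_def)
  have ld: "M (off (\<alpha> 0)) = \<alpha> 1" "M (Suc (off (\<alpha> 0))) = \<beta> 1"
    using inp_adj[OF inp l_n, of 0] inp_adj[OF inp l_n, of 1] x card_l by auto
  have "off (\<alpha> 0) \<le> off n" using off_mono l_n by simp
  then have b: "Suc (off (\<alpha> 0)) < W" "off (\<alpha> 0) < W" using W off_n by auto
  have S: "M (5 * n + \<alpha> 1) = \<Sum>(nb (\<alpha> 1))" "M (5 * n + \<beta> 1) = \<Sum>(nb (\<beta> 1))"
    using segD[OF seg] xy by auto
  have mem: "\<alpha> 0 \<in> nb (\<alpha> 1)" "\<alpha> 0 \<in> nb (\<beta> 1)"
    using \<alpha>_edge[of 0] \<beta>_edge[of 0] left_end by (auto simp: nb_def insert_commute)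
  have rest: "rest 0 x = nb x - {\<alpha> 0}" for x unfolding rest_0 nb_def ..
  have r: "card (nb (\<alpha> 1)) - 1 = card (rest 0 (\<alpha> 1))" "\<Sum>(nb (\<alpha> 1)) - \<alpha> 0 = \<Sum>(rest 0 (\<alpha> 1))"
    "\<Sum>(nb (\<beta> 1)) - \<alpha> 0 = \<Sum>(rest 0 (\<beta> 1))"
    unfolding rest using mem finite_nb by (auto simp: sum_remove)
  have bb: "card (nb (\<alpha> 1)) < W" "\<Sum>(nb (\<alpha> 1)) < W" "\<Sum>(nb (\<beta> 1)) < W" "card (rest 0 (\<alpha> 1)) < W"
     "\<Sum>(rest 0 (\<alpha> 1)) < W" "\<Sum>(rest 0 (\<beta> 1)) < W" "1 < W"
    using W card_nb_le[of "\<alpha> 1"] sum_nb_le[of "\<alpha> 1"] sum_nb_le[of "\<beta> 1"] sum_rest_le[of 0 "\<alpha> 1"]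
      sum_rest_le[of 0 "\<beta> 1"] card_rest_le[of 0 "\<alpha> 1"] n_ge_4 by linarith+
  have addr: "5 * n + \<alpha> 1 < W" "5 * n + \<beta> 1 < W" "7 * n + 1 < W" "8 * n + 1 < W" "\<alpha> 1 < W" "\<beta> 1 < W"
    using W xy n_ge_4 by auto
  have m: "n - 3 - 1 = m" "n - 3 < W" "m < W" using n_eq W by auto
  let ?M = "M(7 * n + 1 := 1, 8 * n + 1 := 1)"
  have d: "dl (\<alpha> 1) = 1" "dl (\<beta> 1) = 1"
    using dist_left_1 strip.dist_left_1[OF swap] left_end by auto
  have s7: "seg ?M 7 {1..1} (\<lambda>i. dl (\<alpha> i))" and s8: "seg ?M 8 {1..1} (\<lambda>j. dl (\<beta> j))"
    using d n_ge_4 cell_eq[of 1 1 8 7] by (auto simp: seg_def)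
  have su: "sums ?M n"
    using sums n_ge_4 sums_upd[of 8 1 "M(7 * n + 1 := 1)" 1] sums_upd[of 7 1 M 1] by simp
  show ?thesis
    unfolding start_prog_def peel_inv_def
    using K l l_n b bb addr m xy inp sums su s7 s8 W r d
    by (auto simp: K_D ld S[unfolded One_nat_def] degree_wp a_0 b_0 seg_def intro!: exI[of _ 0])
qed

text \<open>Two remaining neighbours select the first branch; subtracting \<open>y\<close> from
  their sum leaves the entering vertex \<open>z\<close>. Its own data are those of its full
  neighbourhood without \<open>x\<close>, since all its other neighbours are still present.\<close>

lemma peel_A_correct:
  assumes I: "K R" "sums M n" "R 27 = t" "R 28 = m" "R 18 = \<alpha> (a t)" "R 19 = \<beta> (b t)"
     "R 20 = card (rest t (\<alpha> (a t)))" "R 21 = \<Sum>(rest t (\<alpha> (a t)))" "R 22 = \<Sum>(rest t (\<beta> (b t)))"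
     "R 23 = dl (\<alpha> (a t))" "R 24 = dl (\<beta> (b t))" "R 25 = a t" "R 26 = b t"
    and seg: "seg M 6 {..<t} (\<lambda>t. if a (Suc t) = Suc (a t) then 0 else 1)"
     "seg M 7 {1..a t} (\<lambda>i. dl (\<alpha> i))" "seg M 8 {1..b t} (\<lambda>j. dl (\<beta> j))"
    and t: "t < m" and up: "a (Suc t) = Suc (a t)"
  shows "wp W peel_body (\<lambda>R' M'. peel_inv R' M' \<and> m - R' 27 < m - R 27) R M"
proof -
  let ?x = "\<alpha> (a t)" and ?y = "\<beta> (b t)" and ?z = "\<alpha> (a (Suc t))"
  have tm: "t \<le> m" "Suc t \<le> m" using t by auto
  have inp: "inp M" and seg5: "seg M 5 {..<n} (\<lambda>v. \<Sum>(nb v))" using I(2) by (auto simp: sums_def)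
  have xyz: "?x < n" "?y < n" "?z < n" using rung_less_n tm by auto
  have sx: "\<Sum>(rest t ?x) = ?y + ?z" using rest_old[OF t up] by simp
  have lt3: "card (rest t ?x) < 3" using rest_old[OF t up] by (simp add: card_insert_if)
  have sy: "\<Sum>(rest t ?y) - ?x = \<Sum>(rest (Suc t) ?y)"
    unfolding rest_Suc[OF t up] using sum_remove[OF finite_rest old_in_rest[OF t up]] by simp
  have x_nb: "?x \<in> nb ?z" using old_adj_new[OF t up] by (simp add: nb_def)
  have rest_z: "rest (Suc t) ?z = nb ?z - {?x}" using rest_new[OF t up] by (simp add: nb_def)
  have rz: "card (nb ?z) - 1 = card (rest (Suc t) ?z)" and sz: "\<Sum>(nb ?z) - ?x = \<Sum>(rest (Suc t) ?z)"
    unfolding rest_z using x_nb finite_nb by (auto simp: sum_remove)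
  have S: "M (5 * n + ?z) = \<Sum>(nb ?z)" using segD[OF seg5] xyz by simp
  have dz: "dl ?z = Suc (min (dl ?x) (dl ?y))"
    using dist_left_Suc[OF rung_mem(1)[OF tm(2)] tm(1) s_new[OF t up]] .
  have d1: "dl ?x < dl ?y \<Longrightarrow> Suc (dl ?x) = dl ?z" and d2: "\<not> dl ?x < dl ?y \<Longrightarrow> Suc (dl ?y) = dl ?z"
    using dz by auto
  have dn: "dl ?x < n" "dl ?y < n" "dl ?z < n" using dist_less_n \<alpha>_in[of 0] rung_mem tm by auto
  have a_le: "a (Suc t) < n" using a_bounds[OF tm(2)] n_eq by simp
  have t_n: "Suc t < n" using tm n_eq by simp
  let ?M = "M(7 * n + a (Suc t) := dl ?z, 6 * n + t := 0)"
  have sub: "{1..a (Suc t)} \<subseteq> {..<n}" "{1..b t} \<subseteq> {..<n}" "{..<t} \<subseteq> {..<n}"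
    using a_le b_bounds[OF tm(1)] n_eq t_n by auto
  have su: "sums ?M n" using I(2) a_le t_n by (simp add: sums_upd)
  have "{1..a (Suc t)} = insert (a (Suc t)) {1..a t}" using up by auto
  moreover have "seg (M(7 * n + a (Suc t) := dl ?z)) 7 (insert (a (Suc t)) {1..a t}) (\<lambda>i. dl (\<alpha> i))"
    by (rule seg_upd_same[OF a_le _ seg(2) refl]) (use a_le up in auto)
  ultimately have s7: "seg ?M 7 {1..a (Suc t)} (\<lambda>i. dl (\<alpha> i))"
    using t_n sub by (simp add: seg_upd_other)
  have s8: "seg ?M 8 {1..b (Suc t)} (\<lambda>j. dl (\<beta> j))"
    using seg(3) same_b[OF t up] t_n a_le sub by (simp add: seg_upd_other)
  have s6': "seg (M(7 * n + a (Suc t) := dl ?z)) 6 {..<t} (\<lambda>t. if a (Suc t) = Suc (a t) then 0 else 1)"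
    using seg(1) a_le sub by (simp add: seg_upd_other)
  have "seg ?M 6 (insert t {..<t}) (\<lambda>t. if a (Suc t) = Suc (a t) then 0 else 1)"
    by (rule seg_upd_same[OF _ _ s6']) (use t_n up in auto)
  then have s6: "seg ?M 6 {..<Suc t} (\<lambda>t. if a (Suc t) = Suc (a t) then 0 else 1)"
    by (simp add: lessThan_Suc)
  have bounds: "\<Sum>(nb ?z) < W" "\<Sum>(rest (Suc t) ?z) < W" "\<Sum>(rest (Suc t) ?y) < W"
      "card (rest (Suc t) ?z) < W" "?z < W" "5 * n + ?z < W" "dl ?z < W" "a (Suc t) < W"
      "7 * n + a (Suc t) < W" "6 * n + t < W" "0 < W" "Suc t < W"
    using W sum_nb_le[of ?z] sum_rest_le[of "Suc t" ?z] sum_rest_le[of "Suc t" ?y]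
      card_rest_le[of "Suc t" ?z] xyz dn a_le t_n by linarith+
  have goal: "peel_inv R' ?M" if "K R'" "R' 27 = Suc t" "R' 28 = m" "R' 18 = ?z" "R' 19 = ?y"
     "R' 20 = card (rest (Suc t) ?z)" "R' 21 = \<Sum>(rest (Suc t) ?z)" "R' 22 = \<Sum>(rest (Suc t) ?y)"
     "R' 23 = dl ?z" "R' 24 = dl ?y" "R' 25 = a (Suc t)" "R' 26 = b t" for R'
    unfolding peel_inv_def
    by (rule exI[of _ "Suc t"]) (use that tm su s6 s7 s8 same_b[OF t up] in auto)
  show ?thesis
    unfolding peel_body_def peel_A_def min_prog_def
    using I(1) lt3 inp xyz t
    by (simp add: I(3-) K_D degree_wp sx sy rz[simplified] sz S d1 d2 bounds up[symmetric] goal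
        diff_less_mono2)
qed

text \<open>The test on register 20 goes the other way by \<open>rest_other\<close>. For
  \<open>y\<close> the sum alone suffices, because the test concerns \<open>x\<close>.\<close>

lemma peel_B_correct:
  assumes I: "K R" "sums M n" "R 27 = t" "R 28 = m" "R 18 = \<alpha> (a t)" "R 19 = \<beta> (b t)"
     "R 20 = card (rest t (\<alpha> (a t)))" "R 21 = \<Sum>(rest t (\<alpha> (a t)))" "R 22 = \<Sum>(rest t (\<beta> (b t)))"
     "R 23 = dl (\<alpha> (a t))" "R 24 = dl (\<beta> (b t))" "R 25 = a t" "R 26 = b t"
    and seg: "seg M 6 {..<t} (\<lambda>t. if a (Suc t) = Suc (a t) then 0 else 1)"
     "seg M 7 {1..a t} (\<lambda>i. dl (\<alpha> i))" "seg M 8 {1..b t} (\<lambda>j. dl (\<beta> j))"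
    and t: "t < m" and up: "b (Suc t) = Suc (b t)"
  shows "wp W peel_body (\<lambda>R' M'. peel_inv R' M' \<and> m - R' 27 < m - R 27) R M"
proof -
  let ?x = "\<alpha> (a t)" and ?y = "\<beta> (b t)" and ?z = "\<beta> (b (Suc t))"
  have tm: "t \<le> m" "Suc t \<le> m" using t by auto
  have inp: "inp M" and seg5: "seg M 5 {..<n} (\<lambda>v. \<Sum>(nb v))" using I(2) by (auto simp: sums_def)
  have xyz: "?x < n" "?y < n" "?z < n" using rung_less_n tm by auto
  have sy: "\<Sum>(rest t ?y) = ?x + ?z" using strip.rest_old[OF swap t up] by simp
  have ge3: "\<not> card (rest t ?x) < 3" using strip.rest_other[OF swap t up] by simp
  have rest_x: "rest (Suc t) ?x = rest t ?x - {?y}" "?y \<in> rest t ?x"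
    using strip.rest_Suc[OF swap t up] strip.old_in_rest[OF swap t up] by auto
  have rx: "card (rest t ?x) - 1 = card (rest (Suc t) ?x)" and sx: "\<Sum>(rest t ?x) - ?y = \<Sum>(rest (Suc t) ?x)"
    unfolding rest_x(1) using rest_x(2) finite_rest by (auto simp: sum_remove)
  have y_nb: "?y \<in> nb ?z" using strip.old_adj_new[OF swap t up] by (simp add: nb_def)
  have rest_z: "rest (Suc t) ?z = nb ?z - {?y}" using strip.rest_new[OF swap t up] by (simp add: nb_def)
  have sz: "\<Sum>(nb ?z) - ?y = \<Sum>(rest (Suc t) ?z)"
    unfolding rest_z using y_nb finite_nb by (auto simp: sum_remove)
  have S: "M (5 * n + ?z) = \<Sum>(nb ?z)" using segD[OF seg5] xyz by simp
  have dz: "dl ?z = Suc (min (dl ?x) (dl ?y))"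
    using dist_left_Suc[OF rung_mem(2)[OF tm(2)] tm(1) strip.s_new[OF swap t up]] .
  have d1: "dl ?x < dl ?y \<Longrightarrow> Suc (dl ?x) = dl ?z" and d2: "\<not> dl ?x < dl ?y \<Longrightarrow> Suc (dl ?y) = dl ?z"
    using dz by auto
  have dn: "dl ?x < n" "dl ?y < n" "dl ?z < n" using dist_less_n \<alpha>_in[of 0] rung_mem tm by auto
  have b_le: "b (Suc t) < n" using b_bounds[OF tm(2)] n_eq by simp
  have t_n: "Suc t < n" using tm n_eq by simp
  have same_a: "a (Suc t) = a t" using strip.same_b[OF swap t up] .
  let ?M = "M(8 * n + b (Suc t) := dl ?z, 6 * n + t := 1)"
  have sub: "{1..b (Suc t)} \<subseteq> {..<n}" "{1..a t} \<subseteq> {..<n}" "{..<t} \<subseteq> {..<n}"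
    using b_le a_bounds[OF tm(1)] n_eq t_n by auto
  have su: "sums ?M n" using I(2) b_le t_n by (simp add: sums_upd)
  have "{1..b (Suc t)} = insert (b (Suc t)) {1..b t}" using up by auto
  moreover have "seg (M(8 * n + b (Suc t) := dl ?z)) 8 (insert (b (Suc t)) {1..b t}) (\<lambda>i. dl (\<beta> i))"
    by (rule seg_upd_same[OF b_le _ seg(3) refl]) (use b_le up in auto)
  ultimately have s8: "seg ?M 8 {1..b (Suc t)} (\<lambda>i. dl (\<beta> i))"
    using t_n sub by (simp add: seg_upd_other)
  have s7: "seg ?M 7 {1..a (Suc t)} (\<lambda>j. dl (\<alpha> j))"
    using seg(2) same_a t_n b_le sub by (simp add: seg_upd_other)
  have "seg ?M 6 (insert t {..<t}) (\<lambda>t. if a (Suc t) = Suc (a t) then 0 else 1)"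
    by (rule seg_upd_same) (use t_n sub b_le seg(1) same_a in \<open>auto simp: seg_upd_other\<close>)
  then have s6: "seg ?M 6 {..<Suc t} (\<lambda>t. if a (Suc t) = Suc (a t) then 0 else 1)"
    by (simp add: lessThan_Suc)
  have bounds: "\<Sum>(nb ?z) < W" "\<Sum>(rest (Suc t) ?z) < W" "\<Sum>(rest (Suc t) ?x) < W"
      "card (rest (Suc t) ?x) < W" "?z < W" "5 * n + ?z < W" "dl ?z < W" "b (Suc t) < W"
      "8 * n + b (Suc t) < W" "6 * n + t < W" "0 < W" "1 < W" "Suc t < W"
    using W sum_nb_le[of ?z] sum_rest_le[of "Suc t" ?z] sum_rest_le[of "Suc t" ?x]
      card_rest_le[of "Suc t" ?x] xyz dn b_le t_n by linarith+
  have goal: "peel_inv R' ?M" if "K R'" "R' 27 = Suc t" "R' 28 = m" "R' 18 = ?x" "R' 19 = ?z"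
     "R' 20 = card (rest (Suc t) ?x)" "R' 21 = \<Sum>(rest (Suc t) ?x)" "R' 22 = \<Sum>(rest (Suc t) ?z)"
     "R' 23 = dl ?x" "R' 24 = dl ?z" "R' 25 = a t" "R' 26 = b (Suc t)" for R'
    unfolding peel_inv_def
    by (rule exI[of _ "Suc t"]) (use that tm su s6 s7 s8 same_a in auto)
  show ?thesis
    unfolding peel_body_def peel_B_def min_prog_def
    using I(1) ge3 xyz t
    by (simp add: I(3-) K_D sy rx[simplified] sx sz S d1 d2 bounds bounds[simplified] up[symmetric]
        goal[simplified] diff_less_mono2)
qed

lemma peel_correct:
  assumes "peel_inv R M"
  shows "runs W (WhileLess 27 28 peel_body) R M (n * Suc (cost peel_body) + 1)
    (\<lambda>R M. peel_inv R M \<and> R 27 = m)"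
proof (rule runs_While_wp[where I = peel_inv and \<mu> = "\<lambda>R M. m - R 27"])
  fix R M assume I: "peel_inv R M" and less: "R 27 < R 28"
  then obtain t where t: "t = R 27" "t < m" unfolding peel_inv_def by auto
  have "a (Suc t) = Suc (a t) \<or> b (Suc t) = Suc (b t)" using step[OF t(2)] by auto
  then show "wp W peel_body (\<lambda>R' M'. peel_inv R' M' \<and> m - R' 27 < m - R 27) R M"
    using peel_A_correct[of R M t] peel_B_correct[of R M t] I t unfolding peel_inv_def by blast
next
  have "m \<le> n" using n_eq(2) by simp
  then show "m - R 27 \<le> n" by simp
qed (use assms in \<open>auto simp: peel_inv_def\<close>)

end


context machine
begin

definition data :: "(nat \<Rightarrow> nat) \<Rightarrow> (nat \<Rightarrow> nat) \<Rightarrow> bool" where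
  "data R M \<longleftrightarrow> K R \<and> R 29 = D \<and> R 30 = p \<and> R 31 = q \<and>
     seg M 7 {1..p} (\<lambda>i. dl (\<alpha> i)) \<and> seg M 8 {1..q} (\<lambda>j. dl (\<beta> j))"

definition back_inv :: "(nat \<Rightarrow> nat) \<Rightarrow> (nat \<Rightarrow> nat) \<Rightarrow> bool" where
  "back_inv R M \<longleftrightarrow> (\<exists>t\<le>m. data R M \<and> R 27 = t \<and>
     R 23 = dr (\<alpha> (a t)) \<and> R 24 = dr (\<beta> (b t)) \<and> R 25 = a t \<and> R 26 = b t \<and>
     seg M 6 {..<m} (\<lambda>t. if a (Suc t) = Suc (a t) then 0 else 1) \<and>
     seg M 9 {a t..p} (\<lambda>i. dr (\<alpha> i)) \<and> seg M 10 {b t..q} (\<lambda>j. dr (\<beta> j)))"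

lemma data_upd: "11 < i \<Longrightarrow> i \<noteq> 32 \<Longrightarrow> i \<noteq> 29 \<Longrightarrow> i \<noteq> 30 \<Longrightarrow> i \<noteq> 31 \<Longrightarrow> data (R(i := x)) M = data R M"
    "data (R(0 := x)) M = data R M"
  by (auto simp: data_def)

lemma sub_n: "{1..p} \<subseteq> {..<n}" "{1..q} \<subseteq> {..<n}" "{i..p} \<subseteq> {..<n}" "{i..q} \<subseteq> {..<n}" "{..<m} \<subseteq> {..<n}"
  using n_eq by auto

lemma pq_n: "p < n" "q < n" "m < n"
  using n_eq by auto

lemma data_upd_mem: "8 < k \<Longrightarrow> j < n \<Longrightarrow> data R (M(k * n + j := x)) = data R M"
  by (simp add: data_def seg_upd_other sub_n)

text \<open>The end r first appears in triangle m + 1, so one more step of the forward recurrence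
  from rung m yields D.\<close>

lemma turn_correct:
  assumes I: "peel_inv R M" "R 27 = m"
  shows "wp W turn_prog back_inv R M"
proof -
  have K: "K R" and R: "R 25 = p" "R 26 = q" "R 23 = dl (\<alpha> p)" "R 24 = dl (\<beta> q)"
    and seg: "seg M 6 {..<m} (\<lambda>t. if a (Suc t) = Suc (a t) then 0 else 1)"
      "seg M 7 {1..p} (\<lambda>i. dl (\<alpha> i))" "seg M 8 {1..q} (\<lambda>j. dl (\<beta> j))"
    using I a_m b_m by (auto simp: peel_inv_def)
  have "D = Suc (min (dl (\<alpha> p)) (dl (\<beta> q)))"
    using dist_left_Suc[of "\<alpha> (Suc p)" m] a_m b_m by simp
  then have D1: "dl (\<alpha> p) < dl (\<beta> q) \<Longrightarrow> Suc (dl (\<alpha> p)) = D" and D2: "\<not> dl (\<alpha> p) < dl (\<beta> q) \<Longrightarrow> Suc (dl (\<beta> q)) = D"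
    by auto
  have d: "dr (\<alpha> p) = 1" "dr (\<beta> q) = 1"
    using dist_right_1 strip.dist_right_1[OF swap] right_end by auto
  let ?M = "M(9 * n + p := 1, 10 * n + q := 1)"
  have "seg M 9 {} (\<lambda>i. dr (\<alpha> i))" "seg (M(9 * n + p := 1)) 10 {} (\<lambda>i. dr (\<beta> i))" by (auto simp: seg_def)
  from seg_upd_same[OF pq_n(1) _ this(1)] seg_upd_same[OF pq_n(2) _ this(2)]
  have s9: "seg (M(9 * n + p := 1)) 9 {p} (\<lambda>i. dr (\<alpha> i))" and s10: "seg ?M 10 {q} (\<lambda>i. dr (\<beta> i))"
    using d by auto
  have s9: "seg ?M 9 {p} (\<lambda>i. dr (\<alpha> i))"
    using s9 pq_n by (simp add: seg_upd_other)
  have s: "seg ?M 6 {..<m} (\<lambda>t. if a (Suc t) = Suc (a t) then 0 else 1)"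
    "seg ?M 7 {1..p} (\<lambda>i. dl (\<alpha> i))" "seg ?M 8 {1..q} (\<lambda>j. dl (\<beta> j))"
    using seg pq_n sub_n by (simp_all add: seg_upd_other)
  have goal: "back_inv R' ?M" if "K R'" "R' 29 = D" "R' 30 = p" "R' 31 = q" "R' 27 = m" "R' 23 = 1"
     "R' 24 = 1" "R' 25 = p" "R' 26 = q" for R'
    unfolding back_inv_def data_def
    by (rule exI[of _ m]) (use that s s9 s10 a_m b_m d in auto)
  have bounds: "D < W" "p < W" "q < W" "1 < W" "9 * n + p < W" "10 * n + q < W"
    using W pq_n D_less_n n_ge_4 by linarith+
  have "dl (\<alpha> p) < dl (\<beta> q) \<or> \<not> dl (\<alpha> p) < dl (\<beta> q)" by blast
  then show ?thesis
    unfolding turn_prog_def min_prog_def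
    using K I(2)
    by (auto simp: K_D R D1 D2 bounds bounds(4)[simplified] goal[simplified])
qed

text \<open>Undoes a recorded step: the vertex that re-enters has last triangle
  \<open>t + 1\<close>, so its distance to r comes from the ends of rung
  \<open>t + 1\<close>.\<close>

lemma back_body_correct:
  assumes I: "back_inv R M" and less: "R 32 < R 27"
  shows "wp W back_body (\<lambda>R' M'. back_inv R' M' \<and> R' 27 < R 27) R M"
proof -
  obtain t' where t': "t' \<le> m" "data R M" "R 27 = t'" "R 23 = dr (\<alpha> (a t'))" "R 24 = dr (\<beta> (b t'))"
      "R 25 = a t'" "R 26 = b t'"
    and seg: "seg M 6 {..<m} (\<lambda>t. if a (Suc t) = Suc (a t) then 0 else 1)"
     "seg M 9 {a t'..p} (\<lambda>i. dr (\<alpha> i))" "seg M 10 {b t'..q} (\<lambda>j. dr (\<beta> j))"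
    using I unfolding back_inv_def by blast
  have K: "K R" using t' by (simp add: data_def)
  then obtain t where t: "t' = Suc t" using less t' by (cases t') (auto simp: K_D)
  have tm: "t < m" "t \<le> m" "Suc t \<le> m" using t t' by auto
  note R = t'(3-)[unfolded t]
  let ?x = "\<alpha> (a (Suc t))" and ?y = "\<beta> (b (Suc t))"
  have flag: "M (6 * n + t) = (if a (Suc t) = Suc (a t) then 0 else 1)"
    using segD[OF seg(1)] tm by simp
  have bounds: "6 * n + t < W" "t < W" "1 < W" "0 < W" using W tm pq_n n_ge_4 by linarith+
  show ?thesis
  proof (cases "a (Suc t) = Suc (a t)")
    case up: True
    let ?z = "\<alpha> (a t)"
    let ?M = "M(9 * n + a t := dr ?z)"
    have b: "b (Suc t) = b t" using same_b[OF tm(1) up] .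
    have dz: "dr ?z = Suc (min (dr ?x) (dr ?y))"
      using dist_right_Suc[OF rung_mem(1)[OF tm(2)] tm(3) e_old[OF tm(1) up]] .
    have d1: "dr ?x < dr ?y \<Longrightarrow> Suc (dr ?x) = dr ?z" and d2: "\<not> dr ?x < dr ?y \<Longrightarrow> Suc (dr ?y) = dr ?z"
      using dz by auto
    have a_n: "a t \<le> p" "a t < n" using a_bounds[OF tm(2)] pq_n by auto
    have "dr ?z < n" using dist_less_n rung_mem[OF tm(2)] \<alpha>_in[of "Suc p"] by blast
    then have bb: "dr ?z < W" "a t < W" "9 * n + a t < W" using W a_n by linarith+
    have da: "data R ?M" using t'(2) a_n by (simp add: data_upd_mem)
    have s6: "seg ?M 6 {..<m} (\<lambda>t. if a (Suc t) = Suc (a t) then 0 else 1)"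
      using seg(1) a_n sub_n by (simp add: seg_upd_other)
    have "{a t..p} = insert (a t) {a (Suc t)..p}" using up a_n by auto
    moreover have "seg ?M 9 (insert (a t) {a (Suc t)..p}) (\<lambda>i. dr (\<alpha> i))"
      by (rule seg_upd_same[OF a_n(2) sub_n(3) _ refl]) (use seg(2) t in simp)
    ultimately have s9: "seg ?M 9 {a t..p} (\<lambda>i. dr (\<alpha> i))" by simp
    have s10: "seg ?M 10 {b t..q} (\<lambda>i. dr (\<beta> i))"
      using seg(3) t b a_n sub_n by (simp add: seg_upd_other)
    have goal: "back_inv R' ?M" if "data R' ?M" "R' 27 = t" "R' 23 = dr ?z" "R' 24 = dr ?y"
       "R' 25 = a t" "R' 26 = b t" for R'
      unfolding back_inv_def by (rule exI[of _ t]) (use that s6 s9 s10 tm b in auto)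
    have up': "a (Suc t) - Suc 0 = a t" using up by simp
    have f: "M (6 * n + t) = 0" using flag up by simp
    show ?thesis
      unfolding back_body_def min_prog_def
      using K da
      by (simp add: K_D R bounds bounds(3)[simplified] f d1 d2 bb up' b[symmetric] goal data_upd)
  next
    case False
    then have up: "b (Suc t) = Suc (b t)" using step[OF tm(1)] by auto
    let ?z = "\<beta> (b t)"
    let ?M = "M(10 * n + b t := dr ?z)"
    have b: "a (Suc t) = a t" using strip.same_b[OF swap tm(1) up] .
    have dz: "dr ?z = Suc (min (dr ?x) (dr ?y))"
      using dist_right_Suc[OF rung_mem(2)[OF tm(2)] tm(3) strip.e_old[OF swap tm(1) up]] .
    have d1: "dr ?x < dr ?y \<Longrightarrow> Suc (dr ?x) = dr ?z" and d2: "\<not> dr ?x < dr ?y \<Longrightarrow> Suc (dr ?y) = dr ?z"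
      using dz by auto
    have b_n: "b t \<le> q" "b t < n" using b_bounds[OF tm(2)] pq_n by auto
    have "dr ?z < n" using dist_less_n rung_mem[OF tm(2)] \<alpha>_in[of "Suc p"] by blast
    then have bb: "dr ?z < W" "b t < W" "10 * n + b t < W" using W b_n by linarith+
    have da: "data R ?M" using t'(2) b_n by (simp add: data_upd_mem)
    have s6: "seg ?M 6 {..<m} (\<lambda>t. if a (Suc t) = Suc (a t) then 0 else 1)"
      using seg(1) b_n sub_n by (simp add: seg_upd_other)
    have "{b t..q} = insert (b t) {b (Suc t)..q}" using up b_n by auto
    moreover have "seg ?M 10 (insert (b t) {b (Suc t)..q}) (\<lambda>i. dr (\<beta> i))"
      by (rule seg_upd_same[OF b_n(2) sub_n(4) _ refl]) (use seg(3) t in simp)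
    ultimately have s10: "seg ?M 10 {b t..q} (\<lambda>i. dr (\<beta> i))" by simp
    have s9: "seg ?M 9 {a t..p} (\<lambda>i. dr (\<alpha> i))"
      using seg(2) t b b_n sub_n by (simp add: seg_upd_other)
    have goal: "back_inv R' ?M" if "data R' ?M" "R' 27 = t" "R' 23 = dr ?x" "R' 24 = dr ?z"
       "R' 25 = a t" "R' 26 = b t" for R'
      unfolding back_inv_def by (rule exI[of _ t]) (use that s6 s9 s10 tm b in auto)
    have up': "b (Suc t) - Suc 0 = b t" using up by simp
    have f: "M (6 * n + t) = 1" using flag False by simp
    show ?thesis
      unfolding back_body_def min_prog_def
      using K da
      by (simp add: K_D R bounds bounds(3)[simplified] f[simplified] d1 d2 bb up' b[symmetric] goal data_upd)
  qed
qed

definition result_data :: "(nat \<Rightarrow> nat) \<Rightarrow> (nat \<Rightarrow> nat) \<Rightarrow> bool" where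
  "result_data R M \<longleftrightarrow> data R M \<and>
     seg M 9 {1..p} (\<lambda>i. dr (\<alpha> i)) \<and> seg M 10 {1..q} (\<lambda>j. dr (\<beta> j))"

lemma back_correct:
  assumes "back_inv R M"
  shows "runs W (WhileLess 32 27 back_body) R M (n * Suc (cost back_body) + 1) result_data"
proof (rule runs_While_wp[where I = back_inv and \<mu> = "\<lambda>R M. R 27"])
  show "R 27 \<le> n" using assms pq_n by (auto simp: back_inv_def)
next
  fix R M assume I: "back_inv R M" and "\<not> R 32 < R 27"
  then have "R 27 = 0" by (auto simp: back_inv_def data_def K_D)
  then show "result_data R M" using I by (auto simp: back_inv_def result_data_def a_0 b_0)
qed (use assms back_body_correct in auto)

end


section \<open>Correctness of the criterion and of the final answer\<close>

definition keep :: "(nat \<Rightarrow> nat) \<Rightarrow> (nat \<Rightarrow> nat) \<Rightarrow> bool" where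
  "keep R0 R \<longleftrightarrow> (\<forall>i\<in>{2..11} \<union> {29..32}. R i = R0 i)"

lemma keep_upd [simp]: "i \<notin> {2..11} \<union> {29..32} \<Longrightarrow> keep R0 (R(i := x)) = keep R0 R"
  unfolding keep_def by (intro ball_cong refl) (metis fun_upd_other)

lemma keep_D: "keep R0 R \<Longrightarrow> i \<in> {2..11} \<union> {29..32} \<Longrightarrow> R i = R0 i"
  by (simp add: keep_def)

context machine_input
begin

text \<open>Registers and array bases are parameters, because the check runs for both orientations
  of the strip. The upper bound \<open>d\<close> on the stored values turns the tests for less into
  tests for inequality.\<close>

lemma window_check_correct:
  assumes K: "K R0" and R0: "R0 29 = d" "R0 rp = P" "R0 rq = Q" "R0 xb = kx * n" "R0 yb = ky * n"
    and regs: "rp \<in> {2..11} \<union> {29..32}" "rq \<in> {2..11} \<union> {29..32}" "xb \<in> {2..11} \<union> {29..32}"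
      "yb \<in> {2..11} \<union> {29..32}"
    and k: "kx \<le> 10" "ky \<le> 10" and d: "d \<le> Suc P" and PQ: "P < n" "Q < n"
    and X: "seg M kx {1..Q} X" "\<And>j. 1 \<le> j \<Longrightarrow> j \<le> Q \<Longrightarrow> X j \<le> d"
    and Y: "seg M ky {1..Q} Y" "\<And>j. 1 \<le> j \<Longrightarrow> j \<le> Q \<Longrightarrow> Y j \<le> d"
    and R: "keep R0 R"
  shows "runs W (window_check rp rq xb yb) R M (n * Suc (cost (window_body xb yb)) + 10)
    (\<lambda>R' M'. M' = M \<and> keep R0 R' \<and>
       R' 0 = (if Suc P = d \<and> (\<exists>j\<ge>1. j + d \<le> Q \<and> Y j = d \<and> X (j + d) = d) then 2 else R 0))"
    (is "runs _ _ _ _ _ ?Q")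
proof -
  \<comment> \<open>A match among the window starts already examined, those below
    \<open>l\<close>.\<close>
  define found where "found l \<longleftrightarrow> (\<exists>j\<ge>1. j < l \<and> j + d \<le> Q \<and> Y j = d \<and> X (j + d) = d)" for l
  define inv where "inv R' M' \<longleftrightarrow> M' = M \<and> keep R0 R' \<and> 1 \<le> R' 16 \<and> R' 17 = R' 16 + d \<and> R' 18 = Suc Q \<and>
    R' 0 = (if found (R' 16) then 2 else R 0)" for R' M' :: "nat \<Rightarrow> nat"
  have ne: "xb \<noteq> 15" "xb \<noteq> 16" "xb \<noteq> 17" "xb \<noteq> 18" "xb \<noteq> 19" "xb \<noteq> 20" "xb \<noteq> 0"
    "yb \<noteq> 15" "yb \<noteq> 16" "yb \<noteq> 17" "yb \<noteq> 18" "yb \<noteq> 19" "yb \<noteq> 20" "yb \<noteq> 0"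
    "rp \<noteq> 15" "rq \<noteq> 15" "rq \<noteq> 16" "rq \<noteq> 17"
    using regs by auto
  have kn: "kx * n \<le> 10 * n" "ky * n \<le> 10 * n" using k mult_right_mono by blast+
  have dn: "d \<le> n" using d PQ by simp
  have small: "1 < W" "2 < W" using W n_ge_4 by auto
  have kR: "R' 29 = d" "R' rp = P" "R' rq = Q" "R' xb = kx * n" "R' yb = ky * n" "R' 3 = 1" if "keep R0 R'" for R'
    using keep_D[OF that] regs R0 K K_D(2)[OF K] by auto
  have body: "wp W (window_body xb yb) (\<lambda>R'' M''. inv R'' M'' \<and> R'' 18 - R'' 17 < R' 18 - R' 17) R' M'"
    if inv: "inv R' M'" and less: "R' 17 < R' 18" for R' M'
  proof -
    define j where "j = R' 16"
    have i: "M' = M" "keep R0 R'" "1 \<le> j" "R' 16 = j" "R' 17 = j + d" "R' 18 = Suc Q"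
      "R' 0 = (if found j then 2 else R 0)" using inv by (auto simp: inv_def j_def)
    have jQ: "j + d \<le> Q" "j \<le> Q" using less i by auto
    note r = kR[OF i(2)]
    have ld: "M (ky * n + j) = Y j" "M (kx * n + (j + d)) = X (j + d)"
      using segD[OF X(1), of "j + d"] segD[OF Y(1), of j] jQ i(3) by auto
    have le: "X (j + d) \<le> d" "Y j \<le> d" using X(2)[of "j + d"] Y(2)[of j] jQ i(3) by auto
    have f: "found (Suc j) \<longleftrightarrow> found j \<or> (Y j = d \<and> X (j + d) = d)"
      using jQ i(3) unfolding found_def by (auto simp: less_Suc_eq)
    have b: "ky * n + j < W" "kx * n + (j + d) < W" "X (j + d) < W" "Y j < W" "Suc j < W" "Suc (j + d) < W"
      using W kn jQ PQ dn le by linarith+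
    show ?thesis
      unfolding window_body_def inv_def
      using i(1,2,3) le jQ
      by (auto simp: i(4-) r ne ld ld[unfolded add.assoc[symmetric]] b b[unfolded add.assoc[symmetric]] small f)
  qed
  \<comment> \<open>Once \<open>l + d\<close> exceeds \<open>Q\<close>, every window that fits on
    the side starts below \<open>l\<close>.\<close>
  have found_all: "found l \<longleftrightarrow> (\<exists>j\<ge>1. j + d \<le> Q \<and> Y j = d \<and> X (j + d) = d)" if "Q < l + d" for l
    using that unfolding found_def by auto
  have loop: "runs W (WhileLess 17 18 (window_body xb yb)) R' M' (n * Suc (cost (window_body xb yb)) + 1) ?Q"
    if "inv R' M'" "Suc P = d" for R' M'
  proof (rule runs_While_wp[where I = inv and \<mu> = "\<lambda>R M. R 18 - R 17"])
    show "R' 18 - R' 17 \<le> n" using that PQ by (auto simp: inv_def)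
  next
    fix R'' M'' assume "inv R'' M''" "\<not> R'' 17 < R'' 18"
    then show "?Q R'' M''" using found_all[of "R'' 16"] that(2) unfolding inv_def by simp
  qed (use that body in auto)
  have pre: "runs W (block [Assign 16 (Const 1), Assign 17 (Add 29 3), Assign 18 (Add rq 3)]) R' M' 4 inv"
    if "M' = M" "keep R0 R'" "R' 0 = R 0" for R' M'
  proof -
    have "\<not> found 1" by (auto simp: found_def)
    then have "wp W (block [Assign 16 (Const 1), Assign 17 (Add 29 3), Assign 18 (Add rq 3)]) inv R' M'"
      using that small kR[OF that(2)] W dn PQ by (auto simp: ne inv_def)
    from wp_runs[OF this] show ?thesis by (rule runs_weaken) simp_all
  qed
  have 1: "runs W (Assign 15 (Add rp 3)) R M 1 (\<lambda>R' M'. M' = M \<and> keep R0 R' \<and> R' 0 = R 0 \<and> R' 15 = Suc P)"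
    using wp_runs[of W "Assign 15 (Add rp 3)"] R kR[OF R] W PQ by auto
  have "runs W (window_check rp rq xb yb) R M (1 + Suc (4 + (n * Suc (cost (window_body xb yb)) + 1))) ?Q"
    unfolding window_check_def
  proof (rule runs_Seq[OF 1], rule runs_If)
    fix R' M' assume *: "M' = M \<and> keep R0 R' \<and> R' 0 = R 0 \<and> R' 15 = Suc P" and "R' 29 < R' 15"
    then have "Suc P \<noteq> d" using kR by auto
    then have "wp W Skip ?Q R' M'" using * by simp
    from wp_runs[OF this]
    show "runs W Skip R' M' (4 + (n * Suc (cost (window_body xb yb)) + 1)) ?Q"
      by (rule runs_weaken) auto
  next
    fix R' M' assume *: "M' = M \<and> keep R0 R' \<and> R' 0 = R 0 \<and> R' 15 = Suc P" and "\<not> R' 29 < R' 15"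
    then have "Suc P = d" using kR d by auto
    then show "runs W (Seq (block [Assign 16 (Const 1), Assign 17 (Add 29 3), Assign 18 (Add rq 3)])
       (WhileLess 17 18 (window_body xb yb))) R' M' (4 + (n * Suc (cost (window_body xb yb)) + 1)) ?Q"
      using * by (intro runs_Seq[OF pre] loop) auto
  qed
  then show ?thesis by (rule runs_weaken) auto
qed

lemma ends_check_correct:
  assumes K: "K R0" and R0: "R0 29 = d" "R0 rp = P" "R0 rq = Q" "R0 xa = kx * n" "R0 yb = ky * n"
    and regs: "rp \<in> {2..11} \<union> {29..32}" "rq \<in> {2..11} \<union> {29..32}" "xa \<in> {2..11} \<union> {29..32}"
      "yb \<in> {2..11} \<union> {29..32}"
    and k: "kx \<le> 10" "ky \<le> 10" and d: "1 \<le> d" and PQ: "P < n" "Q < n"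
    and X: "seg M kx {1..P} X" "\<And>j. 1 \<le> j \<Longrightarrow> j \<le> P \<Longrightarrow> X j \<le> d"
    and Y: "seg M ky {1..Q} Y" "\<And>j. 1 \<le> j \<Longrightarrow> j \<le> Q \<Longrightarrow> Y j \<le> d"
    and R: "keep R0 R"
  shows "runs W (ends_check rp rq xa yb) R M 12
    (\<lambda>R' M'. M' = M \<and> keep R0 R' \<and>
       R' 0 = (if d \<le> P \<and> d \<le> Q \<and> X d = d \<and> Y (Suc Q - d) = d then 2 else R 0))"
    (is "runs _ _ _ _ _ ?Q")
proof -
  have ne: "xa \<noteq> 15" "xa \<noteq> 16" "yb \<noteq> 15" "yb \<noteq> 16" "rq \<noteq> 15" using regs by auto
  have kn: "kx * n \<le> 10 * n" "ky * n \<le> 10 * n" using k mult_right_mono by blast+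
  have small: "2 < W" using W n_ge_4 by auto
  have kR: "R 29 = d" "R rp = P" "R rq = Q" "R xa = kx * n" "R yb = ky * n" "R 3 = 1"
    using keep_D[OF R] regs R0 K K_D(2)[OF K] by auto
  have "wp W (ends_check rp rq xa yb) ?Q R M"
  proof (cases "d \<le> P \<and> d \<le> Q")
    case True
    define w where "w = Suc Q - d"
    \<comment> \<open>\<open>1 \<le> d\<close> and \<open>d \<le> Q\<close> keep this index within
      1, ..., \<open>Q\<close>, the range for which distances are stored.\<close>
    have w: "Suc Q - d = w" "1 \<le> w" "w \<le> Q" using True d by (auto simp: w_def)
    have ld: "M (kx * n + d) = X d" "M (ky * n + w) = Y w"
      using segD[OF X(1), of d] segD[OF Y(1), of w] True d w by auto
    have le: "X d \<le> d" "Y w \<le> d" using X(2)[of d] Y(2)[of w] True d w by auto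
    have b: "kx * n + d < W" "ky * n + w < W" "X d < W" "Y w < W" "Suc Q < W" "w < W"
      using W kn PQ le True w by linarith+
    have c: "X d < d \<longleftrightarrow> X d \<noteq> d" "Y w < d \<longleftrightarrow> Y w \<noteq> d" using le by auto
    have PQd: "d \<le> P" "d \<le> Q" "\<not> P < d" "\<not> Q < d" using True by auto
    show ?thesis
      unfolding ends_check_def using R by (simp add: kR ne ld b small w(1) c PQd)
  next
    case False
    then consider "P < d" | "\<not> P < d" "Q < d" by linarith
    then show ?thesis unfolding ends_check_def by cases (simp_all add: kR R)
  qed
  from wp_runs[OF this] show ?thesis
    by (rule runs_weaken) (auto simp: ends_check_def)
qed

lemma div3_correct:
  assumes "K R"
  shows "runs W (Seq (Assign 0 (Const 0)) (WhileLess 4 2 div3_body)) R M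
    (1 + (n * Suc (cost div3_body) + 1)) (\<lambda>R' M'. R' 0 = n div 3)"
proof -
  \<comment> \<open>\<open>K\<close> fails once register 2 is decreased, so the invariant keeps just
    the constants.\<close>
  define inv :: "(nat \<Rightarrow> nat) \<Rightarrow> (nat \<Rightarrow> nat) \<Rightarrow> bool"
    where "inv R' M' \<longleftrightarrow> 3 * R' 0 + R' 2 = n \<and> R' 3 = 1 \<and> R' 4 = 2 \<and> R' 5 = 3" for R' M'
  have "runs W (Assign 0 (Const 0)) R M 1 inv"
    using wp_runs[of W "Assign 0 (Const 0)" inv R M] assms W by (simp add: inv_def K_D)
  then show ?thesis
  proof (rule runs_Seq)
    fix R' M' assume "inv R' M'"
    then show "runs W (WhileLess 4 2 div3_body) R' M' (n * Suc (cost div3_body) + 1) (\<lambda>R' M'. R' 0 = n div 3)"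
    proof (intro runs_While_wp[where I = inv and \<mu> = "\<lambda>R M. R 2"])
      fix R M assume "inv R M" "R 4 < R 2"
      then show "wp W div3_body (\<lambda>R' M'. inv R' M' \<and> R' 2 < R 2) R M"
        using W by (auto simp: div3_body_def inv_def)
    next
      fix R M :: "nat \<Rightarrow> nat" assume "inv R M" "\<not> R 4 < R 2"
      then show "R 0 = n div 3" unfolding inv_def by linarith
    qed (auto simp: inv_def)
  qed
qed

end

context machine
begin

lemma swap_machine: "machine V E adj n W \<beta> \<alpha> b a q p m s e"
  using machine_input_axioms swap by (simp add: machine_def)

text \<open>Both checks either leave register 0 alone or set it to 2, so running them in sequence
  computes the disjunction in \<open>crit\<close>.\<close>

lemma crit_prog_correct:
  assumes K: "K R0" and R0: "R0 29 = D" "R0 rp = p" "R0 rq = q" "R0 xa = ka * n" "R0 xb = kb * n" "R0 yb = ky * n"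
    and regs: "rp \<in> {2..11} \<union> {29..32}" "rq \<in> {2..11} \<union> {29..32}" "xa \<in> {2..11} \<union> {29..32}"
      "xb \<in> {2..11} \<union> {29..32}" "yb \<in> {2..11} \<union> {29..32}"
    and k: "ka \<le> 10" "kb \<le> 10" "ky \<le> 10"
    and seg: "seg M ka {1..p} (\<lambda>i. dl (\<alpha> i))" "seg M kb {1..q} (\<lambda>j. dl (\<beta> j))" "seg M ky {1..q} (\<lambda>j. dr (\<beta> j))"
    and R: "keep R0 R"
  shows "runs W (crit_prog rp rq xa xb yb) R M (n * Suc (cost (window_body xb yb)) + 10 + 12)
    (\<lambda>R' M'. M' = M \<and> keep R0 R' \<and> R' 0 = (if crit V E \<alpha> \<beta> p q D then 2 else R 0))"
  unfolding crit_prog_def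
proof (rule runs_Seq)
  let ?c = "Suc p = D \<and> (\<exists>j\<ge>1. j + D \<le> q \<and> dr (\<beta> j) = D \<and> dl (\<beta> (j + D)) = D)"
  show "runs W (window_check rp rq xb yb) R M (n * Suc (cost (window_body xb yb)) + 10)
    (\<lambda>R' M'. M' = M \<and> keep R0 R' \<and> R' 0 = (if ?c then 2 else R 0))"
    by (rule window_check_correct[OF K R0(1,2,3,5,6) regs(1,2,4,5) k(2,3) D_le pq_n(1,2) seg(2) _ seg(3) _ R])
      (auto intro: dist_le_D)
  fix R' M' assume *: "M' = M \<and> keep R0 R' \<and> R' 0 = (if ?c then 2 else R 0)"
  have "runs W (ends_check rp rq xa yb) R' M 12 (\<lambda>R'' M'. M' = M \<and> keep R0 R'' \<and>
      R'' 0 = (if D \<le> p \<and> D \<le> q \<and> dl (\<alpha> D) = D \<and> dr (\<beta> (Suc q - D)) = D then 2 else R' 0))"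
    by (rule ends_check_correct[OF K R0(1,2,3,4,6) regs(1,2,3,5) k(1,3) _ pq_n(1,2) seg(1) _ seg(3)])
      (use D_ge_2 * in \<open>auto intro: dist_le_D\<close>)
  then show "runs W (ends_check rp rq xa yb) R' M' 12 (\<lambda>R' M'. M' = M \<and> keep R0 R' \<and>
      R' 0 = (if crit V E \<alpha> \<beta> p q D then 2 else R 0))"
    using * unfolding crit_def by (auto elim!: runs_weaken)
qed

lemma decide_correct:
  assumes "result_data R M"
  shows "runs W decide_prog R M (100 * n + 100) (\<lambda>R' M'. R' 0 = num_TDDP V E)"
proof -
  have K: "K R" and R: "R 29 = D" "R 30 = p" "R 31 = q"
    and seg: "seg M 7 {1..p} (\<lambda>i. dl (\<alpha> i))" "seg M 8 {1..q} (\<lambda>j. dl (\<beta> j))"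
      "seg M 9 {1..p} (\<lambda>i. dr (\<alpha> i))" "seg M 10 {1..q} (\<lambda>j. dr (\<beta> j))"
    using assms by (auto simp: result_data_def data_def)
  note num = num_TDDP_eq[unfolded machine_input.card_V[OF machine_input_axioms]]
  have "runs W decide_prog R M (Suc (100 * n + 99)) (\<lambda>R' M'. R' 0 = num_TDDP V E)"
    unfolding decide_prog_def
  proof (rule runs_If)
    assume "R 29 < R 5"
    then have eq: "num_TDDP V E = n div 3" using num R K by (simp add: K_D)
    show "runs W (Seq (Assign 0 (Const 0)) (WhileLess 4 2 div3_body)) R M (100 * n + 99)
       (\<lambda>R' M'. R' 0 = num_TDDP V E)"
      unfolding eq by (rule runs_weaken[OF div3_correct[OF K]]) (auto simp: div3_body_def)
  next
    assume "\<not> R 29 < R 5"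
    then have num: "num_TDDP V E = (if crit V E \<alpha> \<beta> p q D \<or> crit V E \<beta> \<alpha> q p D then 2 else 1)"
      using num R K by (simp add: K_D)
    have 1: "runs W (Assign 0 (Const 1)) R M 1 (\<lambda>R' M'. M' = M \<and> keep R R' \<and> R' 0 = 1)"
      using wp_runs[of W "Assign 0 (Const 1)" _ R M] W n_ge_4 by (auto simp: keep_def)
    have 2: "runs W (crit_prog 30 31 8 9 11) R' M (n * Suc (cost (window_body 9 11)) + 10 + 12)
      (\<lambda>R'' M'. M' = M \<and> keep R R'' \<and> R'' 0 = (if crit V E \<alpha> \<beta> p q D then 2 else R' 0))" if "keep R R'" for R'
      by (rule crit_prog_correct[OF K, where ka = 7 and kb = 8 and ky = 10]) (use R seg that K in \<open>auto simp: K_D\<close>)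
    have ends: "\<beta> 0 = \<alpha> 0" "\<beta> (Suc q) = \<alpha> (Suc p)" using left_end right_end by auto
    \<comment> \<open>The second orientation is the instance for \<open>swap_machine\<close>;
      \<open>ends\<close> rewrites its end vertices to those of \<open>\<alpha>\<close>, so that D
      and the stored distances match.\<close>
    have 3: "runs W (crit_prog 31 30 9 8 10) R' M (n * Suc (cost (window_body 8 10)) + 10 + 12)
      (\<lambda>R'' M'. M' = M \<and> keep R R'' \<and> R'' 0 = (if crit V E \<beta> \<alpha> q p D then 2 else R' 0))" if "keep R R'" for R'
      by (rule machine.crit_prog_correct[OF swap_machine, unfolded ends, OF K, where ka = 8 and kb = 7 and ky = 9])
        (use R seg that K in \<open>auto simp: K_D\<close>)
    have "runs W (Seq (Assign 0 (Const 1)) (Seq (crit_prog 30 31 8 9 11) (crit_prog 31 30 9 8 10))) R M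
       (1 + ((n * Suc (cost (window_body 9 11)) + 10 + 12) + (n * Suc (cost (window_body 8 10)) + 10 + 12)))
       (\<lambda>R' M'. R' 0 = num_TDDP V E)"
    proof (rule runs_Seq[OF 1], rule runs_Seq)
      fix R' M' assume *: "M' = M \<and> keep R R' \<and> R' 0 = 1"
      then have "M' = M" "keep R R'" by auto
      then show "runs W (crit_prog 30 31 8 9 11) R' M' (n * Suc (cost (window_body 9 11)) + 10 + 12)
        (\<lambda>R'' M'. M' = M \<and> keep R R'' \<and> R'' 0 = (if crit V E \<alpha> \<beta> p q D then 2 else 1))"
        by (simp only:, intro runs_weaken[OF 2]) (use * in auto)
    next
      fix R' M' assume *: "M' = M \<and> keep R R' \<and> R' 0 = (if crit V E \<alpha> \<beta> p q D then 2 else 1)"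
      then have "M' = M" "keep R R'" by auto
      then show "runs W (crit_prog 31 30 9 8 10) R' M' (n * Suc (cost (window_body 8 10)) + 10 + 12)
        (\<lambda>R' M'. R' 0 = num_TDDP V E)"
        by (simp only:, intro runs_weaken[OF 3]) (use * num in auto)
    qed
    then show "runs W (Seq (Assign 0 (Const 1)) (Seq (crit_prog 30 31 8 9 11) (crit_prog 31 30 9 8 10))) R M
       (100 * n + 99) (\<lambda>R' M'. R' 0 = num_TDDP V E)"
      by (rule runs_weaken) (auto simp: window_body_def)
  qed
  then show ?thesis by (rule runs_weaken) simp_all
qed

end


context machine
begin

lemma traverse_correct:
  assumes "K R" "sums M n" "R 12 = \<alpha> 0" "R 16 = off (\<alpha> 0)" "adj ! \<alpha> 0 = [\<alpha> 1, \<beta> 1]"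
  shows "runs W (Seq start_prog (Seq (WhileLess 27 28 peel_body)
    (Seq turn_prog (Seq (WhileLess 32 27 back_body) decide_prog)))) R M (300 * n + 300)
    (\<lambda>R' M'. R' 0 = num_TDDP V E)"
proof -
  have start: "runs W start_prog R M (cost start_prog) peel_inv"
    by (rule wp_runs[OF start_correct[OF assms]])
  have turn: "runs W turn_prog R M (cost turn_prog) back_inv" if "peel_inv R M \<and> R 27 = m" for R M
    using that by (intro wp_runs turn_correct) auto
  show ?thesis
    by (rule runs_weaken[OF runs_Seq[OF start runs_Seq[OF peel_correct runs_Seq[OF turn
            runs_Seq[OF back_correct decide_correct]]]]])
      (auto simp: start_prog_def peel_body_def peel_A_def peel_B_def turn_prog_def back_body_def
        min_prog_def degree_prog_def)
qed

end

lemma (in machine_input) TDDP_prog_correct: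
  "runs W TDDP_prog (\<lambda>_. 0) M0 (1000 * n) (\<lambda>R M. R 0 = num_TDDP V E)"
proof -
  have ex: "\<exists>v<n. card (nb v) \<le> 2"
  proof -
    obtain \<alpha> \<beta> a b p q m s e where S: "strip V E \<alpha> \<beta> a b p q m s e" using two_path_strip[OF two_path] .
    have "\<alpha> 0 < n" using strip.\<alpha>_in[OF S, of 0] V_eq by auto
    moreover have "card (nb (\<alpha> 0)) \<le> 2" using strip.degree_left[OF S] by (simp add: nb_def)
    ultimately show ?thesis by blast
  qed
  let ?rest = "Seq start_prog (Seq (WhileLess 27 28 peel_body)
    (Seq turn_prog (Seq (WhileLess 32 27 back_body) decide_prog)))"
  have rest: "runs W ?rest R M (300 * n + 300) (\<lambda>R M. R 0 = num_TDDP V E)"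
    if I: "K R \<and> sums M n \<and> R 12 < n \<and> R 16 = off (R 12) \<and> card (nb (R 12)) \<le> 2" for R M
  proof -
    define v where "v = R 12"
    have v: "v < n" "v \<in> V" "card (nb v) \<le> 2" using I V_eq by (auto simp: v_def)
    \<comment> \<open>The search only guarantees at most 2; such a vertex is an end of the strip,
      and both ends have exactly two neighbours.\<close>
    have "card (nb v) = 2"
    proof -
      obtain \<alpha> \<beta> a b p q m s e where S: "strip V E \<alpha> \<beta> a b p q m s e" using two_path_strip[OF two_path] .
      have "v = \<alpha> 0 \<or> v = \<alpha> (Suc p)" using strip.degree_le_2[OF S v(2)] v(3) by (simp add: nb_def)
      then show ?thesis
        using strip.degree_left[OF S] strip.degree_left[OF strip.mirror[OF S]] by (auto simp: nb_def)
    qed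
    then obtain x y where xy: "adj ! v = [x, y]"
      using length_adj[OF v(1)] by (auto simp: length_Suc_conv numeral_2_eq_2)
    then have nb_v: "{w. {v, w} \<in> E} = {x, y}" and "x \<noteq> y"
      using adj_nth[OF v(1)] by (auto simp: nb_def)
    \<comment> \<open>The strip for the traversal is fixed only now, adapted to the vertex found and
      to the order of its list.\<close>
    from two_path_strip_from[OF two_path v(2) this]
    obtain \<alpha> \<beta> a b p q m s e where S: "strip V E \<alpha> \<beta> a b p q m s e" "\<alpha> 0 = v" "\<alpha> 1 = x" "\<beta> 1 = y" .
    have "machine V E adj n W \<alpha> \<beta> a b p q m s e"
      using machine_input_axioms S(1) by (simp add: machine_def)
    from machine.traverse_correct[OF this, of R M] show ?thesis
      using I S xy by (simp add: v_def)
  qed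
  have init: "runs W init_prog (\<lambda>_. 0) M0 (cost init_prog)
      (\<lambda>R M. K R \<and> R 12 = 0 \<and> R 13 = 0 \<and> R 14 = off 0 \<and> sums M 0)"
    by (rule wp_runs[OF init_correct])
  \<comment> \<open>\<open>find_correct\<close> treats the initialisation and the search loop as one
    unit, while the program is nested to the right.\<close>
  have assoc: "runs W (Seq c (Seq d f)) R M T Q" if "runs W (Seq (Seq c d) f) R M T Q" for c d f R M T Q
    using that unfolding runs_def by (auto elim!: exec_elims(4) intro!: exec.Seq simp: add.assoc) (metis exec.Seq add.assoc)
  let ?find = "block [Assign 12 (Const 0), degree_prog 12 17]"
  have find: "runs W (Seq ?find (Seq (WhileLess 4 17 find_body) ?rest)) R M
      (cost ?find + (n * Suc (cost find_body) + 1) + (300 * n + 300)) (\<lambda>R M. R 0 = num_TDDP V E)"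
    if "K R \<and> sums M n" for R M
    by (rule assoc, rule runs_Seq[OF find_correct rest]) (use that ex in auto)
  show ?thesis
    unfolding TDDP_prog_def
    by (rule runs_weaken[OF runs_Seq[OF init runs_Seq[OF sum_correct find]]])
      (use n_ge_4 in \<open>auto simp: init_prog_def sum_body_def find_body_def degree_prog_def\<close>)
qed

theorem theorem6:
  "\<exists>(c :: prog) (k :: nat) (d :: nat).
     \<forall>(V :: nat set) (E :: nat set set) (adj :: nat list list).
       two_path V E \<and> adjacency_lists V E adj \<longrightarrow>
       (\<exists>t R M. exec (card V ^ d) c (initial_state adj) t (R, M) \<and>
                t \<le> k * card V \<and> R 0 = num_TDDP V E)"
\<comment> \<open>The time constant 1000 is a round upper bound for the sum of all costs. From n
  \<ge> 4 follows n^4 \<ge> 16 n^2, which exceeds both 2 n^2 and 16 n; so exponent 4 meets the word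
  size assumptions for every input.\<close>
proof (rule exI[of _ TDDP_prog], rule exI[of _ 1000], rule exI[of _ 4], intro allI impI)
  fix V :: "nat set" and E adj
  assume *: "two_path V E \<and> adjacency_lists V E adj"
  then have V: "V = {..<length adj}" by (simp add: adjacency_lists_def)
  then have card: "card V = length adj" by simp
  obtain \<alpha> \<beta> a b p q m s e where S: "strip V E \<alpha> \<beta> a b p q m s e" using two_path_strip * by blast
  have n: "4 \<le> card V" using strip.card_V[OF S] strip.p_ge_1[OF S] strip.q_ge_1[OF S] by simp
  have "4 ^ 2 * card V ^ 2 \<le> card V ^ 2 * card V ^ 2" using n by (intro mult_right_mono power_mono) auto
  then have sq: "16 * (card V * card V) \<le> card V ^ 4" by (simp add: power2_eq_square power4_eq_xxxx mult.assoc)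
  have "4 * card V \<le> card V * card V" using n by (rule mult_right_mono) simp
  then have "16 * card V < card V ^ 4" "2 * (card V * card V) < card V ^ 4" using sq n by linarith+
  then interpret machine_input V E adj "card V" "card V ^ 4"
    using * card by unfold_locales auto
  have "initial_state adj = (\<lambda>_. 0, M0)" by (simp add: M0_def initial_state_def)
  then show "\<exists>t R M. exec (card V ^ 4) TDDP_prog (initial_state adj) t (R, M) \<and>
      t \<le> 1000 * card V \<and> R 0 = num_TDDP V E"
    using TDDP_prog_correct unfolding runs_def by metis
qed

end
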